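(* Let $f:\mathbb{S}^{n-1}\to\mathbb{R}^{n+1}_1$ be a spacelike embedding. The following are equivalent: (1) $f$ is L-convex; (2) $\tau_\ell(\mathbb{S}^{n-1},f)=2$; (3) $f$ is L-tight. Moreover, condition (4) $\tau^+_\ell(\mathbb{S}^{n-1},f)=\tau^-_\ell(\mathbb{S}^{n-1},f)=1$ implies (2); and if $n$ is odd or $\pi\circ f:\mathbb{S}^{n-1}\to\mathbb{R}^n_0$ is an embedding, then (2) implies (4).
   Context: $\mathbb{R}^{n+1}_1$ is $\mathbb{R}^{n+1}$ with $\langle x,y\rangle=-x_0y_0+\sum_{i=1}^n x_iy_i$; $\pi(x_0,\dots,x_n)=(0,x_1,\dots,x_n)\in\mathbb{R}^n_0=\{x_0=0\}$. Spacelike embedding: each $df(T_pM)$ consists of vectors with $\langle v,v\rangle>0$; $M=\mathbb{S}^{n-1}$ gets the induced metric and volume element $d\mathfrak{v}_M$. The normal space $N_p(M)$ (pseudo-orthogonal complement) is a Lorentzian plane. Choose a smooth future directed unit timelike normal field $n^T$ ($\langle n^T,n^T\rangle=-1$, $n^T_0>0$) and a smooth unit spacelike normal field $n^S$ with $\langle n^S,n^T\rangle=0$; then $N_1(M)[n^T]=\{(p,\pm n^S(p))\}$ with fibers $N_1(M)_p[n^T]=\{\xi\in N_p(M):\langle\xi,\xi\rangle=1,\langle\xi,n^T(p)\rangle=0\}$. For nonzero lightlike $x$, $\widetilde x=x/x_0\in\mathbb{S}^{n-1}_+=\{x:\langle x,x\rangle=0,x_0=1\}$. $\widetilde{\mathbb{LG}}_\pm(p)=\widetilde{n^T(p)\pm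 n^S(p)}$, $\widetilde K^\pm_\ell(p)=\det(-\pi^\tau\circ d_p\widetilde{\mathbb{LG}}_\pm)$ with $\pi^\tau$ the projection $df(T_pM)\oplus N_p(M)\to df(T_pM)$; $\tau^\pm_\ell(M,f)=\frac{1}{\gamma_{n-1}}\int_M|\widetilde K^\pm_\ell|\,d\mathfrak{v}_M$, $\gamma_{n-1}$ the volume of the unit $(n-1)$-sphere. In general $\tau_\ell(M,f)=\frac{1}{\gamma_{n-1}}\int_{N_1(M)[n^T]}|\widetilde K_\ell(n^T)|\,d\mathfrak{v}_{N_1(M)[n^T]}$, where $\widetilde K_\ell(n^T)(p,\xi)=\det(-\Pi^\tau\circ d_{(p,\xi)}\widetilde{\mathbb{LG}}(n^T))$, $\widetilde{\mathbb{LG}}(n^T)(p,\xi)=\widetilde{n^T(p)+\xi}$, $T_{(p,\xi)}N_1(M)[n^T]$ is identified with $T_pM\oplus\{\eta\in N_p(M):\langle\eta,\xi\rangle=\langle\eta,n^T(p)\rangle=0\}$ with induced metric, and $\Pi^\tau$ is projection along $\mathrm{span}\{n^T(p),\xi\}$; here this gives $\tau_\ell=\tau^+_\ell+\tau^-_\ell$. Lightcone height functions: $h_v(p)=\langle f(p),v\rangle$, $v\in\mathbb{S}^{n-1}_+$. $f$ is L-tight if every lightcone height function $h_v$ that is a Morse function has exactly $\gamma(M)$ critical points ($\gamma(M)$ the Morse number; $=2$ for spheres). $HP(v,c)=\{x:\langle x,v\rangle=c\}$. At $p$ the lightlike tangent hyperplanes are $HP(v^\pm,c^\pm)$ with $v^\pm=n^T(p)\pm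 n^S(p)$, $c^\pm=\langle f(p),v^\pm\rangle$. A hyperplane through a point of a set $K$ is a support plane of $K$ if $K$ lies in one of the two closed half-spaces it determines. $f$ is L-convex if for every $p$ both lightlike tangent hyperplanes at $f(p)$ are support planes of $f(M)$. *)

theory Defs
  imports "HOL-Analysis.Analysis"
begin

fun ddir :: "'a::real_normed_vector list \<Rightarrow> ('a \<Rightarrow> 'b::real_normed_vector) \<Rightarrow> 'a \<Rightarrow> 'b" where
  "ddir [] g = g"
| "ddir (v # vs) g = (\<lambda>x. vector_derivative (\<lambda>t. ddir vs g (x + t *\<^sub>R v)) (at 0))"

definition smooth_on :: "'a::real_normed_vector set \<Rightarrow> ('a \<Rightarrow> 'b::real_normed_vector) \<Rightarrow> bool" where
  "smooth_on U g \<longleftrightarrow> (\<forall>vs. continuous_on U (ddir vs g) \<and>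
     (\<forall>x\<in>U. \<forall>v. ((\<lambda>t. ddir vs g (x + t *\<^sub>R v)) has_vector_derivative ddir (v # vs) g x) (at 0)))"

abbreviation S :: "(real^'n) set" where "S \<equiv> sphere 0 1"

definition smooth_sphere_map :: "(real^'n \<Rightarrow> 'b::real_normed_vector) \<Rightarrow> bool" where
  "smooth_sphere_map g \<longleftrightarrow> (\<exists>U G. open U \<and> S \<subseteq> U \<and> smooth_on U G \<and> (\<forall>x\<in>S. G x = g x))"

text \<open>Standard chart of the sphere around p (w ranges over the tangent space p-perp).\<close>
definition chart :: "real^'n \<Rightarrow> real^'n \<Rightarrow> real^'n" where
  "chart p w = (p + w) /\<^sub>R norm (p + w)"

definition tangent :: "real^'n \<Rightarrow> (real^'n) set" where
  "tangent p = {v. v \<bullet> p = 0}"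

definition sdiff :: "(real^'n \<Rightarrow> 'b::real_normed_vector) \<Rightarrow> real^'n \<Rightarrow> real^'n \<Rightarrow> 'b" where
  "sdiff g p v = vector_derivative (\<lambda>t. g (chart p (t *\<^sub>R v))) (at 0)"

text \<open>Determinant of an endomorphism L of the tangent space p-perp (extended by the identity on p).\<close>
definition tdet :: "real^'n \<Rightarrow> (real^'n \<Rightarrow> real^'n) \<Rightarrow> real" where
  "tdet p L = det (matrix (\<lambda>x. L (x - (x \<bullet> p) *\<^sub>R p) + (x \<bullet> p) *\<^sub>R p))"

text \<open>Integral over the sphere w.r.t. its standard (n-1)-dimensional volume, via polar coordinates.\<close>
definition sphere_integral :: "(real^'n \<Rightarrow> real) \<Rightarrow> real" where
  "sphere_integral \<phi> = real CARD('n) * integral (ball 0 1) (\<lambda>x. \<phi> (x /\<^sub>R norm x))"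

definition gamma_sphere :: "'n::finite itself \<Rightarrow> real" where
  "gamma_sphere _ = sphere_integral (\<lambda>x::real^'n. 1)"

definition lor :: "real \<times> (real^'n) \<Rightarrow> real \<times> (real^'n) \<Rightarrow> real" where
  "lor x y = - fst x * fst y + snd x \<bullet> snd y"

definition proj0 :: "real \<times> (real^'n) \<Rightarrow> real \<times> (real^'n)" where
  "proj0 x = (0, snd x)"

definition lightcone_plus :: "(real \<times> (real^'n)) set" where
  "lightcone_plus = {x. lor x x = 0 \<and> fst x = 1}"

definition tilde :: "real \<times> (real^'n) \<Rightarrow> real \<times> (real^'n)" where
  "tilde x = x /\<^sub>R fst x"

definition spacelike_embedding :: "(real^'n \<Rightarrow> real \<times> (real^'n)) \<Rightarrow> bool" where
  "spacelike_embedding f \<longleftrightarrow> smooth_sphere_map f \<and> inj_on f S \<and>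
     (\<forall>p\<in>S. \<forall>v\<in>tangent p. v \<noteq> 0 \<longrightarrow> lor (sdiff f p v) (sdiff f p v) > 0)"

definition normal_space :: "(real^'n \<Rightarrow> real \<times> (real^'n)) \<Rightarrow> real^'n \<Rightarrow> (real \<times> (real^'n)) set" where
  "normal_space f p = {x. \<forall>v\<in>tangent p. lor x (sdiff f p v) = 0}"

definition normal_frame :: "(real^'n \<Rightarrow> real \<times> (real^'n)) \<Rightarrow> (real^'n \<Rightarrow> real \<times> (real^'n))
    \<Rightarrow> (real^'n \<Rightarrow> real \<times> (real^'n)) \<Rightarrow> bool" where
  "normal_frame f nT nS \<longleftrightarrow> smooth_sphere_map nT \<and> smooth_sphere_map nS \<and>
     (\<forall>p\<in>S. nT p \<in> normal_space f p \<and> nS p \<in> normal_space f p \<and>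
        lor (nT p) (nT p) = -1 \<and> fst (nT p) > 0 \<and> lor (nS p) (nS p) = 1 \<and> lor (nS p) (nT p) = 0)"

definition proj_tan :: "(real^'n \<Rightarrow> real \<times> (real^'n)) \<Rightarrow> real^'n \<Rightarrow> real \<times> (real^'n) \<Rightarrow> real \<times> (real^'n)" where
  "proj_tan f p x = (THE y. y \<in> sdiff f p ` tangent p \<and> x - y \<in> normal_space f p)"

definition dinv :: "(real^'n \<Rightarrow> real \<times> (real^'n)) \<Rightarrow> real^'n \<Rightarrow> real \<times> (real^'n) \<Rightarrow> real^'n" where
  "dinv f p y = (THE w. w \<in> tangent p \<and> sdiff f p w = y)"

definition LG :: "(real^'n \<Rightarrow> real \<times> (real^'n)) \<Rightarrow> (real^'n \<Rightarrow> real \<times> (real^'n)) \<Rightarrow> real \<Rightarrow> real^'n \<Rightarrow> real \<times> (real^'n)" where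
  "LG nT nS sg p = tilde (nT p + sg *\<^sub>R nS p)"

text \<open>Normalized lightcone Gauss-Kronecker curvature: det(-pi^tau o dLG), as an endomorphism
  of df(T_pM) identified with T_pM via df_p.\<close>
definition Kl :: "(real^'n \<Rightarrow> real \<times> (real^'n)) \<Rightarrow> (real^'n \<Rightarrow> real \<times> (real^'n)) \<Rightarrow> (real^'n \<Rightarrow> real \<times> (real^'n))
    \<Rightarrow> real \<Rightarrow> real^'n \<Rightarrow> real" where
  "Kl f nT nS sg p = tdet p (\<lambda>u. dinv f p (- proj_tan f p (sdiff (LG nT nS sg) p u)))"

text \<open>Induced metric g_p on T_pM as a self-adjoint endomorphism w.r.t. the Euclidean product;
  sqrt (det g) is the density of dv_M w.r.t. the standard volume of the sphere.\<close>
definition gram :: "(real^'n \<Rightarrow> real \<times> (real^'n)) \<Rightarrow> real^'n \<Rightarrow> real^'n \<Rightarrow> real^'n" where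
  "gram f p u = (THE w. w \<in> tangent p \<and> (\<forall>z\<in>tangent p. w \<bullet> z = lor (sdiff f p u) (sdiff f p z)))"

definition integral_M :: "(real^'n \<Rightarrow> real \<times> (real^'n)) \<Rightarrow> (real^'n \<Rightarrow> real) \<Rightarrow> real" where
  "integral_M f \<phi> = sphere_integral (\<lambda>p. \<phi> p * sqrt (tdet p (gram f p)))"

definition tau_l :: "(real^'n \<Rightarrow> real \<times> (real^'n)) \<Rightarrow> (real^'n \<Rightarrow> real \<times> (real^'n)) \<Rightarrow> (real^'n \<Rightarrow> real \<times> (real^'n))
    \<Rightarrow> real \<Rightarrow> real" where
  "tau_l f nT nS sg = integral_M f (\<lambda>p. \<bar>Kl f nT nS sg p\<bar>) / gamma_sphere TYPE('n)"

text \<open>tau_l = tau_l^+ + tau_l^- (integral over N_1(M)[n^T] = two sections (p, \<plusminus>n^S(p))).\<close>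
definition tau_total :: "(real^'n \<Rightarrow> real \<times> (real^'n)) \<Rightarrow> (real^'n \<Rightarrow> real \<times> (real^'n)) \<Rightarrow> (real^'n \<Rightarrow> real \<times> (real^'n)) \<Rightarrow> real" where
  "tau_total f nT nS = tau_l f nT nS 1 + tau_l f nT nS (-1)"

definition critical :: "(real^'n \<Rightarrow> real) \<Rightarrow> real^'n \<Rightarrow> bool" where
  "critical h p \<longleftrightarrow> p \<in> S \<and> (\<forall>w\<in>tangent p. sdiff h p w = 0)"

definition hessian :: "(real^'n \<Rightarrow> real) \<Rightarrow> real^'n \<Rightarrow> real^'n \<Rightarrow> real^'n \<Rightarrow> real" where
  "hessian h p u w = vector_derivative
     (\<lambda>s. vector_derivative (\<lambda>t. h (chart p (s *\<^sub>R u + t *\<^sub>R w))) (at 0)) (at 0)"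

definition morse :: "(real^'n \<Rightarrow> real) \<Rightarrow> bool" where
  "morse h \<longleftrightarrow> (\<forall>p. critical h p \<longrightarrow>
     (\<forall>u\<in>tangent p. u \<noteq> 0 \<longrightarrow> (\<exists>w\<in>tangent p. hessian h p u w \<noteq> 0)))"

definition height :: "(real^'n \<Rightarrow> real \<times> (real^'n)) \<Rightarrow> real \<times> (real^'n) \<Rightarrow> real^'n \<Rightarrow> real" where
  "height f v p = lor (f p) v"

text \<open>Morse number of S^{n-1} is 2.\<close>
definition L_tight :: "(real^'n \<Rightarrow> real \<times> (real^'n)) \<Rightarrow> bool" where
  "L_tight f \<longleftrightarrow> (\<forall>v\<in>lightcone_plus. morse (height f v) \<longrightarrow> card {p. critical (height f v) p} = 2)"

definition support_plane :: "(real \<times> (real^'n)) set \<Rightarrow> real \<times> (real^'n) \<Rightarrow> real \<Rightarrow> bool" where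
  "support_plane K v c \<longleftrightarrow> (\<exists>x\<in>K. lor x v = c) \<and>
     ((\<forall>x\<in>K. lor x v \<le> c) \<or> (\<forall>x\<in>K. lor x v \<ge> c))"

definition L_convex :: "(real^'n \<Rightarrow> real \<times> (real^'n)) \<Rightarrow> (real^'n \<Rightarrow> real \<times> (real^'n)) \<Rightarrow> (real^'n \<Rightarrow> real \<times> (real^'n)) \<Rightarrow> bool" where
  "L_convex f nT nS \<longleftrightarrow> (\<forall>p\<in>S. \<forall>sg\<in>{1::real, -1}.
     support_plane (f ` S) (nT p + sg *\<^sub>R nS p) (lor (f p) (nT p + sg *\<^sub>R nS p)))"

definition immersed_embedding :: "(real^'n \<Rightarrow> real \<times> (real^'n)) \<Rightarrow> bool" where
  "immersed_embedding g \<longleftrightarrow> inj_on g S \<and> (\<forall>p\<in>S. \<forall>v\<in>tangent p. v \<noteq> 0 \<longrightarrow> sdiff g p v \<noteq> 0)"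

end

theory Submission
  imports Defs "HOL-Combinatorics.Permutations"
begin

text \<open>
  Write \<open>f = (f\<^sub>0, F)\<close>, let \<open>g\<^sub>\<plusminus>(p)\<close> be the spatial part of the lightcone Gauss map and, for a unit
  vector \<open>w\<close>, \<open>h\<^sub>w = F \<bullet> w - f\<^sub>0\<close>. The critical points of \<open>h\<^sub>w\<close> are the \<open>p\<close> with \<open>g\<^sub>+(p) = w\<close> or
  \<open>g\<^sub>-(p) = w\<close>, and they are nondegenerate where \<open>g\<^sub>\<plusminus>\<close> is regular; the total curvatures are the
  integrals of \<open>\<bar>Jac g\<^sub>\<plusminus>\<bar>\<close>. Let \<open>N\<^sub>\<plusminus>\<close> be the open set of \<open>p\<close> that are not extremal for \<open>h\<^sub>w\<close>,
  \<open>w = g\<^sub>\<plusminus>(p)\<close>; then L-convexity says that \<open>N\<^sub>+\<close> and \<open>N\<^sub>-\<close> are empty.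

  Maxima and minima of the \<open>h\<^sub>w\<close> already contribute 2 to the total curvature, so \<open>\<tau> = 2\<close> forces
  \<open>Jac g\<^sub>\<plusminus> = 0\<close> on \<open>N\<^sub>\<plusminus>\<close>; so does L-tightness, by Sard's theorem. Such a flat \<open>N\<^sub>\<plusminus>\<close> is empty:
  a component of a fibre of \<open>g\<^sub>\<plusminus>\<close> through a point of maximal rank is compact, consists of points of
  the same rank, and is tangent to a fixed flat, so that a linear functional attains no maximum on it.

  Conversely, if \<open>f\<close> is L-convex, connectedness of the sphere makes one of \<open>g\<^sub>\<plusminus>\<close> consist of maxima
  only and the other one of minima only. Two points over the same regular value lie on a common
  lightlike line; since \<open>f\<close> is injective, the points that are last on their lightlike line form
  a nonempty, open and closed subset of the sphere, so no two distinct points lie on one line.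
  Hence \<open>g\<^sub>\<plusminus>\<close> covers almost every direction exactly once.
\<close>

section \<open>Maps of constant rank\<close>

text \<open>Maps on the sphere are extended to the punctured space, \<open>f0\<close>,
  \<open>F\<close> and \<open>g\<close> with degree 0 and \<open>G\<close> with degree 1.
  Derivatives then live on open sets, Jacobians are n by n determinants, and volumes of the sphere
  become volumes in the punctured unit ball. The 2 contributed by extrema is a covering argument:
  every height function has a maximum and a minimum, both are critical, so the maxima alone, and
  likewise the minima alone, are mapped onto the ball by \<open>G 1\<close> and
  \<open>G (-1)\<close> together.

  The main obstacle is that the rank of \<open>g'\<close> might drop in the limit along a fibre. The
  relation d\<eta> = F . dg excludes this: differentiated once more along a fibre it gives an
  identity in which second derivatives of \<open>g\<close> occur only at the starting point. It
  survives limits, and there it embeds the kernel of \<open>g'\<close> into the complement of the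
  initial range, so the kernel cannot grow.

  In the other direction distinct points might share a Gauss image. Regularity makes their chord
  lightlike; the connectedness argument is then run for the causal order, where pairs can be both
  continued and passed to limits.\<close>

lemma dim_range_plus_kernel:
  fixes f :: "'a::euclidean_space \<Rightarrow> 'b::euclidean_space"
  assumes "linear f"
  shows "dim (range f) + dim {x. f x = 0} = DIM('a)"
proof -
  let ?K = "{x. f x = 0}"
  let ?C = "{y \<in> UNIV. \<forall>x\<in>?K. orthogonal x y}"
  have K: "subspace ?K"
    using assms by (rule linear_subspace_kernel)
  have C: "subspace ?C"
    using subspace_orthogonal_to_vectors[of ?K] by simp
  have "f ` ?C = range f"
  proof (intro set_eqI iffI)
    fix y assume "y \<in> range f"
    then obtain x where y: "y = f x" by auto
    obtain k c where kc: "k \<in> span ?K" "\<And>w. w \<in> span ?K \<Longrightarrow> orthogonal c w" "x = k + c"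
      using orthogonal_subspace_decomp_exists[of ?K x] by blast
    have "f k = 0" using kc(1) K by (simp add: span_eq_iff[THEN iffD2])
    then have "f x = f c" using kc(3) assms by (simp add: linear_add)
    moreover have "c \<in> ?C" using kc(2) by (auto simp: orthogonal_commute span_base)
    ultimately show "y \<in> f ` ?C" using y by auto
  qed auto
  moreover have "inj_on f (span ?C)"
  proof (rule inj_onI)
    fix x y assume "x \<in> span ?C" "y \<in> span ?C" "f x = f y"
    then have "x - y \<in> ?C" "f (x - y) = 0"
      using C assms by (simp_all only: span_eq_iff[THEN iffD2] subspace_diff linear_diff) auto
    then have "orthogonal (x - y) (x - y)" by auto
    then show "x = y" by (simp add: orthogonal_self)
  qed
  ultimately have "dim (range f) = dim ?C"
    using dim_image_eq[OF assms] by metis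
  then show ?thesis
    using dim_subspace_orthogonal_to_vectors[OF K subspace_UNIV] by simp
qed

section \<open>Orthogonal projection onto a subspace\<close>

definition oproj :: "'a::euclidean_space set \<Rightarrow> 'a \<Rightarrow> 'a" where
  "oproj R x = (SOME y. y \<in> R \<and> (\<forall>z\<in>R. (x - y) \<bullet> z = 0))"

lemma
  assumes "subspace R"
  shows oproj_in: "oproj R x \<in> R" and oproj_orth: "z \<in> R \<Longrightarrow> (x - oproj R x) \<bullet> z = 0"
proof -
  obtain y w where "y \<in> span R" "\<And>u. u \<in> span R \<Longrightarrow> orthogonal w u" "x = y + w"
    using orthogonal_subspace_decomp_exists[of R x] by blast
  then have "\<exists>y. y \<in> R \<and> (\<forall>z\<in>R. (x - y) \<bullet> z = 0)"
    using assms by (intro exI[of _ y]) (auto simp: orthogonal_def span_base span_eq_iff[THEN iffD2])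
  from someI_ex[OF this] show "oproj R x \<in> R" "z \<in> R \<Longrightarrow> (x - oproj R x) \<bullet> z = 0"
    unfolding oproj_def by blast+
qed

lemma oproj_eqI:
  assumes "subspace R" "y \<in> R" "\<And>z. z \<in> R \<Longrightarrow> (x - y) \<bullet> z = 0"
  shows "oproj R x = y"
proof -
  let ?d = "oproj R x - y"
  have d: "?d \<in> R" using assms oproj_in[OF assms(1)] by (simp add: subspace_diff)
  have "?d \<bullet> ?d = (x - y) \<bullet> ?d - (x - oproj R x) \<bullet> ?d" by (simp add: inner_diff_left)
  also have "\<dots> = 0" using assms(3)[OF d] oproj_orth[OF assms(1) d] by simp
  finally show ?thesis by simp
qed

lemma oproj_id: "subspace R \<Longrightarrow> x \<in> R \<Longrightarrow> oproj R x = x"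
  by (rule oproj_eqI) auto

lemma oproj_zero_iff: "subspace R \<Longrightarrow> oproj R x = 0 \<longleftrightarrow> (\<forall>z\<in>R. x \<bullet> z = 0)"
  using oproj_orth[of R _ x] by (auto intro!: oproj_eqI simp: subspace_0)

lemma linear_oproj: assumes "subspace R" shows "linear (oproj R)"
proof (rule linearI)
  fix x y :: 'a and c :: real
  show "oproj R (x + y) = oproj R x + oproj R y"
  proof (rule oproj_eqI[OF assms])
    show "oproj R x + oproj R y \<in> R" by (simp add: assms oproj_in subspace_add)
    fix z assume z: "z \<in> R"
    have "(x + y - (oproj R x + oproj R y)) \<bullet> z = (x - oproj R x) \<bullet> z + (y - oproj R y) \<bullet> z"
      by (simp add: inner_simps)
    then show "(x + y - (oproj R x + oproj R y)) \<bullet> z = 0" using oproj_orth[OF assms z] by simp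
  qed
  show "oproj R (c *\<^sub>R x) = c *\<^sub>R oproj R x"
  proof (rule oproj_eqI[OF assms])
    show "c *\<^sub>R oproj R x \<in> R" by (simp add: assms oproj_in subspace_scale)
    fix z assume z: "z \<in> R"
    have "(c *\<^sub>R x - c *\<^sub>R oproj R x) \<bullet> z = c * ((x - oproj R x) \<bullet> z)"
      by (simp add: inner_simps right_diff_distrib)
    then show "(c *\<^sub>R x - c *\<^sub>R oproj R x) \<bullet> z = 0" using oproj_orth[OF assms z] by simp
  qed
qed

lemma norm_oproj_le: assumes "subspace R" shows "norm (oproj R x) \<le> norm x"
proof -
  have "(x - oproj R x) \<bullet> oproj R x = 0" using assms oproj_orth oproj_in by blast
  then have "oproj R x \<bullet> oproj R x = x \<bullet> oproj R x" by (simp add: inner_diff_left)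
  then have "norm (oproj R x) * norm (oproj R x) \<le> norm x * norm (oproj R x)"
    by (metis norm_cauchy_schwarz power2_eq_square power2_norm_eq_inner)
  then show ?thesis by (cases "norm (oproj R x) = 0") (auto simp: mult_le_cancel_right)
qed

lemma range_oproj: "subspace R \<Longrightarrow> range (oproj R) = R"
  by (auto simp: oproj_in) (metis oproj_id rangeI)

text \<open>With \<open>\<kappa>\<close> mapping the kernel of \<open>g' q\<close> isometrically
  onto the complement of \<open>R\<close>, the map \<open>\<pi> (g x) + \<kappa> (x - q)\<close> is
  a local diffeomorphism that turns \<open>\<pi> \<circ> g\<close> into \<pi>. The rank bound then
  kills the derivative of \<open>g\<close> along the kernel of \<pi>, so \<open>g\<close> depends on
  \<open>\<pi> (g x)\<close> alone, and so does \<eta>, whose derivative factors through that of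
  \<open>g\<close>. The last two conclusions say that \<open>\<pi> \<circ> g\<close> is open onto
  \<open>R\<close> and that each kernel vector at \<open>q\<close> is the velocity of a curve in the
  fibre.\<close>

lemma constant_rank_chart:
  fixes g :: "'a::euclidean_space \<Rightarrow> 'a" and \<eta> :: "'a \<Rightarrow> real" and F :: "'a \<Rightarrow> 'a"
    and g' :: "'a \<Rightarrow> 'a \<Rightarrow> 'a" and q :: 'a
  assumes U: "open U" "q \<in> U"
    and g: "\<And>x. x \<in> U \<Longrightarrow> (g has_derivative g' x) (at x)"
    and contg: "\<And>v. continuous_on U (\<lambda>x. g' x v)"
    and \<eta>: "\<And>x. x \<in> U \<Longrightarrow> (\<eta> has_derivative (\<lambda>u. F x \<bullet> g' x u)) (at x)"
    and rank: "\<And>x. x \<in> U \<Longrightarrow> dim (range (g' x)) \<le> dim R"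
    and R: "R = range (g' q)"
    and zero: "oproj R (g q) = 0"
  obtains W \<delta> \<sigma> \<sigma>' where "open W" "q \<in> W" "W \<subseteq> U" "\<delta> > 0" "\<sigma> 0 = q"
    "\<And>\<xi>. norm \<xi> < \<delta> \<Longrightarrow> \<sigma> \<xi> \<in> U \<and> (\<sigma> has_derivative \<sigma>' \<xi>) (at \<xi>)"
    "\<And>x. x \<in> W \<Longrightarrow> norm (oproj R (g x)) < \<delta> \<and> g x = g (\<sigma> (oproj R (g x))) \<and> \<eta> x = \<eta> (\<sigma> (oproj R (g x)))"
    "\<And>x. x \<in> W \<Longrightarrow> dim (range (g' x)) = dim R"
    "\<And>x V. x \<in> W \<Longrightarrow> open V \<Longrightarrow> x \<in> V \<Longrightarrow>
       \<exists>\<epsilon>>0. \<forall>\<xi>\<in>R. norm \<xi> < \<epsilon> \<longrightarrow> (\<exists>y\<in>V. oproj R (g y) = oproj R (g x) + \<xi>)"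
    "\<And>u. g' q u = 0 \<Longrightarrow> \<exists>c. c 0 = q \<and> (c has_vector_derivative u) (at 0) \<and>
       (\<forall>\<^sub>F t in nhds 0. g (c t) = g q \<and> \<eta> (c t) = \<eta> q)"
proof -
  let ?\<pi> = "oproj R"
  have lin: "linear (g' x)" if "x \<in> U" for x
    using g[OF that] has_derivative_linear by blast
  have sR: "subspace R" unfolding R by (rule linear_subspace_image[OF lin[OF U(2)] subspace_UNIV])
  note \<pi>lin = linear_oproj[OF sR]
  have \<pi>bl: "bounded_linear ?\<pi>" using \<pi>lin by (simp add: linear_conv_bounded_linear)
  have \<pi>\<pi>: "?\<pi> (?\<pi> x) = ?\<pi> x" for x by (simp add: oproj_id oproj_in sR)
  define K where "K = {x. g' q x = 0}"
  have sK: "subspace K" unfolding K_def by (rule linear_subspace_kernel[OF lin[OF U(2)]])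
  define Rp where "Rp = {y \<in> UNIV. \<forall>x\<in>R. orthogonal x y}"
  have sRp: "subspace Rp" unfolding Rp_def using subspace_orthogonal_to_vectors[of R] by simp
  have dRp: "dim Rp + dim R = DIM('a)"
    unfolding Rp_def using dim_subspace_orthogonal_to_vectors[OF sR subspace_UNIV] by simp
  have dK: "dim R + dim K = DIM('a)"
    unfolding R K_def by (rule dim_range_plus_kernel[OF lin[OF U(2)]])
  have "dim K = dim Rp" using dRp dK by simp
  then obtain h k where h: "linear h" "h ` K = Rp" "\<And>x. x \<in> K \<Longrightarrow> norm (h x) = norm x"
    using isometries_subspaces[OF sK sRp] by metis
  define \<kappa> where "\<kappa> = (\<lambda>u. h (oproj K u))"
  have \<kappa>lin: "linear \<kappa>" unfolding \<kappa>_def using linear_compose[OF linear_oproj[OF sK] h(1)] by (simp add: o_def)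
  then have \<kappa>bl: "bounded_linear \<kappa>" by (simp add: linear_conv_bounded_linear)
  have \<kappa>Rp: "\<kappa> u \<in> Rp" for u unfolding \<kappa>_def using h(2) oproj_in[OF sK] by blast
  have \<pi>\<kappa>: "?\<pi> (\<kappa> u) = 0" for u
    unfolding oproj_zero_iff[OF sR] using \<kappa>Rp[of u] by (auto simp: Rp_def orthogonal_def inner_commute)
  define M where "M = (\<lambda>x u. ?\<pi> (g' x u) + \<kappa> u)"
  have Mbl: "bounded_linear (M x)" if "x \<in> U" for x
    unfolding M_def
    by (intro bounded_linear_add bounded_linear_compose[OF \<pi>bl] \<kappa>bl has_derivative_bounded_linear[OF g[OF that]])
  have injM: "inj (M q)"
    unfolding linear_injective_0[OF bounded_linear.linear[OF Mbl[OF U(2)]]]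
  proof safe
    fix u assume "M q u = 0"
    moreover have gR: "?\<pi> (g' q u) = g' q u" by (rule oproj_id[OF sR]) (simp add: R)
    ultimately have e: "g' q u + \<kappa> u = 0" unfolding M_def by simp
    have "?\<pi> (g' q u + \<kappa> u) = g' q u"
      using \<pi>\<kappa> by (simp add: linear_add[OF \<pi>lin] gR)
    then have "g' q u = 0" using e linear_0[OF \<pi>lin] by simp
    then have "u \<in> K" "\<kappa> u = 0" using e by (auto simp: K_def)
    then show "u = 0" using h(3)[of u] by (simp add: \<kappa>_def oproj_id[OF sK])
  qed
  define \<Psi> where "\<Psi> = (\<lambda>x. ?\<pi> (g x) + \<kappa> (x - q))"
  have \<Psi>der: "(\<Psi> has_derivative blinfun_apply (Blinfun (M x))) (at x)" if "x \<in> U" for x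
    unfolding \<Psi>_def bounded_linear_Blinfun_apply[OF Mbl[OF that]] unfolding M_def
    by (auto intro!: derivative_eq_intros bounded_linear.has_derivative[OF \<pi>bl] bounded_linear.has_derivative[OF \<kappa>bl] g[OF that])
  have contM: "continuous_on U (\<lambda>x. Blinfun (M x))"
  proof (rule continuous_on_blinfun_componentwise)
    fix i :: 'a assume "i \<in> Basis"
    have "continuous_on U (\<lambda>x. M x i)" unfolding M_def
      by (intro continuous_on_add continuous_on_const bounded_linear.continuous_on[OF \<pi>bl] contg)
    then show "continuous_on U (\<lambda>x. blinfun_apply (Blinfun (M x)) i)"
      by (rule continuous_on_eq) (simp add: bounded_linear_Blinfun_apply Mbl)
  qed
  obtain N where N: "linear N" "N \<circ> M q = id"
    using linear_injective_left_inverse[OF bounded_linear.linear[OF Mbl[OF U(2)]] injM] by blast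
  have Nbl: "bounded_linear N" using N(1) by (simp add: linear_conv_bounded_linear)
  have "Blinfun N o\<^sub>L Blinfun (M q) = id_blinfun"
    using N(2) by (intro blinfun_eqI) (simp add: bounded_linear_Blinfun_apply Nbl Mbl U fun_eq_iff)
  from inverse_function_theorem[OF U(1) \<Psi>der contM U(2) this]
  obtain U' V G G' where IF: "open U'" "U' \<subseteq> U" "q \<in> U'" "open V" "\<Psi> q \<in> V" "homeomorphism U' V \<Psi> G"
    "\<And>y. y \<in> V \<Longrightarrow> (G has_derivative (G' y)) (at y)"
    "\<And>y. y \<in> V \<Longrightarrow> G' y = inv (blinfun_apply (Blinfun (M (G y))))"
    by metis
  have \<Psi>q: "\<Psi> q = 0" by (simp add: \<Psi>_def zero linear_0[OF \<kappa>lin])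
  then obtain \<delta> where \<delta>: "\<delta> > 0" "ball 0 \<delta> \<subseteq> V" using IF(4,5) by (metis openE)
  have G: "G z \<in> U'" "\<Psi> (G z) = z" if "z \<in> V" for z
    using IF(6) that by (auto simp: homeomorphism_def)
  have G\<Psi>: "\<Psi> x \<in> V" "G (\<Psi> x) = x" if "x \<in> U'" for x
    using IF(6) that by (auto simp: homeomorphism_def)
  have \<pi>\<Psi>: "?\<pi> (\<Psi> x) = ?\<pi> (g x)" for x
    by (simp add: \<Psi>_def linear_add[OF \<pi>lin] \<pi>\<pi> \<pi>\<kappa>)
  have \<pi>g: "?\<pi> (g (G z)) = ?\<pi> z" if "z \<in> V" for z
    using \<pi>\<Psi>[of "G z"] G(2)[OF that] by simp
  define L where "L = (\<lambda>z k. g' (G z) (G' z k))"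
  have gG: "((\<lambda>z. g (G z)) has_derivative L z) (at z)" if "z \<in> V" for z
    unfolding L_def using has_derivative_compose[OF IF(7)[OF that] g] G(1)[OF that] IF(2) by blast
  have \<pi>L: "?\<pi> (L z k) = ?\<pi> k" if z: "z \<in> V" for z k
  proof -
    have "((\<lambda>z. ?\<pi> (g (G z))) has_derivative (\<lambda>k. ?\<pi> (L z k))) (at z)"
      by (rule bounded_linear.has_derivative[OF \<pi>bl gG[OF z]])
    moreover have "((\<lambda>z. ?\<pi> (g (G z))) has_derivative ?\<pi>) (at z)"
      by (rule has_derivative_transform_within_open[OF bounded_linear_imp_has_derivative[OF \<pi>bl] IF(4) z])
        (simp add: \<pi>g)
    ultimately show ?thesis using has_derivative_unique by metis
  qed
  have Llin: "linear (L z)" if "z \<in> V" for z using gG[OF that] has_derivative_linear by blast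
  have dimL: "dim (range (L z)) = dim R \<and> dim (range (g' (G z))) = dim R" if z: "z \<in> V" for z
  proof -
    have "range (L z) \<subseteq> range (g' (G z))" unfolding L_def by auto
    then have 1: "dim (range (L z)) \<le> dim (range (g' (G z)))" by (rule dim_subset)
    have "R = ?\<pi> ` range (L z)"
      using range_oproj[OF sR] \<pi>L[OF z] by (simp add: image_image)
    then have "dim R \<le> dim (range (L z))" using dim_image_le[OF \<pi>lin, of "range (L z)"] by simp
    then show ?thesis using 1 rank[of "G z"] G(1)[OF z] IF(2) by fastforce
  qed
  have kerL: "L z k = 0" if z: "z \<in> V" and k: "?\<pi> k = 0" for z k
  proof -
    have "{k. L z k = 0} = {k. ?\<pi> k = 0}"
    proof (rule subspace_dim_equal)
      show "subspace {k. L z k = 0}" "subspace {k. ?\<pi> k = 0}"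
        by (rule linear_subspace_kernel[OF Llin[OF z]], rule linear_subspace_kernel[OF \<pi>lin])
      show "{k. L z k = 0} \<subseteq> {k. ?\<pi> k = 0}" using \<pi>L[OF z] linear_0[OF \<pi>lin] by (metis (mono_tags) Collect_mono)
      show "dim {k. ?\<pi> k = 0} \<le> dim {k. L z k = 0}"
        using dim_range_plus_kernel[OF Llin[OF z]] dim_range_plus_kernel[OF \<pi>lin] dimL[OF z] range_oproj[OF sR]
        by simp
    qed
    then show ?thesis using k by auto
  qed
  \<comment> \<open>The segment from \<open>\<pi> z\<close> to \<open>z\<close> stays in the ball,
    since projections do not increase norms, and its velocity lies in the kernel of \<pi>.\<close>
  have const: "g (G z) = g (G (?\<pi> z)) \<and> \<eta> (G z) = \<eta> (G (?\<pi> z))" if z: "norm z < \<delta>" for z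
  proof -
    let ?c = "\<lambda>t. ?\<pi> z + t *\<^sub>R (z - ?\<pi> z)"
    have cV: "?c t \<in> V" if "t \<in> {0..1}" for t :: real
    proof -
      have "z \<in> ball 0 \<delta>" "?\<pi> z \<in> ball 0 \<delta>"
        using z norm_oproj_le[OF sR, of z] by auto
      then have "(1 - t) *\<^sub>R ?\<pi> z + t *\<^sub>R z \<in> ball 0 \<delta>"
        using that by (intro convexD[OF convex_ball]) auto
      also have "(1 - t) *\<^sub>R ?\<pi> z + t *\<^sub>R z = ?c t" by (simp add: algebra_simps)
      finally show ?thesis using \<delta>(2) by blast
    qed
    have pk: "?\<pi> (s *\<^sub>R (z - ?\<pi> z)) = 0" for s
      by (simp add: linear_scale[OF \<pi>lin] linear_diff[OF \<pi>lin] \<pi>\<pi>)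
    have cd: "(?c has_derivative (\<lambda>s. s *\<^sub>R (z - ?\<pi> z))) (at t within {0..1})" for t :: real
      by (auto intro!: derivative_eq_intros)
    have "\<exists>c. \<forall>t\<in>{0..1::real}. g (G (?c t)) = c"
    proof (rule has_derivative_zero_constant)
      fix t :: real assume t: "t \<in> {0..1}"
      have "((\<lambda>t. g (G (?c t))) has_derivative (\<lambda>s. L (?c t) (s *\<^sub>R (z - ?\<pi> z)))) (at t within {0..1})"
        by (rule has_derivative_compose[OF cd gG[OF cV[OF t]]])
      then show "((\<lambda>t. g (G (?c t))) has_derivative (\<lambda>h. 0)) (at t within {0..1})"
        using kerL[OF cV[OF t] pk] by simp
    qed simp
    then have "g (G (?c 1)) = g (G (?c 0))" by (metis atLeastAtMost_iff order_refl zero_le_one)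
    moreover have "\<exists>c. \<forall>t\<in>{0..1::real}. \<eta> (G (?c t)) = c"
    proof (rule has_derivative_zero_constant)
      fix t :: real assume t: "t \<in> {0..1}"
      have GU: "G (?c t) \<in> U" using G(1)[OF cV[OF t]] IF(2) by auto
      have "((\<lambda>t. G (?c t)) has_derivative (\<lambda>s. G' (?c t) (s *\<^sub>R (z - ?\<pi> z)))) (at t within {0..1})"
        by (rule has_derivative_compose[OF cd IF(7)[OF cV[OF t]]])
      from has_derivative_compose[OF this \<eta>[OF GU]]
      show "((\<lambda>t. \<eta> (G (?c t))) has_derivative (\<lambda>h. 0)) (at t within {0..1})"
        using kerL[OF cV[OF t] pk] unfolding L_def by simp
    qed simp
    then have "\<eta> (G (?c 1)) = \<eta> (G (?c 0))" by (metis atLeastAtMost_iff order_refl zero_le_one)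
    ultimately show ?thesis by simp
  qed
  have cont\<Psi>: "continuous_on U' \<Psi>" and contG: "continuous_on V G"
    using IF(6) by (auto simp: homeomorphism_def)
  define W where "W = U' \<inter> \<Psi> -` ball 0 \<delta>"
  show ?thesis
  proof
    show "open W" unfolding W_def using cont\<Psi> IF(1) by (metis Int_commute continuous_open_preimage open_ball)
    show "q \<in> W" using \<Psi>q \<delta> IF(3) by (simp add: W_def)
    show "W \<subseteq> U" using IF(2) by (auto simp: W_def)
    show "\<delta> > 0" by fact
    show "G 0 = q" using G\<Psi>(2)[OF IF(3)] \<Psi>q by simp
    show "G \<xi> \<in> U \<and> (G has_derivative G' \<xi>) (at \<xi>)" if "norm \<xi> < \<delta>" for \<xi>
      using that \<delta> G(1) IF(2,7) by (metis dist_0_norm mem_ball subsetD)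
    show "norm (?\<pi> (g x)) < \<delta> \<and> g x = g (G (?\<pi> (g x))) \<and> \<eta> x = \<eta> (G (?\<pi> (g x)))" if "x \<in> W" for x
    proof -
      have x: "x \<in> U'" "norm (\<Psi> x) < \<delta>" using that by (auto simp: W_def)
      then show ?thesis
        using const[OF x(2)] G\<Psi>(2)[OF x(1)] \<pi>\<Psi>[of x] norm_oproj_le[OF sR, of "\<Psi> x"] by simp
    qed
    show "dim (range (g' x)) = dim R" if "x \<in> W" for x
      using dimL[OF G\<Psi>(1)] G\<Psi>(2) that by (auto simp: W_def)
    show "\<exists>\<epsilon>>0. \<forall>\<xi>\<in>R. norm \<xi> < \<epsilon> \<longrightarrow> (\<exists>y\<in>T. ?\<pi> (g y) = ?\<pi> (g x) + \<xi>)"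
      if "x \<in> W" "open T" "x \<in> T" for x T
    proof -
      have x: "x \<in> U'" using that by (auto simp: W_def)
      have "open (V \<inter> G -` T)" using contG IF(4) that(2) by (metis Int_commute continuous_open_preimage)
      moreover have "\<Psi> x \<in> V \<inter> G -` T" using G\<Psi>[OF x] that by simp
      ultimately obtain \<epsilon> where \<epsilon>: "\<epsilon> > 0" "ball (\<Psi> x) \<epsilon> \<subseteq> V \<inter> G -` T" by (metis openE)
      have "\<exists>y\<in>T. ?\<pi> (g y) = ?\<pi> (g x) + \<xi>" if "\<xi> \<in> R" "norm \<xi> < \<epsilon>" for \<xi>
      proof (rule bexI[of _ "G (\<Psi> x + \<xi>)"])
        have "\<Psi> x + \<xi> \<in> ball (\<Psi> x) \<epsilon>" using that by (simp add: dist_norm)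
        then have v: "\<Psi> x + \<xi> \<in> V" and "G (\<Psi> x + \<xi>) \<in> T" using \<epsilon>(2) by auto
        then show "G (\<Psi> x + \<xi>) \<in> T" by simp
        show "?\<pi> (g (G (\<Psi> x + \<xi>))) = ?\<pi> (g x) + \<xi>"
          using \<pi>g[OF v] by (simp add: linear_add[OF \<pi>lin] \<pi>\<Psi> oproj_id[OF sR that(1)])
      qed
      then show ?thesis using \<epsilon>(1) by blast
    qed
    show "\<exists>c. c 0 = q \<and> (c has_vector_derivative u) (at 0) \<and>
       (\<forall>\<^sub>F t in nhds 0. g (c t) = g q \<and> \<eta> (c t) = \<eta> q)" if u: "g' q u = 0" for u
    \<comment> \<open>The curve runs in the kernel of \<pi>, where \<open>g \<circ> G\<close> and
      \<open>\<eta> \<circ> G\<close> are constant; its velocity is \<open>u\<close> because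
      \<open>M q u = \<kappa> u\<close>.\<close>
    proof (intro exI[of _ "\<lambda>t. G (t *\<^sub>R \<kappa> u)"] conjI)
      have G0: "G 0 = q" using G\<Psi>(2)[OF IF(3)] \<Psi>q by simp
      show "G (0 *\<^sub>R \<kappa> u) = q" using G0 by simp
      have "M q u = \<kappa> u" using u linear_0[OF \<pi>lin] by (simp add: M_def)
      then have iu: "G' 0 (\<kappa> u) = u"
        using IF(8)[of 0] IF(5) \<Psi>q G0 injM by (simp add: bounded_linear_Blinfun_apply Mbl U) (metis inv_f_f)
      have "((\<lambda>t. t *\<^sub>R \<kappa> u) has_derivative (\<lambda>t. t *\<^sub>R \<kappa> u)) (at 0)"
        by (auto intro!: derivative_eq_intros)
      moreover have "(G has_derivative G' 0) (at (0 *\<^sub>R \<kappa> u))" using IF(5,7) \<Psi>q by simp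
      ultimately have "((\<lambda>t. G (t *\<^sub>R \<kappa> u)) has_derivative (\<lambda>t. G' 0 (t *\<^sub>R \<kappa> u))) (at 0)"
        by (rule has_derivative_compose)
      moreover have "linear (G' 0)" using IF(7)[of 0] IF(5) \<Psi>q has_derivative_linear by metis
      ultimately show "((\<lambda>t. G (t *\<^sub>R \<kappa> u)) has_vector_derivative u) (at 0)"
        using iu by (simp add: has_vector_derivative_def linear_scale)
      have "((\<lambda>t. t *\<^sub>R \<kappa> u) \<longlongrightarrow> 0 *\<^sub>R \<kappa> u) (nhds 0)" by (intro tendsto_scaleR filterlim_ident tendsto_const)
      then have "\<forall>\<^sub>F t in nhds 0. norm (t *\<^sub>R \<kappa> u) < \<delta>"
        using \<delta>(1) by (auto dest: tendstoD simp: dist_norm)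
      then show "\<forall>\<^sub>F t in nhds 0. g (G (t *\<^sub>R \<kappa> u)) = g q \<and> \<eta> (G (t *\<^sub>R \<kappa> u)) = \<eta> q"
      proof eventually_elim
        case (elim t)
        have "?\<pi> (t *\<^sub>R \<kappa> u) = 0" by (simp add: linear_scale[OF \<pi>lin] \<pi>\<kappa>)
        then show ?case using const[OF elim] G0 by simp
      qed
    qed
  qed
qed

text \<open>\<open>Z\<close> stands in for the component of a fibre: it collects the fibre points
  near which (\<open>g\<close>, \<eta>) is still described by the slice \<sigma> chosen at
  \<open>q0\<close>. On the compact set of its unit vectors maximise \<open>F x \<bullet> e\<close>,
  with \<open>e\<close> orthogonal to \<open>v0\<close> and \<open>R\<close>; the codimension two in
  \<open>flat\<close> provides \<open>e\<close>. At the maximum \<open>A q\<close> maps the kernel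
  of \<open>g' q\<close> onto the complement of \<open>R\<close>, so some fibre curve has a velocity
  \<open>u\<close> with \<open>A q u = e\<close>, and along it the functional grows at rate
  \<open>e \<bullet> e\<close>.\<close>

lemma no_flat_cone:
  fixes g F :: "'a::euclidean_space \<Rightarrow> 'a" and \<eta> :: "'a \<Rightarrow> real" and g' F' :: "'a \<Rightarrow> 'a \<Rightarrow> 'a"
  assumes U: "open U" "U \<noteq> {}" "0 \<notin> U"
    and cone: "\<And>x t. x \<in> U \<Longrightarrow> t > 0 \<Longrightarrow> t *\<^sub>R x \<in> U \<and> g (t *\<^sub>R x) = g x \<and> F (t *\<^sub>R x) = F x \<and> \<eta> (t *\<^sub>R x) = \<eta> x"
    and g: "\<And>x. x \<in> U \<Longrightarrow> (g has_derivative g' x) (at x)"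
    and contg: "\<And>v. continuous_on U (\<lambda>x. g' x v)"
    and g2: "\<And>v x. x \<in> U \<Longrightarrow> (\<lambda>x. g' x v) differentiable (at x)"
    and F: "\<And>x. x \<in> U \<Longrightarrow> (F has_derivative F' x) (at x)"
    and contF: "\<And>v. continuous_on U (\<lambda>x. F' x v)"
    and \<eta>: "\<And>x. x \<in> U \<Longrightarrow> (\<eta> has_derivative (\<lambda>u. F x \<bullet> g' x u)) (at x)"
    and unit: "\<And>x. x \<in> U \<Longrightarrow> norm (g x) = 1"
    and immersed: "\<And>x u. x \<in> U \<Longrightarrow> F' x u - (F' x u \<bullet> g x) *\<^sub>R g x + (u \<bullet> x) *\<^sub>R g x = 0 \<Longrightarrow> u = 0"
    and fibre_closed: "\<And>v c. closed {x \<in> sphere 0 1 \<inter> U. g x = v \<and> \<eta> x = c}"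
    and flat: "\<And>x. x \<in> U \<Longrightarrow> dim (range (g' x)) + 2 \<le> DIM('a)"
  shows False
proof -
  have lin: "linear (g' x)" if "x \<in> U" for x
    using g[OF that] has_derivative_linear by blast
  have linF: "linear (F' x)" if "x \<in> U" for x
    using F[OF that] has_derivative_linear by blast
  obtain q0 where q0: "q0 \<in> U" and max: "\<And>x. x \<in> U \<Longrightarrow> dim (range (g' x)) \<le> dim (range (g' q0))"
  proof -
    obtain x0 where "x0 \<in> U" using U(2) by auto
    then have "\<exists>x. x \<in> U \<and> (\<forall>y. y \<in> U \<longrightarrow> dim (range (g' y)) \<le> dim (range (g' x)))"
      by (rule ex_has_greatest_nat[where b = "Suc DIM('a)"]) (auto intro: le_imp_less_Suc dim_subset_UNIV)
    then show ?thesis using that by blast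
  qed
  define R where "R = range (g' q0)"
  have sR: "subspace R" unfolding R_def by (rule linear_subspace_image[OF lin[OF q0] subspace_UNIV])
  let ?\<pi> = "oproj R"
  note \<pi>lin = linear_oproj[OF sR]
  have \<pi>bl: "bounded_linear ?\<pi>" using \<pi>lin by (simp add: linear_conv_bounded_linear)
  define v0 where "v0 = g q0"
  define c where "c = \<eta> q0"
  have gperp: "g' x u \<bullet> g x = 0" if x: "x \<in> U" for x u
  proof -
    have "((\<lambda>x. g x \<bullet> g x) has_derivative (\<lambda>u. g x \<bullet> g' x u + g' x u \<bullet> g x)) (at x)"
      by (intro has_derivative_inner g x)
    moreover have "((\<lambda>x. g x \<bullet> g x) has_derivative (\<lambda>u. 0)) (at x)"
    proof (rule has_derivative_transform_within_open[OF has_derivative_const U(1) x])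
      show "1 = g y \<bullet> g y" if "y \<in> U" for y using unit[OF that] by (simp add: dot_square_norm)
    qed
    ultimately have "(\<lambda>u. g x \<bullet> g' x u + g' x u \<bullet> g x) = (\<lambda>u. 0)" by (rule has_derivative_unique)
    from fun_cong[OF this, of u] show ?thesis by (simp add: inner_commute)
  qed
  have Rv0: "\<rho> \<bullet> v0 = 0" if "\<rho> \<in> R" for \<rho>
    using that gperp[OF q0] by (auto simp: R_def v0_def)
  have \<pi>v0: "?\<pi> v0 = 0" using Rv0 by (simp add: oproj_zero_iff[OF sR] inner_commute)
  obtain W0 \<delta> \<sigma> \<sigma>' where W0: "open W0" "q0 \<in> W0" "W0 \<subseteq> U" "\<delta> > 0" "\<sigma> 0 = q0"
    and \<sigma>: "\<And>\<xi>. norm \<xi> < \<delta> \<Longrightarrow> \<sigma> \<xi> \<in> U \<and> (\<sigma> has_derivative \<sigma>' \<xi>) (at \<xi>)"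
    and W0g: "\<And>x. x \<in> W0 \<Longrightarrow> norm (?\<pi> (g x)) < \<delta> \<and> g x = g (\<sigma> (?\<pi> (g x))) \<and> \<eta> x = \<eta> (\<sigma> (?\<pi> (g x)))"
    and W0r: "\<And>x. x \<in> W0 \<Longrightarrow> dim (range (g' x)) = dim R"
    and "\<And>x V. x \<in> W0 \<Longrightarrow> open V \<Longrightarrow> x \<in> V \<Longrightarrow>
       \<exists>\<epsilon>>0. \<forall>\<xi>\<in>R. norm \<xi> < \<epsilon> \<longrightarrow> (\<exists>y\<in>V. ?\<pi> (g y) = ?\<pi> (g x) + \<xi>)"
    and "\<And>u. g' q0 u = 0 \<Longrightarrow> \<exists>c. c 0 = q0 \<and> (c has_vector_derivative u) (at 0) \<and>
       (\<forall>\<^sub>F t in nhds 0. g (c t) = g q0 \<and> \<eta> (c t) = \<eta> q0)"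
    by (rule constant_rank_chart[OF U(1) q0 g contg \<eta> max[folded R_def] R_def \<pi>v0[unfolded v0_def]]) (assumption+, rule that)
  define good where "good x W \<longleftrightarrow> open W \<and> x \<in> W \<and> W \<subseteq> U \<and> (\<forall>y\<in>W. dim (range (g' y)) = dim R \<and>
      norm (?\<pi> (g y)) < \<delta> \<and> g y = g (\<sigma> (?\<pi> (g y))) \<and> \<eta> y = \<eta> (\<sigma> (?\<pi> (g y))))" for x W
  define Z where "Z = {x \<in> U. g x = v0 \<and> \<eta> x = c \<and> (\<exists>W. good x W)}"
  have "good q0 W0" unfolding good_def using W0 W0g W0r by blast
  then have q0Z: "q0 \<in> Z" using q0 by (auto simp: Z_def v0_def c_def)
  define D where "D w = frechet_derivative (\<lambda>x. g' x w) (at q0)" for w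
  have D: "((\<lambda>x. g' x w) has_derivative D w) (at q0)" for w
    unfolding D_def using g2[OF q0] frechet_derivative_works by blast
  \<comment> \<open>At points with \<open>\<pi> (g x) = 0\<close> this is the derivative of
    \<open>\<sigma> (\<pi> (g y))\<close>, the local map that carries a neighbourhood of
    \<open>x\<close> into the slice through \<open>q0\<close>.\<close>
  define \<tau> where "\<tau> x u = \<sigma>' 0 (?\<pi> (g' x u))" for x u
  (* On the fibre Z the second fundamental form in the directions of R is bounded away from
     degeneracy by data of q0 alone; this passes to limits and keeps the rank from dropping. *)
  have rel: "F' x u \<bullet> g' q0 w = F' q0 (\<tau> x u) \<bullet> g' q0 w - (F x - F q0) \<bullet> D w (\<tau> x u) \<and> g' x u \<in> R"
    if xZ: "x \<in> Z" for x u w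
  proof -
    obtain W where W: "good x W" using xZ by (auto simp: Z_def)
    have xW: "x \<in> W" "open W" using W by (auto simp: good_def)
    have \<xi>x: "?\<pi> (g x) = 0" using xZ \<pi>v0 by (simp add: Z_def)
    define \<theta> where "\<theta> y = \<sigma> (?\<pi> (g y))" for y
    define \<tau>y where "\<tau>y y u = \<sigma>' (?\<pi> (g y)) (?\<pi> (g' y u))" for y u
    have \<theta>: "(\<theta> has_derivative \<tau>y y) (at y)" "\<theta> y \<in> U" "y \<in> U" if "y \<in> W" for y
    proof -
      show yU: "y \<in> U" using that W by (auto simp: good_def)
      have n: "norm (?\<pi> (g y)) < \<delta>" using that W by (auto simp: good_def)
      show "\<theta> y \<in> U" using \<sigma>[OF n] by (simp add: \<theta>_def)
      show "(\<theta> has_derivative \<tau>y y) (at y)"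
        unfolding \<theta>_def \<tau>y_def using \<sigma>[OF n]
        by (intro has_derivative_compose[OF bounded_linear.has_derivative[OF \<pi>bl g[OF yU]]]) auto
    qed
    have g\<theta>: "g' y u = g' (\<theta> y) (\<tau>y y u)" if y: "y \<in> W" for y u
    proof -
      have "(g has_derivative (\<lambda>u. g' (\<theta> y) (\<tau>y y u))) (at y)"
      proof (rule has_derivative_transform_within_open[OF has_derivative_compose[OF \<theta>(1)[OF y] g[OF \<theta>(2)[OF y]]] xW(2) y])
        show "g (\<theta> z) = g z" if "z \<in> W" for z using W that unfolding good_def \<theta>_def by auto
      qed
      from has_derivative_unique[OF this g[OF \<theta>(3)[OF y]]] show ?thesis by metis
    qed
    have \<eta>\<theta>: "F y \<bullet> g' y u = F (\<theta> y) \<bullet> g' y u" if y: "y \<in> W" for y u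
    proof -
      have "(\<eta> has_derivative (\<lambda>u. F (\<theta> y) \<bullet> g' (\<theta> y) (\<tau>y y u))) (at y)"
      proof (rule has_derivative_transform_within_open[OF has_derivative_compose[OF \<theta>(1)[OF y] \<eta>[OF \<theta>(2)[OF y]]] xW(2) y])
        show "\<eta> (\<theta> z) = \<eta> z" if "z \<in> W" for z using W that unfolding good_def \<theta>_def by auto
      qed
      from has_derivative_unique[OF this \<eta>[OF \<theta>(3)[OF y]]] show ?thesis using g\<theta>[OF y] by metis
    qed
    \<comment> \<open>The two expressions for the derivative of \<eta> agree, which makes the
      difference orthogonal to the range of \<open>g' y\<close>; by maximality of the rank this is
      the range at \<open>\<theta> y\<close> too.\<close>
    have orth: "(F y - F (\<theta> y)) \<bullet> g' (\<theta> y) w = 0" if y: "y \<in> W" for y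
    proof -
      have "range (g' y) = range (g' (\<theta> y))"
      proof (rule subspace_dim_equal)
        show "subspace (range (g' y))" "subspace (range (g' (\<theta> y)))"
          by (rule linear_subspace_image[OF lin[OF \<theta>(3)[OF y]] subspace_UNIV],
              rule linear_subspace_image[OF lin[OF \<theta>(2)[OF y]] subspace_UNIV])
        show "range (g' y) \<subseteq> range (g' (\<theta> y))" using g\<theta>[OF y] by auto
        show "dim (range (g' (\<theta> y))) \<le> dim (range (g' y))"
          using max[OF \<theta>(2)[OF y]] W y by (auto simp: good_def R_def)
      qed
      then obtain u where "g' (\<theta> y) w = g' y u" by (metis rangeE rangeI)
      then show ?thesis using \<eta>\<theta>[OF y, of u] by (simp add: inner_diff_left)
    qed
    have xU: "x \<in> U" using xZ by (simp add: Z_def)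
    have \<theta>x: "\<theta> x = q0" "\<tau>y x = \<tau> x" by (simp_all add: \<theta>_def \<tau>y_def \<tau>_def \<xi>x W0(5) fun_eq_iff)
    have d1: "(\<theta> has_derivative \<tau> x) (at x)" using \<theta>(1)[OF xW(1)] \<theta>x by simp
    have "(F has_derivative F' q0) (at (\<theta> x))" "((\<lambda>x. g' x w) has_derivative D w) (at (\<theta> x))"
      using D F[OF q0] \<theta>x(1) by simp_all
    then have F\<theta>: "((\<lambda>y. F (\<theta> y)) has_derivative (\<lambda>u. F' q0 (\<tau> x u))) (at x)"
      and D\<theta>: "((\<lambda>y. g' (\<theta> y) w) has_derivative (\<lambda>u. D w (\<tau> x u))) (at x)"
      by (auto intro: has_derivative_compose[OF d1])
    \<comment> \<open>Writing the range at \<open>\<theta> y\<close> rather than at \<open>y\<close>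
      pays off here: since \<open>\<theta> x = q0\<close>, the second derivative of \<open>g\<close>
      enters only at \<open>q0\<close>.\<close>
    have "((\<lambda>y. (F y - F (\<theta> y)) \<bullet> g' (\<theta> y) w) has_derivative
       (\<lambda>u. (F x - F (\<theta> x)) \<bullet> D w (\<tau> x u) + (F' x u - F' q0 (\<tau> x u)) \<bullet> g' (\<theta> x) w)) (at x)"
      by (rule has_derivative_inner[OF has_derivative_diff[OF F[OF xU] F\<theta>] D\<theta>])
    moreover have "((\<lambda>y. (F y - F (\<theta> y)) \<bullet> g' (\<theta> y) w) has_derivative (\<lambda>u. 0)) (at x)"
      by (rule has_derivative_transform_within_open[OF has_derivative_const xW(2,1)]) (simp add: orth)
    ultimately have "(\<lambda>u. (F x - F (\<theta> x)) \<bullet> D w (\<tau> x u) + (F' x u - F' q0 (\<tau> x u)) \<bullet> g' (\<theta> x) w) = (\<lambda>u. 0)"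
      by (rule has_derivative_unique)
    from fun_cong[OF this, of u]
    have "(F x - F q0) \<bullet> D w (\<tau> x u) + (F' x u - F' q0 (\<tau> x u)) \<bullet> g' q0 w = 0"
      by (simp add: \<theta>x(1))
    moreover have "g' x u \<in> R" using g\<theta>[OF xW(1), of u] \<theta>x by (simp add: R_def)
    ultimately show ?thesis by (simp add: inner_diff_left algebra_simps)
  qed
  \<comment> \<open>The component of \<open>F' x u\<close> along \<open>g x\<close> is replaced by
    the radial component of \<open>u\<close>; \<open>immersed\<close> states that the result is
    injective.\<close>
  define A where "A x u = F' x u - (F' x u \<bullet> g x) *\<^sub>R g x + (u \<bullet> x) *\<^sub>R g x" for x u
  have Alin: "linear (A x)" if "x \<in> U" for x
    unfolding A_def using linF[OF that]
    by (intro linearI) (simp_all add: linear_add linear_scale inner_simps algebra_simps scaleR_diff_right)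
  define Rp where "Rp = {y \<in> UNIV. \<forall>x\<in>R. orthogonal x y}"
  have sRp: "subspace Rp" unfolding Rp_def using subspace_orthogonal_to_vectors[of R] by simp
  have dRp: "dim Rp + dim R = DIM('a)"
    unfolding Rp_def using dim_subspace_orthogonal_to_vectors[OF sR subspace_UNIV] by simp
  \<comment> \<open>The correction terms in \<open>A\<close> are multiples of \<open>v0\<close>,
    which is orthogonal to \<open>R\<close>, so only \<open>F' x u\<close> has to be tested against
    \<open>R\<close>.\<close>
  have kerdim: "A x ` {u. g' x u = 0} \<subseteq> Rp" "dim (A x ` {u. g' x u = 0}) = dim {u. g' x u = 0}"
    if x: "x \<in> U" "g x = v0" and k: "\<And>u \<rho>. g' x u = 0 \<Longrightarrow> \<rho> \<in> R \<Longrightarrow> F' x u \<bullet> \<rho> = 0" for x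
  proof -
    show "A x ` {u. g' x u = 0} \<subseteq> Rp"
    proof safe
      fix u assume u: "g' x u = 0"
      have "A x u \<bullet> \<rho> = 0" if "\<rho> \<in> R" for \<rho>
        using k[OF u that] Rv0[OF that] x(2) by (simp add: A_def inner_simps inner_commute)
      then show "A x u \<in> Rp" by (simp add: Rp_def orthogonal_def inner_commute)
    qed
    have "inj (A x)"
      unfolding linear_injective_0[OF Alin[OF x(1)]] unfolding A_def by (intro allI impI) (rule immersed[OF x(1)])
    then show "dim (A x ` {u. g' x u = 0}) = dim {u. g' x u = 0}"
      by (intro dim_image_eq[OF Alin[OF x(1)]]) (auto intro: inj_on_subset)
  qed
  have \<sigma>0: "bounded_linear (\<sigma>' 0)" using \<sigma>[of 0] W0(4) has_derivative_bounded_linear by auto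
  have Dbl: "bounded_linear (D w)" for w using D has_derivative_bounded_linear by blast
  have F0bl: "bounded_linear (F' q0)" using F[OF q0] has_derivative_bounded_linear by blast
  have closed: "closed (Z \<inter> sphere 0 1)"
  proof (unfold closed_sequential_limits, safe)
    fix X l assume X: "\<forall>n. X n \<in> Z \<inter> sphere 0 1" and lim: "X \<longlonglongrightarrow> l"
    have "l \<in> {x \<in> sphere 0 1 \<inter> U. g x = v0 \<and> \<eta> x = c}"
      by (rule closed_sequentially[OF fibre_closed _ lim]) (use X in \<open>auto simp: Z_def\<close>)
    then have l: "l \<in> sphere 0 1" "l \<in> U" "g l = v0" "\<eta> l = c" by auto
    then show "l \<in> sphere 0 1" by simp
    have XU: "X n \<in> U" for n using X by (auto simp: Z_def)
    have tg: "(\<lambda>n. g' (X n) u) \<longlonglongrightarrow> g' l u" for u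
      using contg[of u] lim l(2) XU by (auto simp: continuous_on_sequentially o_def)
    have tF: "(\<lambda>n. F' (X n) u) \<longlonglongrightarrow> F' l u" for u
      using contF[of u] lim l(2) XU by (auto simp: continuous_on_sequentially o_def)
    have "isCont F l" using F[OF l(2)] has_derivative_continuous by blast
    then have tF0: "(\<lambda>n. F (X n)) \<longlonglongrightarrow> F l" using lim by (simp add: isCont_tendsto_compose)
    have t\<tau>: "(\<lambda>n. \<tau> (X n) u) \<longlonglongrightarrow> \<tau> l u" for u
      unfolding \<tau>_def by (intro bounded_linear.tendsto[OF \<sigma>0] bounded_linear.tendsto[OF \<pi>bl] tg)
    have rel_l: "F' l u \<bullet> g' q0 w = F' q0 (\<tau> l u) \<bullet> g' q0 w - (F l - F q0) \<bullet> D w (\<tau> l u)" for u w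
    proof (rule LIMSEQ_unique)
      show "(\<lambda>n. F' (X n) u \<bullet> g' q0 w) \<longlonglongrightarrow> F' l u \<bullet> g' q0 w" by (intro tendsto_inner tF tendsto_const)
      have "(\<lambda>n. F' q0 (\<tau> (X n) u) \<bullet> g' q0 w - (F (X n) - F q0) \<bullet> D w (\<tau> (X n) u)) \<longlonglongrightarrow>
          F' q0 (\<tau> l u) \<bullet> g' q0 w - (F l - F q0) \<bullet> D w (\<tau> l u)"
        by (intro tendsto_intros bounded_linear.tendsto[OF F0bl] bounded_linear.tendsto[OF Dbl] t\<tau> tF0)
      moreover have eq: "(\<lambda>n. F' (X n) u \<bullet> g' q0 w) =
          (\<lambda>n. F' q0 (\<tau> (X n) u) \<bullet> g' q0 w - (F (X n) - F q0) \<bullet> D w (\<tau> (X n) u))"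
        using rel X by blast
      ultimately show "(\<lambda>n. F' (X n) u \<bullet> g' q0 w) \<longlonglongrightarrow> F' q0 (\<tau> l u) \<bullet> g' q0 w - (F l - F q0) \<bullet> D w (\<tau> l u)"
        by (simp only: eq)
    qed
    have ker0: "F' l u \<bullet> \<rho> = 0" if u0: "g' l u = 0" and \<rho>: "\<rho> \<in> R" for u \<rho>
    proof -
      have "\<tau> l u = 0" using u0 by (simp add: \<tau>_def linear_0[OF \<pi>lin] linear_0[OF bounded_linear.linear[OF \<sigma>0]])
      moreover obtain w where "\<rho> = g' q0 w" using \<rho> by (auto simp: R_def)
      ultimately show ?thesis
        using rel_l[of u w] linear_0[OF bounded_linear.linear[OF F0bl]] linear_0[OF bounded_linear.linear[OF Dbl]]
        by simp
    qed
    \<comment> \<open>For kernel vectors \<tau> vanishes, so the limiting relation gives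
      \<open>ker0\<close>. The kernel at \<open>l\<close> thus embeds into \<open>Rp\<close>, and
      the rank has not dropped.\<close>
    have "dim {u. g' l u = 0} \<le> dim Rp"
      using kerdim[OF l(2,3) ker0] dim_subset by metis
    then have "dim R \<le> dim (range (g' l))"
      using dRp dim_range_plus_kernel[OF lin[OF l(2)]] by simp
    then have dl: "dim (range (g' l)) = dim R" using max[OF l(2)] by (simp add: R_def)
    have "range (g' l) \<subseteq> R"
    proof safe
      fix u
      show "g' l u \<in> R"
        by (rule closed_sequentially[OF closed_subspace[OF sR] _ tg]) (use rel X in auto)
    qed
    then have Rl: "R = range (g' l)"
      using subspace_dim_equal[OF linear_subspace_image[OF lin[OF l(2)] subspace_UNIV] sR] dl by simp
    have \<pi>l: "?\<pi> (g l) = 0" using l(3) \<pi>v0 by simp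
    obtain W1 \<delta>1 \<sigma>1 \<sigma>1' where W1: "open W1" "l \<in> W1" "W1 \<subseteq> U" "\<delta>1 > 0" "\<sigma>1 0 = l"
      and "\<And>\<xi>. norm \<xi> < \<delta>1 \<Longrightarrow> \<sigma>1 \<xi> \<in> U \<and> (\<sigma>1 has_derivative \<sigma>1' \<xi>) (at \<xi>)"
      and W1g: "\<And>x. x \<in> W1 \<Longrightarrow> norm (?\<pi> (g x)) < \<delta>1 \<and> g x = g (\<sigma>1 (?\<pi> (g x))) \<and> \<eta> x = \<eta> (\<sigma>1 (?\<pi> (g x)))"
      and W1r: "\<And>x. x \<in> W1 \<Longrightarrow> dim (range (g' x)) = dim R"
      and W1o: "\<And>x V. x \<in> W1 \<Longrightarrow> open V \<Longrightarrow> x \<in> V \<Longrightarrow>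
       \<exists>\<epsilon>>0. \<forall>\<xi>\<in>R. norm \<xi> < \<epsilon> \<longrightarrow> (\<exists>y\<in>V. ?\<pi> (g y) = ?\<pi> (g x) + \<xi>)"
      and "\<And>u. g' l u = 0 \<Longrightarrow> \<exists>c. c 0 = l \<and> (c has_vector_derivative u) (at 0) \<and>
       (\<forall>\<^sub>F t in nhds 0. g (c t) = g l \<and> \<eta> (c t) = \<eta> l)"
      by (rule constant_rank_chart[OF U(1) l(2) g contg \<eta> max[folded R_def] Rl \<pi>l]) (assumption+, rule that)
    have "\<forall>\<^sub>F n in sequentially. X n \<in> W1" using lim W1(1,2) by (rule topological_tendstoD)
    then obtain k where k: "X k \<in> W1" by (auto simp: eventually_sequentially)
    obtain Wk where Wk: "good (X k) Wk" using X by (auto simp: Z_def)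
    have gXk: "g (X k) = v0" using X by (auto simp: Z_def)
    obtain \<epsilon> where \<epsilon>: "\<epsilon> > 0" "\<And>\<xi>. \<xi> \<in> R \<Longrightarrow> norm \<xi> < \<epsilon> \<Longrightarrow> \<exists>y\<in>W1 \<inter> Wk. ?\<pi> (g y) = \<xi>"
    proof -
      have "open (W1 \<inter> Wk)" "X k \<in> W1 \<inter> Wk" using W1(1) Wk k by (auto simp: good_def)
      from W1o[OF k this] show ?thesis using that gXk \<pi>v0 by (metis add_0)
    qed
    \<comment> \<open>On \<open>W1 \<inter> Wk\<close> both slices describe (\<open>g\<close>,
      \<eta>), and the image of this overlap covers a ball of \<open>R\<close>; so the slice of
      \<open>q0\<close> serves near \<open>l\<close> as well.\<close>
    have same: "norm \<xi> < \<delta> \<and> g (\<sigma>1 \<xi>) = g (\<sigma> \<xi>) \<and> \<eta> (\<sigma>1 \<xi>) = \<eta> (\<sigma> \<xi>)" if \<xi>: "\<xi> \<in> R" "norm \<xi> < \<epsilon>" for \<xi>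
    proof -
      obtain y where y: "y \<in> W1" "y \<in> Wk" "?\<pi> (g y) = \<xi>" using \<epsilon>(2)[OF \<xi>] by auto
      have "norm (?\<pi> (g y)) < \<delta> \<and> g y = g (\<sigma> (?\<pi> (g y))) \<and> \<eta> y = \<eta> (\<sigma> (?\<pi> (g y)))"
        using Wk y(2) unfolding good_def by blast
      then show ?thesis using W1g[OF y(1)] unfolding y(3) by auto
    qed
    define W where "W = W1 \<inter> (\<lambda>y. ?\<pi> (g y)) -` ball 0 \<epsilon>"
    have "continuous_on W1 g"
      using g W1(3) by (meson continuous_at_imp_continuous_on has_derivative_continuous subsetD)
    then have "continuous_on W1 (\<lambda>y. ?\<pi> (g y))" by (rule bounded_linear.continuous_on[OF \<pi>bl])
    then have "open W" unfolding W_def using W1(1) by (metis Int_commute continuous_open_preimage open_ball)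
    moreover have "l \<in> W" using W1(2) l(3) \<pi>v0 \<epsilon>(1) by (simp add: W_def)
    ultimately have "good l W"
      unfolding good_def using W1(3) W1r W1g same oproj_in[OF sR]
      by (auto simp: W_def) metis+
    then show "l \<in> Z" using l by (auto simp: Z_def)
  qed
  have scaleZ: "t *\<^sub>R x \<in> Z" if x: "x \<in> Z" and t: "t > 0" for x t
  proof -
    obtain W where W: "good x W" using x by (auto simp: Z_def)
    have inv: "y \<in> U \<Longrightarrow> t *\<^sub>R y \<in> U \<and> g (t *\<^sub>R y) = g y \<and> \<eta> (t *\<^sub>R y) = \<eta> y" for y
      using cone[OF _ t] by blast
    have rk: "range (g' y) = range (g' (t *\<^sub>R y))" if y: "y \<in> U" for y
    proof -
      have ty: "t *\<^sub>R y \<in> U" using inv[OF y] by simp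
      have "((\<lambda>y. g (t *\<^sub>R y)) has_derivative (\<lambda>u. g' (t *\<^sub>R y) (t *\<^sub>R u))) (at y)"
        by (rule has_derivative_compose[where f = "\<lambda>y. t *\<^sub>R y" and g = g])
          (auto intro!: derivative_eq_intros g ty)
      then have "(g has_derivative (\<lambda>u. g' (t *\<^sub>R y) (t *\<^sub>R u))) (at y)"
        by (rule has_derivative_transform_within_open[OF _ U(1) y]) (simp add: inv)
      then have e: "g' y u = g' (t *\<^sub>R y) (t *\<^sub>R u)" for u using has_derivative_unique[OF g[OF y]] by metis
      have "g' (t *\<^sub>R y) u = g' y (u /\<^sub>R t)" for u using e[of "u /\<^sub>R t"] t by simp
      then show ?thesis using e by (metis image_subset_iff rangeI subset_antisym)
    qed
    have "good (t *\<^sub>R x) ((*\<^sub>R) t ` W)"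
      unfolding good_def
    proof (intro conjI ballI)
      show "open ((*\<^sub>R) t ` W)" using W t by (intro open_scaling) (auto simp: good_def)
      show "t *\<^sub>R x \<in> (*\<^sub>R) t ` W" using W by (auto simp: good_def)
      show "(*\<^sub>R) t ` W \<subseteq> U" using W inv by (auto simp: good_def)
      fix z assume "z \<in> (*\<^sub>R) t ` W"
      then obtain y where y: "z = t *\<^sub>R y" "y \<in> W" by auto
      then have yU: "y \<in> U" using W by (auto simp: good_def)
      show "dim (range (g' z)) = dim R" using rk[OF yU] y W by (auto simp: good_def)
      show "norm (?\<pi> (g z)) < \<delta>" "g z = g (\<sigma> (?\<pi> (g z)))" "\<eta> z = \<eta> (\<sigma> (?\<pi> (g z)))"
        using inv[OF yU] y W by (auto simp: good_def)
    qed
    then show ?thesis using inv[of x] x by (auto simp: Z_def)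
  qed
  have sgnZ: "sgn x \<in> Z \<inter> sphere 0 1" "F (sgn x) = F x" if x: "x \<in> Z" for x
  proof -
    have "x \<in> U" using x by (simp add: Z_def)
    then have nz: "x \<noteq> 0" using U(3) by auto
    then show "sgn x \<in> Z \<inter> sphere 0 1" using scaleZ[OF x, of "inverse (norm x)"]
      by (simp add: sgn_div_norm norm_sgn)
    show "F (sgn x) = F x" using cone[OF \<open>x \<in> U\<close>, of "inverse (norm x)"] nz by (simp add: sgn_div_norm)
  qed
  have "dim (insert v0 R) < DIM('a)" using flat[OF q0] by (simp add: dim_insert R_def)
  then obtain e where e: "e \<noteq> 0" "\<And>y. y \<in> span (insert v0 R) \<Longrightarrow> orthogonal e y"
    using orthogonal_to_subspace_exists[of "insert v0 R"] by metis
  have ev0: "e \<bullet> v0 = 0" and eRp: "e \<in> Rp"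
    using e(2)[OF span_base] by (auto simp: Rp_def orthogonal_def) (metis inner_commute)
  have "compact (Z \<inter> sphere 0 1)"
    using closed by (metis closed_Int_compact compact_sphere inf.right_idem)
  moreover have "continuous_on (Z \<inter> sphere 0 1) (\<lambda>x. F x \<bullet> e)"
    using F by (intro continuous_intros continuous_at_imp_continuous_on ballI) (auto simp: Z_def intro: has_derivative_continuous)
  ultimately obtain q where q: "q \<in> Z" "q \<in> sphere 0 1" "\<And>x. x \<in> Z \<inter> sphere 0 1 \<Longrightarrow> F x \<bullet> e \<le> F q \<bullet> e"
  proof -
    assume "compact (Z \<inter> sphere 0 1)" "continuous_on (Z \<inter> sphere 0 1) (\<lambda>x. F x \<bullet> e)"
    moreover have "Z \<inter> sphere 0 1 \<noteq> {}" using sgnZ(1)[OF q0Z] by blast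
    ultimately obtain q where "q \<in> Z \<inter> sphere 0 1" "\<forall>x\<in>Z \<inter> sphere 0 1. F x \<bullet> e \<le> F q \<bullet> e"
      using continuous_attains_sup by metis
    then show ?thesis using that by blast
  qed
  have qU: "q \<in> U" "g q = v0" "\<eta> q = c" using q(1) by (auto simp: Z_def)
  obtain Wq where Wq: "good q Wq" using q(1) by (auto simp: Z_def)
  have dq: "dim (range (g' q)) = dim R" using Wq by (auto simp: good_def)
  have "range (g' q) \<subseteq> R" using rel[OF q(1)] by auto
  then have Rq: "R = range (g' q)"
    using subspace_dim_equal[OF linear_subspace_image[OF lin[OF qU(1)] subspace_UNIV] sR] dq by simp
  have ker0: "F' q u \<bullet> \<rho> = 0" if u0: "g' q u = 0" and \<rho>: "\<rho> \<in> R" for u \<rho>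
  proof -
    have "\<tau> q u = 0" using u0 by (simp add: \<tau>_def linear_0[OF \<pi>lin] linear_0[OF bounded_linear.linear[OF \<sigma>0]])
    moreover obtain w where "\<rho> = g' q0 w" using \<rho> by (auto simp: R_def)
    ultimately show ?thesis
      using rel[OF q(1), of u w] linear_0[OF bounded_linear.linear[OF F0bl]] linear_0[OF bounded_linear.linear[OF Dbl]]
      by simp
  qed
  have "A q ` {u. g' q u = 0} = Rp"
  proof (rule subspace_dim_equal)
    show "subspace (A q ` {u. g' q u = 0})"
      by (rule linear_subspace_image[OF Alin[OF qU(1)] linear_subspace_kernel[OF lin[OF qU(1)]]])
    show "subspace Rp" by fact
    show "A q ` {u. g' q u = 0} \<subseteq> Rp" by (rule kerdim(1)[OF qU(1,2) ker0])
    have "dim (A q ` {u. g' q u = 0}) = dim {u. g' q u = 0}" by (rule kerdim(2)[OF qU(1,2) ker0])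
    then show "dim Rp \<le> dim (A q ` {u. g' q u = 0})"
      using dRp dim_range_plus_kernel[OF lin[OF qU(1)]] dq by simp
  qed
  with eRp have "e \<in> A q ` {u. g' q u = 0}" by simp
  then obtain u where u: "g' q u = 0" "A q u = e" by auto
  have "e \<bullet> e = F' q u \<bullet> e"
  proof -
    have "A q u \<bullet> e = F' q u \<bullet> e" using ev0 qU(2) by (simp add: A_def inner_simps inner_commute)
    then show ?thesis using u(2) by simp
  qed
  then have pos: "F' q u \<bullet> e > 0" using e(1) by (metis inner_gt_zero_iff)
  have \<pi>q: "?\<pi> (g q) = 0" using qU(2) \<pi>v0 by simp
  have "\<exists>c. c 0 = q \<and> (c has_vector_derivative u) (at 0) \<and> (\<forall>\<^sub>F t in nhds 0. g (c t) = g q \<and> \<eta> (c t) = \<eta> q)"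
  proof (rule constant_rank_chart[OF U(1) qU(1) g contg \<eta> max[folded R_def] Rq \<pi>q])
    assume *: "\<And>u. g' q u = 0 \<Longrightarrow> \<exists>c. c 0 = q \<and> (c has_vector_derivative u) (at 0) \<and>
       (\<forall>\<^sub>F t in nhds 0. g (c t) = g q \<and> \<eta> (c t) = \<eta> q)"
    show ?thesis by (rule *[OF u(1)])
  qed
  then obtain cc where cc: "cc 0 = q" "(cc has_vector_derivative u) (at 0)"
     "\<forall>\<^sub>F t in nhds 0. g (cc t) = v0 \<and> \<eta> (cc t) = c" using qU by auto
  have "isCont cc 0" using cc(2) has_vector_derivative_continuous by blast
  then have "(cc \<longlongrightarrow> q) (nhds 0)" using cc(1) tendsto_at_iff_tendsto_nhds[of cc 0] by (simp add: isCont_def)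
  then have "\<forall>\<^sub>F t in nhds 0. cc t \<in> Wq" by (rule topological_tendstoD) (use Wq in \<open>auto simp: good_def\<close>)
  \<comment> \<open>\<open>Wq\<close> witnesses \<open>good\<close> at each of its points, and
    homogeneity carries the maximum from the unit vectors to all of \<open>Z\<close>.\<close>
  with cc(3) have "\<forall>\<^sub>F t in nhds 0. F (cc t) \<bullet> e \<le> F (cc 0) \<bullet> e"
  proof eventually_elim
    case (elim t)
    then have "good (cc t) Wq" using Wq by (auto simp: good_def)
    then have "cc t \<in> Z" using elim by (auto simp: Z_def good_def)
    then show ?case using q(3)[OF sgnZ(1)[OF \<open>cc t \<in> Z\<close>]] sgnZ(2)[OF \<open>cc t \<in> Z\<close>] cc(1) by simp
  qed
  then obtain d where d: "d > 0" "\<And>t. dist t 0 < d \<Longrightarrow> F (cc t) \<bullet> e \<le> F (cc 0) \<bullet> e"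
    by (auto simp: eventually_nhds_metric)
  have "((\<lambda>t. F (cc t)) has_derivative (\<lambda>s. F' q (s *\<^sub>R u))) (at 0)"
    using has_derivative_compose[of cc "\<lambda>s. s *\<^sub>R u" 0 UNIV F "F' q"] cc(1,2) F[OF qU(1)]
    by (simp add: has_vector_derivative_def)
  then have "((\<lambda>t. F (cc t) \<bullet> e) has_derivative (\<lambda>s. F' q (s *\<^sub>R u) \<bullet> e)) (at 0)"
    by (rule has_derivative_inner_left)
  then have "((\<lambda>t. F (cc t) \<bullet> e) has_real_derivative (F' q u \<bullet> e)) (at 0)"
    unfolding has_field_derivative_def
    by (rule has_derivative_eq_rhs) (simp add: fun_eq_iff linear_scale[OF linF[OF qU(1)]])
  from DERIV_local_max[OF this d(1)] d(2) have "F' q u \<bullet> e = 0" by (auto simp: dist_real_def)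
  then show False using pos by simp
qed

section \<open>Volumes of images\<close>

text \<open>The change of variables theorems of HOL-Analysis require a well-ordered index type.\<close>

typedef 'n idx = "{..<CARD('n::finite)}"
  using zero_less_card_finite by blast

instantiation idx :: (finite) linorder
begin
definition "a \<le> b \<longleftrightarrow> Rep_idx a \<le> Rep_idx b"
definition "a < b \<longleftrightarrow> Rep_idx a < Rep_idx b"
instance by standard (auto simp: less_eq_idx_def less_idx_def Rep_idx_inject)
end

instance idx :: (finite) finite
proof
  show "finite (UNIV :: 'a idx set)"
    unfolding type_definition.univ[OF type_definition_idx] by simp
qed

instance idx :: (finite) wellorder
proof -
  have "{(x :: 'a idx, y). x < y} = Wellfounded.measure Rep_idx" by (auto simp: less_idx_def)
  then have "wf {(x :: 'a idx, y). x < y}" by simp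
  then show "OFCLASS('a idx, wellorder_class)"
    by (rule wf_wellorderI) intro_classes
qed

lemma ex_bij_idx: "\<exists>e :: 'n::finite idx \<Rightarrow> 'n. bij e"
proof -
  have "card (UNIV :: 'n idx set) = card {..<CARD('n)}"
    unfolding type_definition.univ[OF type_definition_idx]
    by (rule card_image) (auto simp: inj_on_def Abs_idx_inject)
  then have "card (UNIV :: 'n idx set) = card (UNIV :: 'n set)" by simp
  then show ?thesis by (rule finite_same_card_bij[OF finite finite])
qed

definition idx_enum :: "'n::finite idx \<Rightarrow> 'n" where
  "idx_enum = (SOME e. bij e)"

lemma bij_idx_enum: "bij idx_enum"
  unfolding idx_enum_def using ex_bij_idx by (rule someI_ex)

lemma idx_enum_inv [simp]: "idx_enum (inv idx_enum j) = j"
  by (rule surj_f_inv_f[OF bij_is_surj[OF bij_idx_enum]])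

lemma inv_idx_enum [simp]: "inv idx_enum (idx_enum i) = i"
  by (rule inv_f_f[OF bij_is_inj[OF bij_idx_enum]])

section \<open>Relabelling coordinates preserves determinants and Lebesgue measure\<close>

definition to_idx :: "real^'n \<Rightarrow> real^('n idx)" where
  "to_idx x = (\<chi> i. x $ idx_enum i)"

definition from_idx :: "real^('n idx) \<Rightarrow> real^'n" where
  "from_idx y = (\<chi> j. y $ inv idx_enum j)"

lemma from_to_idx [simp]: "from_idx (to_idx x) = x"
  by (simp add: from_idx_def to_idx_def vec_eq_iff)

lemma to_from_idx [simp]: "to_idx (from_idx y) = y"
  by (simp add: from_idx_def to_idx_def vec_eq_iff)

lemma bounded_linear_to_idx: "bounded_linear to_idx"
  by (rule linear_conv_bounded_linear[THEN iffD1], rule linearI) (simp_all add: to_idx_def vec_eq_iff)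

lemma bounded_linear_from_idx: "bounded_linear from_idx"
  by (rule linear_conv_bounded_linear[THEN iffD1], rule linearI) (simp_all add: from_idx_def vec_eq_iff)

text \<open>Conjugation by \<open>e\<close> is a sign-preserving bijection between the permutations
  of the two index types, matching the Leibniz sums term by term.\<close>

lemma det_reindex:
  fixes A :: "'a::comm_ring_1^'n^'n" and e :: "'m::finite \<Rightarrow> 'n::finite"
  assumes e: "bij e"
  shows "det (\<chi> i j. A $ e i $ e j) = det A"
proof -
  have inj: "inj_on e UNIV" using e bij_is_inj by blast
  have bb: "bij_betw e UNIV UNIV" using e by simp
  let ?h = "map_permutation UNIV e"
  have hp: "?h p (e i) = e (p i)" for p i
    by (rule map_permutation_apply[OF inj]) simp
  have bij_h: "bij_betw ?h {p. p permutes (UNIV::'m set)} {p. p permutes (UNIV::'n set)}"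
  proof (rule bij_betwI[where g = "map_permutation UNIV (inv e)"])
    show "?h \<in> {p. p permutes UNIV} \<rightarrow> {p. p permutes UNIV}"
      using map_permutation_permutes[OF bb] by auto
    show "map_permutation UNIV (inv e) \<in> {p. p permutes UNIV} \<rightarrow> {p. p permutes UNIV}"
      using map_permutation_permutes[OF bij_imp_bij_inv[OF e]] by auto
    show "map_permutation UNIV (inv e) (?h p) = p" if "p \<in> {p. p permutes UNIV}" for p
      using that inj by (intro map_permutation_compose_inv[OF bb]) auto
    show "?h (map_permutation UNIV (inv e) p) = p" if "p \<in> {p. p permutes UNIV}" for p
      using that e by (intro map_permutation_compose_inv[OF bij_imp_bij_inv[OF e]]) (auto simp: bij_is_surj surj_f_inv_f)
  qed
  have "det A = (\<Sum>p\<in>{p. p permutes UNIV}. of_int (sign p) * (\<Prod>i\<in>UNIV. A $ i $ p i))"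
    by (simp add: det_def)
  also have "\<dots> = (\<Sum>p\<in>{p. p permutes (UNIV::'m set)}. of_int (sign (?h p)) * (\<Prod>i\<in>UNIV. A $ i $ ?h p i))"
    by (rule sum.reindex_bij_betw[symmetric], rule bij_h)
  also have "\<dots> = (\<Sum>p\<in>{p. p permutes (UNIV::'m set)}. of_int (sign p) * (\<Prod>i\<in>UNIV. A $ e i $ e (p i)))"
  proof (rule sum.cong[OF refl])
    fix p :: "'m \<Rightarrow> 'm" assume p: "p \<in> {p. p permutes UNIV}"
    have "sign (?h p) = sign p" using p by (intro sign_map_permutation[OF inj]) auto
    moreover have "(\<Prod>i\<in>UNIV. A $ i $ ?h p i) = (\<Prod>i\<in>UNIV. A $ e i $ ?h p (e i))"
      by (rule prod.reindex_bij_betw[symmetric]) (rule bb)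
    ultimately show "of_int (sign (?h p)) * (\<Prod>i\<in>UNIV. A $ i $ ?h p i) = of_int (sign p) * (\<Prod>i\<in>UNIV. A $ e i $ e (p i))"
      by (simp add: hp)
  qed
  finally show ?thesis by (simp add: det_def)
qed

lemma det_matrix_to_idx:
  fixes L :: "real^'n \<Rightarrow> real^'n"
  shows "det (matrix (\<lambda>y. to_idx (L (from_idx y)))) = det (matrix L)"
proof -
  have "from_idx (axis j 1) = axis (idx_enum j) 1" for j :: "'n idx"
    by (auto simp: from_idx_def vec_eq_iff axis_def)
  then have "matrix (\<lambda>y. to_idx (L (from_idx y))) = (\<chi> i j. matrix L $ idx_enum i $ idx_enum j)"
    by (simp add: matrix_def to_idx_def)
  then show ?thesis by (simp add: det_reindex[OF bij_idx_enum, of "matrix L"])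
qed

lemma lborel_to_idx: "distr lborel borel (to_idx :: real^'n \<Rightarrow> _) = lborel"
proof (rule lborel_eqI[symmetric])
  have bm: "(to_idx :: real^'n \<Rightarrow> _) \<in> borel_measurable borel"
    by (rule borel_measurable_continuous_onI[OF linear_continuous_on[OF bounded_linear_to_idx]])
  show "sets (distr lborel borel (to_idx :: real^'n \<Rightarrow> _)) = sets borel" by simp
  fix l u :: "real^('n idx)" assume lu: "\<And>b. b \<in> Basis \<Longrightarrow> l \<bullet> b \<le> u \<bullet> b"
  have lu': "l $ i \<le> u $ i" for i
    using lu[of "axis i 1"] by (simp add: inner_axis)
  have pre: "to_idx -` box l u = box (from_idx l) (from_idx u)"
  proof (intro set_eqI iffI)
    fix x assume "x \<in> to_idx -` box l u"
    then have *: "l $ i < x $ idx_enum i \<and> x $ idx_enum i < u $ i" for i by (simp add: mem_box_cart to_idx_def)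
    show "x \<in> box (from_idx l) (from_idx u)"
      unfolding mem_box_cart from_idx_def
      using *[of "inv idx_enum j" for j] by simp
  next
    fix x assume "x \<in> box (from_idx l) (from_idx u)"
    then have *: "l $ inv idx_enum j < x $ j \<and> x $ j < u $ inv idx_enum j" for j by (simp add: mem_box_cart from_idx_def)
    show "x \<in> to_idx -` box l u"
      using *[of "idx_enum i" for i] by (simp add: mem_box_cart to_idx_def)
  qed
  have P: "(\<Prod>b\<in>Basis. (u - l) \<bullet> b) = (\<Prod>i\<in>UNIV. (u - l) $ i)" for u l :: "real^'m::finite"
    by (subst prod.reindex_bij_betw[of "\<lambda>i. axis i (1::real)" UNIV, symmetric])
      (auto simp: Basis_vec_def inner_axis bij_betw_def inj_on_def axis_eq_axis)
  have "emeasure (distr lborel borel to_idx) (box l u) = emeasure lborel (box (from_idx l) (from_idx u))"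
    using bm by (subst emeasure_distr) (simp_all add: pre)
  also have "\<dots> = ennreal (\<Prod>b\<in>Basis. (from_idx u - from_idx l) \<bullet> b)"
    by (rule emeasure_lborel_box) (auto simp: Basis_vec_def inner_axis from_idx_def lu')
  also have "(\<Prod>b\<in>Basis. (from_idx u - from_idx l) \<bullet> b) = (\<Prod>j\<in>UNIV. (u - l) $ inv idx_enum j)"
    by (simp add: P) (simp add: from_idx_def)
  also have "\<dots> = (\<Prod>b\<in>Basis. (u - l) \<bullet> b)"
    unfolding P by (rule prod.reindex_bij_betw[OF bij_imp_bij_inv[OF bij_idx_enum]])
  finally show "emeasure (distr lborel borel to_idx) (box l u) = ennreal (\<Prod>b\<in>Basis. (u - l) \<bullet> b)" .
qed

text \<open>The identity of image measures makes preimages of null sets null, which is what is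
  needed to pass to the completions.\<close>

lemma bij_lborel_lebesgue:
  fixes f :: "'a::euclidean_space \<Rightarrow> 'b::euclidean_space"
  assumes f: "bounded_linear f" and eq: "distr lborel borel f = lborel"
  shows "distr lebesgue lebesgue f = lebesgue" "f \<in> lebesgue \<rightarrow>\<^sub>M lebesgue"
proof -
  have bm: "f \<in> lborel \<rightarrow>\<^sub>M lborel"
    using borel_measurable_continuous_onI[OF linear_continuous_on[OF f]] by simp
  have "distr lborel lborel f = distr lborel borel f" by (rule distr_cong) simp_all
  then have eq': "distr lebesgue lborel f = lborel"
    unfolding distr_completion[OF bm] eq .
  have bc: "f \<in> lebesgue \<rightarrow>\<^sub>M lborel" by (rule measurable_completion[OF bm])
  show "f \<in> lebesgue \<rightarrow>\<^sub>M lebesgue"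
    by (rule completion.measurable_completion2[OF bc]) (simp only: eq' subset_refl)
  have "completion (distr lebesgue lborel f) = distr lebesgue lebesgue f"
    by (rule completion.completion_distr_eq[OF bc]) (simp only: eq')
  then show "distr lebesgue lebesgue f = lebesgue" by (simp only: eq')
qed

lemma lborel_from_idx: "distr lborel borel (from_idx :: _ \<Rightarrow> real^'n) = lborel"
proof -
  have bm: "(from_idx :: _ \<Rightarrow> real^'n) \<in> borel_measurable borel"
    by (rule borel_measurable_continuous_onI[OF linear_continuous_on[OF bounded_linear_from_idx]])
  have bt: "(to_idx :: real^'n \<Rightarrow> _) \<in> lborel \<rightarrow>\<^sub>M borel"
    using borel_measurable_continuous_onI[OF linear_continuous_on[OF bounded_linear_to_idx]] by simp
  have "distr lborel borel (from_idx :: _ \<Rightarrow> real^'n) = distr (distr lborel borel to_idx) borel from_idx"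
    by (simp only: lborel_to_idx)
  also have "\<dots> = distr lborel borel (from_idx \<circ> to_idx)" by (rule distr_distr[OF bm bt])
  also have "\<dots> = distr lborel lborel (\<lambda>x. x)" by (rule distr_cong) simp_all
  also have "\<dots> = lborel" by (rule distr_id)
  finally show ?thesis .
qed

lemmas lebesgue_to_idx = bij_lborel_lebesgue(1)[OF bounded_linear_to_idx lborel_to_idx]
  and measurable_to_idx = bij_lborel_lebesgue(2)[OF bounded_linear_to_idx lborel_to_idx]
  and measurable_from_idx = bij_lborel_lebesgue(2)[OF bounded_linear_from_idx lborel_from_idx]

lemma to_idx_image: "to_idx ` X = from_idx -` X"
proof (intro set_eqI iffI)
  fix y assume "y \<in> from_idx -` X"
  then show "y \<in> to_idx ` X" by (intro image_eqI[of _ _ "from_idx y"]) simp_all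
qed auto

lemma idx_vimage: "to_idx -` (to_idx ` X) = X"
  by (rule inj_vimage_image_eq) (rule inj_on_inverseI[of _ from_idx], simp)

lemma sets_to_idx_image: "X \<in> sets lebesgue \<Longrightarrow> to_idx ` X \<in> sets lebesgue"
  using measurable_sets[OF measurable_from_idx, of X] unfolding to_idx_image by simp

lemma emeasure_to_idx_image:
  assumes "to_idx ` X \<in> sets lebesgue"
  shows "X \<in> sets lebesgue" "emeasure lebesgue (to_idx ` X) = emeasure lebesgue X"
proof -
  show "X \<in> sets lebesgue"
    using measurable_sets[OF measurable_to_idx assms] by (simp add: idx_vimage)
  have "emeasure lebesgue (to_idx ` X) = emeasure (distr lebesgue lebesgue to_idx) (to_idx ` X)"
    by (simp add: lebesgue_to_idx)
  also have "\<dots> = emeasure lebesgue X"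
    using assms by (subst emeasure_distr[OF measurable_to_idx]) (simp_all add: idx_vimage)
  finally show "emeasure lebesgue (to_idx ` X) = emeasure lebesgue X" .
qed

lemma lmeasurable_to_idx_image:
  "to_idx ` X \<in> lmeasurable \<longleftrightarrow> X \<in> lmeasurable"
  "X \<in> lmeasurable \<Longrightarrow> measure lebesgue (to_idx ` X) = measure lebesgue X"
proof -
  show "to_idx ` X \<in> lmeasurable \<longleftrightarrow> X \<in> lmeasurable"
  proof
    assume *: "to_idx ` X \<in> lmeasurable"
    note E = emeasure_to_idx_image[OF fmeasurableD[OF *]]
    show "X \<in> lmeasurable"
      by (rule fmeasurableI[OF E(1)]) (use fmeasurableD2[OF *] in \<open>simp only: E(2) top.not_eq_extremum infinity_ennreal_def\<close>)
  next
    assume *: "X \<in> lmeasurable"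
    note E = sets_to_idx_image[OF fmeasurableD[OF *]]
    show "to_idx ` X \<in> lmeasurable"
      by (rule fmeasurableI[OF E]) (use fmeasurableD2[OF *] in \<open>simp only: emeasure_to_idx_image(2)[OF E] top.not_eq_extremum infinity_ennreal_def\<close>)
  qed
  show "measure lebesgue (to_idx ` X) = measure lebesgue X" if "X \<in> lmeasurable"
    unfolding measure_def emeasure_to_idx_image(2)[OF sets_to_idx_image[OF fmeasurableD[OF that]]] ..
qed

text \<open>Nonnegativity upgrades gauge integrability to absolute integrability, so the transfer
  can be carried out for the Lebesgue integral.\<close>

lemma integral_to_idx:
  fixes \<phi> :: "real^'n \<Rightarrow> real"
  assumes X: "X \<in> sets lebesgue" and int: "\<phi> integrable_on X" and nn: "\<And>x. x \<in> X \<Longrightarrow> \<phi> x \<ge> 0"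
  shows "(\<lambda>y. \<phi> (from_idx y)) integrable_on to_idx ` X"
    "integral (to_idx ` X) (\<lambda>y. \<phi> (from_idx y)) = integral X \<phi>"
proof -
  have ai: "\<phi> absolutely_integrable_on X"
    by (rule nonnegative_absolutely_integrable_1[OF int nn])
  then have I: "integrable lebesgue (\<lambda>x. indicator X x *\<^sub>R \<phi> x)"
    by (simp add: set_integrable_def)
  let ?h = "\<lambda>y. indicator (to_idx ` X) y *\<^sub>R \<phi> (from_idx y)"
  have h: "?h (to_idx x) = indicator X x *\<^sub>R \<phi> x" for x
    by (simp add: to_idx_image indicator_def)
  have hm: "?h \<in> borel_measurable lebesgue"
  proof -
    have "?h = (\<lambda>x. indicator X x *\<^sub>R \<phi> x) \<circ> from_idx"
      by (auto simp: fun_eq_iff to_idx_image indicator_def)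
    then show ?thesis
      using measurable_comp[OF measurable_from_idx borel_measurable_integrable[OF I]] by simp
  qed
  have J: "integrable lebesgue ?h"
  proof -
    have "integrable lebesgue (\<lambda>x. ?h (to_idx x))" using I by (simp only: h)
    then have "integrable (distr lebesgue lebesgue to_idx) ?h"
      by (rule integrable_distr_eq[OF measurable_to_idx hm, THEN iffD2])
    then show ?thesis by (simp only: lebesgue_to_idx)
  qed
  then have ai': "(\<lambda>y. \<phi> (from_idx y)) absolutely_integrable_on (to_idx ` X)"
    by (simp add: set_integrable_def)
  then show "(\<lambda>y. \<phi> (from_idx y)) integrable_on to_idx ` X"
    by (rule set_lebesgue_integral_eq_integral)
  have "integral (to_idx ` X) (\<lambda>y. \<phi> (from_idx y)) = integral\<^sup>L lebesgue ?h"
    using set_lebesgue_integral_eq_integral(2)[OF ai'] by (simp only: set_lebesgue_integral_def)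
  also have "\<dots> = integral\<^sup>L lebesgue (\<lambda>x. ?h (to_idx x))"
    using integral_distr[OF measurable_to_idx hm] unfolding lebesgue_to_idx .
  also have "\<dots> = integral X \<phi>"
    using set_lebesgue_integral_eq_integral(2)[OF ai] by (simp only: h set_lebesgue_integral_def)
  finally show "integral (to_idx ` X) (\<lambda>y. \<phi> (from_idx y)) = integral X \<phi>" .
qed

text \<open>Conjugating \<open>f\<close> by \<open>to_idx\<close> changes neither measures of images
  nor determinants of derivatives, so change of variables carries over to every finite index
  type.\<close>

lemma
  fixes f :: "real^'n \<Rightarrow> real^'n"
  assumes X: "X \<in> sets lebesgue"
    and deriv: "\<And>x. x \<in> X \<Longrightarrow> (f has_derivative f' x) (at x within X)"
    and int: "(\<lambda>x. \<bar>det (matrix (f' x))\<bar>) integrable_on X"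
  shows lmeasurable_image_vec: "f ` X \<in> lmeasurable"
    and measure_image_le_vec: "measure lebesgue (f ` X) \<le> integral X (\<lambda>x. \<bar>det (matrix (f' x))\<bar>)"
    and measure_image_eq_vec: "inj_on f X \<Longrightarrow> measure lebesgue (f ` X) = integral X (\<lambda>x. \<bar>det (matrix (f' x))\<bar>)"
proof -
  define h where "h = (\<lambda>y. to_idx (f (from_idx y)))"
  define h' where "h' = (\<lambda>y v. to_idx (f' (from_idx y) (from_idx v)))"
  have im: "h ` (to_idx ` X) = to_idx ` (f ` X)" by (simp add: h_def image_image)
  have det: "\<bar>det (matrix (h' y))\<bar> = \<bar>det (matrix (f' (from_idx y)))\<bar>" for y
    unfolding h'_def by (simp add: det_matrix_to_idx)
  have d: "(h has_derivative h' y) (at y within to_idx ` X)" if "y \<in> to_idx ` X" for y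
  proof -
    have "from_idx y \<in> X" using that by (simp add: to_idx_image)
    moreover have "from_idx ` to_idx ` X = X" by (simp add: image_image)
    ultimately have "(f has_derivative f' (from_idx y)) (at (from_idx y) within from_idx ` to_idx ` X)"
      using deriv by simp
    then show ?thesis unfolding h_def h'_def
      by (intro bounded_linear.has_derivative[OF bounded_linear_to_idx]
        has_derivative_in_compose[OF bounded_linear_imp_has_derivative[OF bounded_linear_from_idx]])
  qed
  note I = integral_to_idx[OF X int abs_ge_zero]
  have int': "(\<lambda>y. \<bar>det (matrix (h' y))\<bar>) integrable_on to_idx ` X" using I(1) by (simp add: det)
  have "h ` (to_idx ` X) \<in> lmeasurable"
    by (rule measurable_differentiable_image[OF sets_to_idx_image[OF X] d int'])
  then show fm: "f ` X \<in> lmeasurable" by (simp add: im lmeasurable_to_idx_image)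
  have m: "measure lebesgue (h ` (to_idx ` X)) = measure lebesgue (f ` X)"
    unfolding im by (rule lmeasurable_to_idx_image(2)[OF fm])
  show "measure lebesgue (f ` X) \<le> integral X (\<lambda>x. \<bar>det (matrix (f' x))\<bar>)"
    using measure_differentiable_image[OF sets_to_idx_image[OF X] d int'] I(2) m by (simp add: det)
  show "measure lebesgue (f ` X) = integral X (\<lambda>x. \<bar>det (matrix (f' x))\<bar>)" if "inj_on f X"
  proof -
    have "inj_on h (to_idx ` X)"
    proof (rule inj_onI)
      fix a b assume "a \<in> to_idx ` X" "b \<in> to_idx ` X" and ab: "h a = h b"
      then have X: "from_idx a \<in> X" "from_idx b \<in> X" by auto
      have "f (from_idx a) = f (from_idx b)" using arg_cong[OF ab, of from_idx] by (simp add: h_def)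
      then have "from_idx a = from_idx b" using inj_onD[OF that _ X] by simp
      from arg_cong[OF this, of to_idx] show "a = b" by simp
    qed
    from measure_differentiable_image_eq[OF sets_to_idx_image[OF X] d this int'] I(2) m
    show ?thesis by (simp add: det)
  qed
qed

section \<open>Continuously differentiable maps\<close>

text \<open>\<open>smooth_on\<close> speaks only of directional derivatives. The increment is split
  into moves along basis vectors, and each move is controlled by the mean value inequality and the
  continuity of one partial derivative.\<close>

lemma has_derivative_directional:
  fixes G :: "'a::euclidean_space \<Rightarrow> 'b::real_normed_vector"
  assumes U: "open U" "x \<in> U"
    and d: "\<And>y v. y \<in> U \<Longrightarrow> ((\<lambda>t. G (y + t *\<^sub>R v)) has_vector_derivative D v y) (at 0)"
    and cont: "\<And>v. continuous_on U (D v)"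
  shows "(G has_derivative (\<lambda>v. D v x)) (at x)"
proof -
  have step: "\<exists>\<delta>>0. \<forall>h. norm h < \<delta> \<longrightarrow>
      norm (G (x + (\<Sum>b\<in>B. (h \<bullet> b) *\<^sub>R b)) - G x - (\<Sum>b\<in>B. (h \<bullet> b) *\<^sub>R D b x)) \<le> e * norm h"
    if "finite B" "B \<subseteq> Basis" "e > 0" for B e
    using that
  proof (induction B arbitrary: e rule: finite_induct)
    case empty
    then show ?case by (intro exI[of _ 1]) auto
  next
    case (insert b B)
    have b: "b \<in> Basis" and nb: "norm b = 1" using insert.prems by auto
    obtain \<delta>1 where \<delta>1: "\<delta>1 > 0" "\<And>h. norm h < \<delta>1 \<Longrightarrow>
      norm (G (x + (\<Sum>b\<in>B. (h \<bullet> b) *\<^sub>R b)) - G x - (\<Sum>b\<in>B. (h \<bullet> b) *\<^sub>R D b x)) \<le> (e / 2) * norm h"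
      using insert.IH[of "e / 2"] insert.prems by auto
    have "isCont (D b) x" using cont U by (simp add: continuous_on_eq_continuous_at)
    then obtain r1 where r1: "r1 > 0" "\<And>y. dist y x < r1 \<Longrightarrow> dist (D b y) (D b x) < e / 2"
      using insert.prems(2) unfolding continuous_at_eps_delta by (metis half_gt_zero)
    obtain r2 where r2: "r2 > 0" "ball x r2 \<subseteq> U" using U openE by blast
    define r where "r = min r1 r2"
    have r: "r > 0" using r1 r2 by (simp add: r_def)
    \<comment> \<open>All points met are reached from \<open>x\<close> by at most
      \<open>card B + 1\<close> moves of length at most \<open>norm h\<close>, so they stay within
      \<open>r\<close> of \<open>x\<close>.\<close>
    define \<delta> where "\<delta> = min \<delta>1 (r / (card B + 2))"
    have "norm (G (x + (\<Sum>b\<in>insert b B. (h \<bullet> b) *\<^sub>R b)) - G x - (\<Sum>b\<in>insert b B. (h \<bullet> b) *\<^sub>R D b x)) \<le> e * norm h"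
      if h: "norm h < \<delta>" for h
    proof -
      define y where "y = x + (\<Sum>b\<in>B. (h \<bullet> b) *\<^sub>R b)"
      define s where "s = h \<bullet> b"
      have sh: "\<bar>s\<bar> \<le> norm h" using Basis_le_norm[OF b] by (simp add: s_def)
      have nB: "norm (\<Sum>b\<in>B. (h \<bullet> b) *\<^sub>R b) \<le> of_nat (card B) * norm h"
        using insert.prems(1) by (intro sum_norm_bound) (auto simp: Basis_le_norm)
      have near: "y + t *\<^sub>R b \<in> ball x r" if "t \<in> closed_segment 0 s" for t
      proof -
        have "\<bar>t\<bar> \<le> \<bar>s\<bar>" using that by (auto simp: closed_segment_eq_real_ivl split: if_splits)
        then have tb: "norm (t *\<^sub>R b) \<le> norm h" using sh nb by simp
        have "norm (y + t *\<^sub>R b - x) \<le> norm (\<Sum>b\<in>B. (h \<bullet> b) *\<^sub>R b) + norm (t *\<^sub>R b)"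
          unfolding y_def by (metis add.assoc add_diff_cancel_left' norm_triangle_ineq)
        also have "\<dots> \<le> (card B + 1) * norm h" using nB tb by (simp add: algebra_simps)
        also have "\<dots> < r"
        proof -
          have "(card B + 2) * norm h < r"
            using h by (simp add: \<delta>_def pos_less_divide_eq mult.commute)
          moreover have "(card B + 1) * norm h \<le> (card B + 2) * norm h"
            by (intro mult_right_mono) auto
          ultimately show ?thesis by linarith
        qed
        finally show ?thesis by (simp add: dist_norm norm_minus_commute)
      qed
      have dG: "((\<lambda>t. G (y + t *\<^sub>R b)) has_derivative (\<lambda>u. u *\<^sub>R D b (y + t *\<^sub>R b))) (at t within closed_segment 0 s)"
        if t: "t \<in> closed_segment 0 s" for t
      proof -
        have "y + t *\<^sub>R b \<in> U" using near[OF t] r2(2) by (auto simp: r_def)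
        from d[OF this, of b]
        have "((\<lambda>u. G (y + t *\<^sub>R b + u *\<^sub>R b)) has_derivative (\<lambda>u. u *\<^sub>R D b (y + t *\<^sub>R b))) (at (t - t))"
          by (simp add: has_vector_derivative_def)
        moreover have "((\<lambda>u. u - t) has_derivative (\<lambda>u. u)) (at t)"
          by (auto intro!: derivative_eq_intros)
        ultimately have "((\<lambda>u. G (y + t *\<^sub>R b + (u - t) *\<^sub>R b)) has_derivative (\<lambda>u. u *\<^sub>R D b (y + t *\<^sub>R b))) (at t)"
          by (rule has_derivative_compose[rotated])
        then show ?thesis by (simp add: algebra_simps has_derivative_at_withinI)
      qed
      have 1: "norm (G (y + s *\<^sub>R b) - G (y + 0 *\<^sub>R b) - (s - 0) *\<^sub>R D b x) \<le> norm (s - 0) * (e / 2)"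
      proof -
        have "norm ((\<lambda>t. G (y + t *\<^sub>R b) - t *\<^sub>R D b x) s - (\<lambda>t. G (y + t *\<^sub>R b) - t *\<^sub>R D b x) 0) \<le> (e / 2) * norm (s - 0)"
        proof (rule differentiable_bound[where S = "closed_segment 0 s" and f' = "\<lambda>t u. u *\<^sub>R D b (y + t *\<^sub>R b) - u *\<^sub>R D b x"])
          show "((\<lambda>t. G (y + t *\<^sub>R b) - t *\<^sub>R D b x) has_derivative (\<lambda>u. u *\<^sub>R D b (y + t *\<^sub>R b) - u *\<^sub>R D b x)) (at t within closed_segment 0 s)"
            if "t \<in> closed_segment 0 s" for t
            by (rule has_derivative_diff[OF dG[OF that]]) (auto intro!: derivative_eq_intros)
          show "onorm (\<lambda>u. u *\<^sub>R D b (y + t *\<^sub>R b) - u *\<^sub>R D b x) \<le> e / 2" if "t \<in> closed_segment 0 s" for t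
          proof (rule onorm_bound)
            have "dist (y + t *\<^sub>R b) x < r1" using near[OF that] by (auto simp: r_def dist_commute)
            from r1(2)[OF this] have "norm (D b (y + t *\<^sub>R b) - D b x) \<le> e / 2" by (simp add: dist_norm)
            then have "\<bar>u\<bar> * norm (D b (y + t *\<^sub>R b) - D b x) \<le> \<bar>u\<bar> * (e / 2)" for u :: real
              by (rule mult_left_mono) simp
            then show "norm (u *\<^sub>R D b (y + t *\<^sub>R b) - u *\<^sub>R D b x) \<le> e / 2 * norm u" for u :: real
              unfolding scaleR_diff_right[symmetric] norm_scaleR real_norm_def by (simp only: mult.commute)
          qed (use insert.prems in simp)
        qed auto
        then show ?thesis by (simp add: algebra_simps)
      qed
      have e1: "x + (\<Sum>b\<in>insert b B. (h \<bullet> b) *\<^sub>R b) = y + s *\<^sub>R b"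
        using insert.hyps by (simp add: y_def s_def add_ac)
      have e2: "(\<Sum>b\<in>insert b B. (h \<bullet> b) *\<^sub>R D b x) = (\<Sum>b\<in>B. (h \<bullet> b) *\<^sub>R D b x) + s *\<^sub>R D b x"
        using insert.hyps by (simp add: s_def add_ac)
      have "G (y + s *\<^sub>R b) - G x - ((\<Sum>b\<in>B. (h \<bullet> b) *\<^sub>R D b x) + s *\<^sub>R D b x) =
          (G (y + s *\<^sub>R b) - G y - s *\<^sub>R D b x) + (G y - G x - (\<Sum>b\<in>B. (h \<bullet> b) *\<^sub>R D b x))"
        by simp
      from ord_eq_le_trans[OF arg_cong[OF this, of norm] norm_triangle_ineq]
      have "norm (G (y + s *\<^sub>R b) - G x - ((\<Sum>b\<in>B. (h \<bullet> b) *\<^sub>R D b x) + s *\<^sub>R D b x)) \<le>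
          norm (G (y + s *\<^sub>R b) - G y - s *\<^sub>R D b x) + norm (G y - G x - (\<Sum>b\<in>B. (h \<bullet> b) *\<^sub>R D b x))"
        .
      also have "\<dots> \<le> \<bar>s\<bar> * (e / 2) + (e / 2) * norm h"
        using 1 \<delta>1(2)[of h] h by (intro add_mono) (auto simp: \<delta>_def y_def)
      also have "\<dots> \<le> norm h * (e / 2) + (e / 2) * norm h"
        using sh insert.prems(2) by (intro add_mono mult_right_mono) auto
      also have "\<dots> = e * norm h" by (simp add: field_simps)
      finally show ?thesis unfolding e1 e2 .
    qed
    moreover have "\<delta> > 0" using \<delta>1(1) r by (simp add: \<delta>_def)
    ultimately show ?case by blast
  qed
  define L where "L = (\<lambda>h. \<Sum>b\<in>Basis. (h \<bullet> b) *\<^sub>R D b x)"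
  have bl: "bounded_linear L"
    unfolding L_def by (intro bounded_linear_sum bounded_linear_scaleR_const bounded_linear_inner_left)
  have G: "(G has_derivative L) (at x)"
    unfolding has_derivative_at_alt
  proof (intro conjI allI impI bl)
    fix e :: real assume "e > 0"
    then obtain \<delta> where \<delta>: "\<delta> > 0" "\<And>h. norm h < \<delta> \<Longrightarrow>
      norm (G (x + (\<Sum>b\<in>Basis. (h \<bullet> b) *\<^sub>R b)) - G x - (\<Sum>b\<in>Basis. (h \<bullet> b) *\<^sub>R D b x)) \<le> e * norm h"
      using step[OF finite_Basis order_refl] by blast
    show "\<exists>d>0. \<forall>y. norm (y - x) < d \<longrightarrow> norm (G y - G x - L (y - x)) \<le> e * norm (y - x)"
      using \<delta>(1) \<delta>(2)[of "y - x" for y] by (intro exI[of _ \<delta>]) (simp add: L_def euclidean_representation)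
  qed
  \<comment> \<open>\<open>L\<close> was assembled from basis directions only; for other
    \<open>v\<close> the value is read off by differentiating along the line through
    \<open>x\<close>.\<close>
  have "L v = D v x" for v
  proof -
    have "((\<lambda>t. G (x + t *\<^sub>R v)) has_derivative (\<lambda>t. L (t *\<^sub>R v))) (at 0)"
      by (rule has_derivative_compose[where f = "\<lambda>t. x + t *\<^sub>R v" and g = G]) (auto intro!: derivative_eq_intros G)
    then have "((\<lambda>t. G (x + t *\<^sub>R v)) has_vector_derivative L v) (at 0)"
      using bl by (simp add: has_vector_derivative_def linear_cmul bounded_linear.linear)
    then show ?thesis using d[OF U(2)] vector_derivative_unique_at by blast
  qed
  then have "L = (\<lambda>v. D v x)" by auto
  with G show ?thesis by simp
qed

text \<open>Derivatives are evaluated at a fixed vector \<open>v\<close> instead of being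
  operator-valued, so derivatives of every order have the same codomain and product and chain rules
  close by induction on \<open>k\<close>.\<close>

primrec Ck :: "nat \<Rightarrow> 'a::euclidean_space set \<Rightarrow> ('a \<Rightarrow> 'b::real_normed_vector) \<Rightarrow> bool" where
  "Ck 0 U f \<longleftrightarrow> continuous_on U f"
| "Ck (Suc k) U f \<longleftrightarrow> (\<exists>f'. (\<forall>x\<in>U. (f has_derivative f' x) (at x)) \<and> (\<forall>v. Ck k U (\<lambda>x. f' x v)))"

lemma Ck_continuous: "Ck k U f \<Longrightarrow> continuous_on U f"
proof (cases k)
  case (Suc j)
  moreover assume "Ck k U f"
  ultimately obtain f' where "\<forall>x\<in>U. (f has_derivative f' x) (at x)" by auto
  then show ?thesis
    by (intro continuous_at_imp_continuous_on ballI) (auto intro: has_derivative_continuous)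
qed simp

lemma Ck_Suc_imp: "Ck (Suc k) U f \<Longrightarrow> Ck k U f"
proof (induction k arbitrary: f)
  case 0
  then show ?case using Ck_continuous[of "Suc 0" U f] by simp
next
  case (Suc k)
  from Suc.prems obtain f' where f': "\<forall>x\<in>U. (f has_derivative f' x) (at x)" "\<forall>v. Ck (Suc k) U (\<lambda>x. f' x v)"
    by (subst (asm) Ck.simps(2)) blast
  have "\<forall>v. Ck k U (\<lambda>x. f' x v)" using f'(2) Suc.IH by blast
  with f'(1) show ?case by (subst Ck.simps(2)) blast
qed

lemma Ck_SucI:
  "(\<And>x. x \<in> U \<Longrightarrow> (f has_derivative f' x) (at x)) \<Longrightarrow> (\<And>v. Ck k U (\<lambda>x. f' x v)) \<Longrightarrow> Ck (Suc k) U f"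
  by auto

lemma Ck_SucE:
  assumes "Ck (Suc k) U f"
  obtains f' where "\<And>x. x \<in> U \<Longrightarrow> (f has_derivative f' x) (at x)" "\<And>v. Ck k U (\<lambda>x. f' x v)"
proof -
  from assms obtain f' where f': "\<forall>x\<in>U. (f has_derivative f' x) (at x)" "\<forall>v. Ck k U (\<lambda>x. f' x v)"
    by (subst (asm) Ck.simps(2)) blast
  show thesis by (rule that[of f']) (use f' in blast)+
qed

lemma Ck_const: "Ck k U (\<lambda>x. c)"
proof (induction k arbitrary: c)
  case (Suc k)
  show ?case by (rule Ck_SucI[of _ _ "\<lambda>_ _. 0"]) (auto intro: Suc)
qed simp

lemma Ck_linear: "bounded_linear L \<Longrightarrow> Ck k U L"
proof (cases k)
  case 0
  then show "bounded_linear L \<Longrightarrow> Ck k U L" by (simp add: linear_continuous_on)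
next
  case (Suc j)
  show "bounded_linear L \<Longrightarrow> Ck k U L"
    unfolding Suc by (rule Ck_SucI[of _ _ "\<lambda>_. L"]) (auto intro: bounded_linear_imp_has_derivative Ck_const)
qed

lemma Ck_linear_compose: "Ck k U f \<Longrightarrow> bounded_linear L \<Longrightarrow> Ck k U (\<lambda>x. L (f x))"
proof (induction k arbitrary: f)
  case 0
  then show ?case by (simp add: bounded_linear.continuous_on)
next
  case (Suc k)
  obtain f' where f': "\<And>x. x \<in> U \<Longrightarrow> (f has_derivative f' x) (at x)" "\<And>v. Ck k U (\<lambda>x. f' x v)"
    using Suc.prems(1) by (rule Ck_SucE) (rule that)
  show ?case
    by (rule Ck_SucI[of _ _ "\<lambda>x v. L (f' x v)"])
      (use f' Suc.IH Suc.prems(2) in \<open>auto intro: bounded_linear.has_derivative\<close>)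
qed

lemma Ck_add: "Ck k U f \<Longrightarrow> Ck k U g \<Longrightarrow> Ck k U (\<lambda>x. f x + g x)"
proof (induction k arbitrary: f g)
  case 0
  then show ?case by (simp add: continuous_on_add)
next
  case (Suc k)
  obtain f' where f': "\<And>x. x \<in> U \<Longrightarrow> (f has_derivative f' x) (at x)" "\<And>v. Ck k U (\<lambda>x. f' x v)"
    using Suc.prems(1) by (rule Ck_SucE) (rule that)
  obtain g' where g': "\<And>x. x \<in> U \<Longrightarrow> (g has_derivative g' x) (at x)" "\<And>v. Ck k U (\<lambda>x. g' x v)"
    using Suc.prems(2) by (rule Ck_SucE) (rule that)
  show ?case
    by (rule Ck_SucI[of _ _ "\<lambda>x v. f' x v + g' x v"])
      (use f' g' Suc.IH in \<open>auto intro: has_derivative_add\<close>)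
qed

lemma Ck_sum: "finite A \<Longrightarrow> (\<And>i. i \<in> A \<Longrightarrow> Ck k U (f i)) \<Longrightarrow> Ck k U (\<lambda>x. \<Sum>i\<in>A. f i x)"
  by (induction A rule: finite_induct) (auto intro: Ck_add Ck_const)

lemma Ck_bilinear:
  assumes B: "bounded_bilinear B"
  shows "Ck k U f \<Longrightarrow> Ck k U g \<Longrightarrow> Ck k U (\<lambda>x. B (f x) (g x))"
proof (induction k arbitrary: f g)
  case 0
  then show ?case by (simp add: bounded_bilinear.continuous_on[OF B])
next
  case (Suc k)
  obtain f' where f': "\<And>x. x \<in> U \<Longrightarrow> (f has_derivative f' x) (at x)" "\<And>v. Ck k U (\<lambda>x. f' x v)"
    using Suc.prems(1) by (rule Ck_SucE) (rule that)
  obtain g' where g': "\<And>x. x \<in> U \<Longrightarrow> (g has_derivative g' x) (at x)" "\<And>v. Ck k U (\<lambda>x. g' x v)"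
    using Suc.prems(2) by (rule Ck_SucE) (rule that)
  have fg: "Ck k U f" "Ck k U g" using Suc.prems Ck_Suc_imp by blast+
  show ?case
  proof (rule Ck_SucI[of _ _ "\<lambda>x v. B (f x) (g' x v) + B (f' x v) (g x)"])
    show "((\<lambda>x. B (f x) (g x)) has_derivative (\<lambda>v. B (f x) (g' x v) + B (f' x v) (g x))) (at x)" if "x \<in> U" for x
      by (rule bounded_bilinear.FDERIV[OF B f'(1)[OF that] g'(1)[OF that]])
    show "Ck k U (\<lambda>x. B (f x) (g' x v) + B (f' x v) (g x))" for v
      by (intro Ck_add Suc.IH fg f'(2) g'(2))
  qed
qed

lemmas Ck_scaleR = Ck_bilinear[OF bounded_bilinear_scaleR]
  and Ck_mult = Ck_bilinear[OF bounded_bilinear_mult]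
  and Ck_inner = Ck_bilinear[OF bounded_bilinear_inner]

lemma Ck_inverse:
  fixes r :: "'a::euclidean_space \<Rightarrow> real"
  assumes nz: "\<And>x. x \<in> U \<Longrightarrow> r x \<noteq> 0"
  shows "Ck k U r \<Longrightarrow> Ck k U (\<lambda>x. inverse (r x))"
proof (induction k)
  case 0
  then show ?case using nz by (auto intro: continuous_on_inverse)
next
  case (Suc k)
  obtain r' where r': "\<And>x. x \<in> U \<Longrightarrow> (r has_derivative r' x) (at x)" "\<And>v. Ck k U (\<lambda>x. r' x v)"
    using Suc.prems(1) by (rule Ck_SucE) (rule that)
  have i: "Ck k U (\<lambda>x. inverse (r x))" using Suc Ck_Suc_imp by blast
  show ?case
  proof (rule Ck_SucI[of _ _ "\<lambda>x v. (- 1) * (inverse (r x) * r' x v * inverse (r x))"])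
    show "((\<lambda>x. inverse (r x)) has_derivative (\<lambda>v. (- 1) * (inverse (r x) * r' x v * inverse (r x)))) (at x)" if "x \<in> U" for x
      using Deriv.has_derivative_inverse[OF nz[OF that] r'(1)[OF that]] by simp
    show "Ck k U (\<lambda>x. (- 1) * (inverse (r x) * r' x v * inverse (r x)))" for v
      by (intro Ck_mult Ck_const i r'(2))
  qed
qed

lemma Ck_compose:
  fixes s :: "'a::euclidean_space \<Rightarrow> 'b::euclidean_space"
  assumes sV: "\<And>x. x \<in> U \<Longrightarrow> s x \<in> V"
  shows "Ck k V f \<Longrightarrow> Ck k U s \<Longrightarrow> Ck k U (\<lambda>x. f (s x))"
proof (induction k arbitrary: f)
  case 0
  then show ?case using sV by (auto intro: continuous_on_compose2)
next
  case (Suc k)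
  obtain f' where f': "\<And>x. x \<in> V \<Longrightarrow> (f has_derivative f' x) (at x)" "\<And>v. Ck k V (\<lambda>x. f' x v)"
    using Suc.prems(1) by (rule Ck_SucE) (rule that)
  obtain s' where s': "\<And>x. x \<in> U \<Longrightarrow> (s has_derivative s' x) (at x)" "\<And>v. Ck k U (\<lambda>x. s' x v)"
    using Suc.prems(2) by (rule Ck_SucE) (rule that)
  have s: "Ck k U s" using Suc.prems Ck_Suc_imp by blast
  show ?case
  \<comment> \<open>In \<open>f' (s x) (s' x v)\<close> both arguments vary with \<open>x\<close>;
    expanding the second in the basis leaves products of functions to which the induction hypothesis
    applies.\<close>
  proof (rule Ck_SucI[of _ _ "\<lambda>x v. \<Sum>b\<in>Basis. (s' x v \<bullet> b) *\<^sub>R f' (s x) b"])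
    show "((\<lambda>x. f (s x)) has_derivative (\<lambda>v. \<Sum>b\<in>Basis. (s' x v \<bullet> b) *\<^sub>R f' (s x) b)) (at x)" if "x \<in> U" for x
    proof -
      have lin: "linear (f' (s x))" using f'(1)[OF sV[OF that]] has_derivative_linear by blast
      have "f' (s x) w = (\<Sum>b\<in>Basis. (w \<bullet> b) *\<^sub>R f' (s x) b)" for w
        by (subst (1) euclidean_representation[symmetric]) (simp only: linear_sum[OF lin] linear_scale[OF lin])
      then show ?thesis
        by (intro has_derivative_eq_rhs[OF has_derivative_compose[OF s'(1)[OF that] f'(1)[OF sV[OF that]]]] ext)
    qed
    show "Ck k U (\<lambda>x. \<Sum>b\<in>Basis. (s' x v \<bullet> b) *\<^sub>R f' (s x) b)" for v
      by (intro Ck_sum Ck_scaleR Ck_inner Ck_const s'(2) Suc.IH f'(2) s) simp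
  qed
qed

lemma Ck_cong:
  assumes "open U" "\<And>x. x \<in> U \<Longrightarrow> f x = g x"
  shows "Ck k U f \<Longrightarrow> Ck k U g"
proof (cases k)
  case 0
  then show "Ck k U f \<Longrightarrow> Ck k U g" using assms by (simp cong: continuous_on_cong)
next
  case (Suc j)
  assume "Ck k U f"
  then obtain f' where f': "\<And>x. x \<in> U \<Longrightarrow> (f has_derivative f' x) (at x)" "\<And>v. Ck j U (\<lambda>x. f' x v)"
    unfolding Suc by (rule Ck_SucE) (rule that)
  show "Ck k U g" unfolding Suc
    by (rule Ck_SucI[of _ _ f'])
      (auto intro: f' has_derivative_transform_within_open[OF f'(1) assms(1)] simp: assms(2))
qed

text \<open>The derivative of the norm involves no function other than a linear one and the inverse
  of the norm itself, so each order of smoothness yields the next.\<close>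

lemma Ck_norm: "Ck k (- {0}) (\<lambda>x::'a::euclidean_space. norm x)"
proof (induction k)
  case 0
  show ?case by (simp add: continuous_on_norm)
next
  case (Suc k)
  show ?case
  proof (rule Ck_SucI[of _ _ "\<lambda>x v. (v \<bullet> x) * inverse (norm x)"])
    show "(norm has_derivative (\<lambda>v. (v \<bullet> x) * inverse (norm x))) (at x)" if "x \<in> - {0}" for x :: 'a
      using has_derivative_norm[of x] that by (simp add: sgn_div_norm inner_commute mult.commute)
    show "Ck k (- {0}) (\<lambda>x. (v \<bullet> x) * inverse (norm x))" for v :: 'a
      by (intro Ck_mult Ck_linear bounded_linear_inner_right Ck_inverse Suc) auto
  qed
qed

lemma Ck_sgn: "Ck k (- {0}) (sgn :: 'a::euclidean_space \<Rightarrow> 'a)"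
  unfolding sgn_div_norm[abs_def]
  by (intro Ck_scaleR Ck_inverse Ck_norm Ck_linear bounded_linear_ident) auto

text \<open>\<open>ddir\<close> peels off the outermost direction, whereas the induction on
  \<open>k\<close> replaces \<open>G\<close> by one of its derivatives and so needs the innermost
  one split off.\<close>

lemma ddir_append: "ddir (vs @ [v]) g = ddir vs (ddir [v] g)"
  by (induction vs) auto

lemma smooth_on_imp_Ck:
  fixes G :: "'a::euclidean_space \<Rightarrow> 'b::real_normed_vector"
  assumes U: "open U"
  shows "smooth_on U G \<Longrightarrow> Ck k U G"
proof (induction k arbitrary: G)
  case 0
  then show ?case unfolding smooth_on_def by (metis Ck.simps(1) ddir.simps(1))
next
  case (Suc k)
  have sm: "continuous_on U (ddir vs G)"
    "x \<in> U \<Longrightarrow> ((\<lambda>t. ddir vs G (x + t *\<^sub>R v)) has_vector_derivative ddir (v # vs) G x) (at 0)" for vs x v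
    using Suc.prems unfolding smooth_on_def by blast+
  show ?case
  proof (rule Ck_SucI[of _ _ "\<lambda>x v. ddir [v] G x"])
    show "(G has_derivative (\<lambda>v. ddir [v] G x)) (at x)" if "x \<in> U" for x
      by (rule has_derivative_directional[OF U that])
        (use sm(2)[of _ "[]"] sm(1) in \<open>auto simp del: ddir.simps(2)\<close>)
    have "smooth_on U (ddir [v] G)" for v
      unfolding smooth_on_def
    proof (intro allI conjI ballI)
      fix vs x w
      show "continuous_on U (ddir vs (ddir [v] G))" using sm(1)[of "vs @ [v]"] by (simp only: ddir_append)
      assume x: "x \<in> U"
      show "((\<lambda>t. ddir vs (ddir [v] G) (x + t *\<^sub>R w)) has_vector_derivative ddir (w # vs) (ddir [v] G) x) (at 0)"
        using sm(2)[OF x, of "vs @ [v]" w] by (simp only: ddir_append append_Cons[symmetric])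
    qed
    from Suc.IH[OF this] show "Ck k U (ddir [v] G)" for v .
  qed
qed

text \<open>Composition with \<open>sgn\<close> turns an unspecified local extension into a
  canonical one, homogeneous of degree 0 on the punctured space.\<close>

lemma smooth_sphere_map_Ck:
  fixes g :: "real^'n \<Rightarrow> 'b::real_normed_vector"
  assumes "smooth_sphere_map g"
  shows "Ck k (- {0}) (\<lambda>x. g (sgn x))"
proof -
  obtain U G where U: "open U" "S \<subseteq> U" "smooth_on U G" "\<And>x. x \<in> S \<Longrightarrow> G x = g x"
    using assms unfolding smooth_sphere_map_def by blast
  have s: "sgn x \<in> S" if "x \<in> - {0}" for x :: "real^'n"
    using that by (simp add: norm_sgn)
  have "Ck k (- {0}) (\<lambda>x. G (sgn x))"
    by (rule Ck_compose[of _ _ U, OF _ smooth_on_imp_Ck[OF U(1,3)] Ck_sgn]) (use s U(2) in blast)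
  then show ?thesis
    by (rule Ck_cong[rotated 2]) (use s U(4) in auto)
qed

section \<open>Lightcone Gauss maps of spacelike spheres\<close>

lemma Ck2_frechet:
  assumes U: "open U" and f: "Ck (Suc (Suc 0)) U f"
  defines "f' \<equiv> \<lambda>x. frechet_derivative f (at x)"
  shows "x \<in> U \<Longrightarrow> (f has_derivative f' x) (at x)"
    "continuous_on U (\<lambda>x. f' x v)"
    "x \<in> U \<Longrightarrow> (\<lambda>x. f' x v) differentiable (at x)"
proof -
  obtain D where D: "\<And>x. x \<in> U \<Longrightarrow> (f has_derivative D x) (at x)" "\<And>v. Ck (Suc 0) U (\<lambda>x. D x v)"
    using f by (rule Ck_SucE) (rule that)
  have eq: "f' x = D x" if "x \<in> U" for x
    unfolding f'_def using frechet_derivative_at[OF D(1)[OF that]] by simp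
  show "x \<in> U \<Longrightarrow> (f has_derivative f' x) (at x)" using D(1)[of x] by (simp add: eq)
  have C: "Ck (Suc 0) U (\<lambda>x. f' x v)"
    by (rule Ck_cong[OF U _ D(2)[of v]]) (simp add: eq)
  then show "continuous_on U (\<lambda>x. f' x v)" by (rule Ck_continuous)
  obtain E where "\<And>x. x \<in> U \<Longrightarrow> ((\<lambda>x. f' x v) has_derivative E x) (at x)"
    using C by (rule Ck_SucE) (rule that)
  then show "x \<in> U \<Longrightarrow> (\<lambda>x. f' x v) differentiable (at x)" unfolding differentiable_def by blast
qed

lemma sgn_scaleR_pos: "t > 0 \<Longrightarrow> sgn (t *\<^sub>R x) = sgn (x :: 'a::real_normed_vector)"
  by (simp add: sgn_div_norm)

lemma sgn_sgn_eq: "sgn (sgn x) = sgn (x :: 'a::real_normed_vector)"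
  by (cases "x = 0") (simp_all add: sgn_div_norm)

lemma derivative_homogeneous:
  fixes f :: "'a::euclidean_space \<Rightarrow> 'b::real_normed_vector"
  assumes "t > 0" and hom: "\<And>y. f (t *\<^sub>R y) = f y"
    and "(f has_derivative D) (at x)" "(f has_derivative E) (at (t *\<^sub>R x))"
  shows "D u = t *\<^sub>R E u"
proof -
  have "((\<lambda>y. f (t *\<^sub>R y)) has_derivative (\<lambda>u. E (t *\<^sub>R u))) (at x)"
    by (rule has_derivative_compose[where f = "\<lambda>y. t *\<^sub>R y" and g = f])
      (auto intro!: derivative_eq_intros assms(4))
  then have "(f has_derivative (\<lambda>u. E (t *\<^sub>R u))) (at x)" by (simp add: hom)
  from has_derivative_unique[OF assms(3) this] have "D u = E (t *\<^sub>R u)" by (rule fun_cong)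
  then show ?thesis using has_derivative_linear[OF assms(4)] by (simp add: linear_scale)
qed

lemma derivative_radial:
  fixes f :: "'a::euclidean_space \<Rightarrow> 'b::real_normed_vector"
  assumes hom: "\<And>t. t > 0 \<Longrightarrow> f (t *\<^sub>R x) = f x" and d: "(f has_derivative D) (at x)"
  shows "D x = 0"
proof -
  have "((\<lambda>t. f (t *\<^sub>R x)) has_derivative (\<lambda>t. D (t *\<^sub>R x))) (at 1)"
    by (rule has_derivative_compose[where f = "\<lambda>t. t *\<^sub>R x" and g = f])
      (auto intro!: derivative_eq_intros d)
  moreover have "((\<lambda>t. f (t *\<^sub>R x)) has_derivative (\<lambda>t. 0)) (at (1::real))"
    by (rule has_derivative_transform_within_open[OF has_derivative_const, of "{0<..}" _ "f x"])
      (simp_all add: hom)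
  ultimately have "(\<lambda>t. D (t *\<^sub>R x)) = (\<lambda>t. 0)" by (rule has_derivative_unique)
  from fun_cong[OF this, of 1] show ?thesis by simp
qed

text \<open>Cauchy-Schwarz for the spatial parts, after all inner products are expressed by the time
  components. For the normal frame it gives \<open>nT\<close> plus or minus \<open>nS\<close> a
  positive time component, so \<open>tilde\<close> divides by a positive number.\<close>

lemma timelike_dominates:
  fixes X Y :: "'a::real_inner" and a b :: real
  assumes "- a * a + X \<bullet> X = -1" "- b * b + Y \<bullet> Y = 1" "- b * a + Y \<bullet> X = 0" "a > 0"
  shows "\<bar>b\<bar> < a"
proof -
  have "Y \<bullet> X = b * a" "Y \<bullet> Y = b * b + 1" "X \<bullet> X = a * a - 1" using assms by simp_all
  then have "(b * a)\<^sup>2 \<le> (b * b + 1) * (a * a - 1)"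
    using Cauchy_Schwarz_ineq[of Y X] by (simp only:)
  then have "b\<^sup>2 < a\<^sup>2" by (simp add: algebra_simps power2_eq_square)
  then show ?thesis using assms(4) abs_le_square_iff[of a b] by (simp add: not_le[symmetric])
qed

section \<open>Homogeneous extensions and the conormal equation\<close>

locale spacelike_sphere =
  fixes f nT nS :: "real^'n \<Rightarrow> real \<times> (real^'n)"
  assumes card2: "CARD('n) \<ge> 2"
    and emb: "spacelike_embedding f"
    and frame: "normal_frame f nT nS"
begin

text \<open>As degree 0 extensions these have derivatives that vanish on the radial direction and
  restrict to \<open>sdiff\<close> on the tangent space, so no vector has to be projected before it
  is inserted.\<close>

definition f0 :: "real^'n \<Rightarrow> real" where "f0 x = fst (f (sgn x))"
definition F :: "real^'n \<Rightarrow> real^'n" where "F x = snd (f (sgn x))"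
definition g :: "real \<Rightarrow> real^'n \<Rightarrow> real^'n" where "g s x = snd (LG nT nS s (sgn x))"

definition f0' where "f0' x = frechet_derivative f0 (at x)"
definition F' where "F' x = frechet_derivative F (at x)"
definition g' where "g' s x = frechet_derivative (g s) (at x)"

lemma sgn_S: "x \<noteq> 0 \<Longrightarrow> sgn x \<in> S" for x :: "real^'n"
  by (simp add: norm_sgn)

lemma S_sgn: "p \<in> S \<Longrightarrow> sgn p = p" for p :: "real^'n"
  by (simp add: sgn_div_norm)

lemma S_nz: "p \<in> S \<Longrightarrow> p \<noteq> 0" for p :: "real^'n"
  by auto

lemma sm: "smooth_sphere_map f" "smooth_sphere_map nT" "smooth_sphere_map nS"
  using emb frame by (auto simp: spacelike_embedding_def normal_frame_def)

lemma frameD: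
  assumes "p \<in> S"
  shows "nT p \<in> normal_space f p" "nS p \<in> normal_space f p" "lor (nT p) (nT p) = -1" "fst (nT p) > 0"
    "lor (nS p) (nS p) = 1" "lor (nS p) (nT p) = 0"
  using frame assms by (auto simp: normal_frame_def)

lemma nT_nS_pos:
  assumes "p \<in> S" "s = 1 \<or> s = -1"
  shows "fst (nT p) + s * fst (nS p) > 0"
proof -
  have "\<bar>fst (nS p)\<bar> < fst (nT p)"
    using timelike_dominates[of "fst (nT p)" "snd (nT p)" "fst (nS p)" "snd (nS p)"] frameD[OF assms(1)]
    by (simp add: lor_def)
  then show ?thesis using assms(2) by auto
qed

lemma LG_eq:
  assumes "p \<in> S" "s = 1 \<or> s = -1"
  shows "nT p + s *\<^sub>R nS p = (fst (nT p) + s * fst (nS p)) *\<^sub>R (1, g s p)" "LG nT nS s p = (1, g s p)"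
proof -
  let ?r = "fst (nT p) + s * fst (nS p)"
  have r: "?r > 0" by (rule nT_nS_pos[OF assms])
  have f1: "fst (LG nT nS s p) = 1" using r by (simp add: LG_def tilde_def)
  then show l: "LG nT nS s p = (1, g s p)"
    using S_sgn[OF assms(1)] by (simp add: g_def prod_eq_iff)
  have "?r *\<^sub>R LG nT nS s p = nT p + s *\<^sub>R nS p" using r by (simp add: LG_def tilde_def)
  then show "nT p + s *\<^sub>R nS p = ?r *\<^sub>R (1, g s p)" using l by simp
qed

lemma norm_g:
  assumes "x \<noteq> 0" "s = 1 \<or> s = -1"
  shows "norm (g s x) = 1"
proof -
  let ?p = "sgn x"
  have p: "?p \<in> S" by (rule sgn_S[OF assms(1)])
  let ?r = "fst (nT ?p) + s * fst (nS ?p)"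
  have r: "?r > 0" by (rule nT_nS_pos[OF p assms(2)])
  have "lor (nT ?p + s *\<^sub>R nS ?p) (nT ?p + s *\<^sub>R nS ?p) = 0"
    using frameD[OF p] assms(2) by (auto simp: lor_def inner_simps inner_commute algebra_simps)
  then have "lor (?r *\<^sub>R (1, g s ?p)) (?r *\<^sub>R (1, g s ?p)) = 0"
    by (simp only: LG_eq(1)[OF p assms(2)])
  then have "?r * ?r * (g s ?p \<bullet> g s ?p - 1) = 0" by (simp add: lor_def algebra_simps)
  then have "g s ?p \<bullet> g s ?p = 1" using r by simp
  then show ?thesis by (simp add: g_def norm_eq_1 S_sgn[OF p])
qed

lemma Ck_f0: "Ck k (- {0}) f0" and Ck_F: "Ck k (- {0}) F"
  unfolding f0_def[abs_def] F_def[abs_def]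
  by (rule Ck_linear_compose[OF smooth_sphere_map_Ck[OF sm(1)]], simp add: bounded_linear_fst bounded_linear_snd)+

lemma Ck_g:
  assumes s: "s = 1 \<or> s = -1"
  shows "Ck k (- {0}) (g s)"
proof -
  define n where "n = (\<lambda>x. nT (sgn x) + s *\<^sub>R nS (sgn x))"
  have n: "Ck k (- {0}) n"
    unfolding n_def by (intro Ck_add Ck_scaleR Ck_const smooth_sphere_map_Ck sm)
  have "fst (n x) \<noteq> 0" if "x \<in> - {0}" for x
    using nT_nS_pos[OF sgn_S s, of x] that by (simp add: n_def)
  then have "Ck k (- {0}) (\<lambda>x. inverse (fst (n x)) *\<^sub>R snd (n x))"
    by (intro Ck_scaleR Ck_inverse Ck_linear_compose[OF n] bounded_linear_fst bounded_linear_snd)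
  then show ?thesis by (simp add: g_def[abs_def] LG_def tilde_def n_def)
qed

lemma open_nz: "open (- {0 :: real^'n})"
  by auto

lemmas f0_der = Ck2_frechet[OF open_nz Ck_f0, folded f0'_def]
  and F_der = Ck2_frechet[OF open_nz Ck_F, folded F'_def]

lemma der_f0: "x \<noteq> 0 \<Longrightarrow> (f0 has_derivative f0' x) (at x)" using f0_der(1)[of x] by simp
lemma der_F: "x \<noteq> 0 \<Longrightarrow> (F has_derivative F' x) (at x)" using F_der(1)[of x] by simp
lemma der_g: "s = 1 \<or> s = -1 \<Longrightarrow> x \<noteq> 0 \<Longrightarrow> (g s has_derivative g' s x) (at x)"
  using Ck2_frechet(1)[OF open_nz Ck_g, of s x, folded g'_def] by simp
lemma cont_g': "s = 1 \<or> s = -1 \<Longrightarrow> continuous_on (- {0}) (\<lambda>x. g' s x v)"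
  using Ck2_frechet(2)[OF open_nz Ck_g, of s v, folded g'_def] by simp
lemma diff_g': "s = 1 \<or> s = -1 \<Longrightarrow> x \<noteq> 0 \<Longrightarrow> (\<lambda>x. g' s x v) differentiable (at x)"
  using Ck2_frechet(3)[OF open_nz Ck_g, of s x v, folded g'_def] by simp

lemma lin_f0': "x \<noteq> 0 \<Longrightarrow> linear (f0' x)" and lin_F': "x \<noteq> 0 \<Longrightarrow> linear (F' x)"
  and lin_g': "s = 1 \<or> s = -1 \<Longrightarrow> x \<noteq> 0 \<Longrightarrow> linear (g' s x)"
  using der_f0 der_F der_g has_derivative_linear by blast+

lemma hom: "t > 0 \<Longrightarrow> f0 (t *\<^sub>R x) = f0 x" "t > 0 \<Longrightarrow> F (t *\<^sub>R x) = F x" "t > 0 \<Longrightarrow> g s (t *\<^sub>R x) = g s x"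
  by (simp_all add: f0_def F_def g_def sgn_scaleR_pos)

lemma sgn_inv: "f0 (sgn x) = f0 x" "F (sgn x) = F x" "g s (sgn x) = g s x"
  by (simp_all add: f0_def F_def g_def sgn_sgn_eq)

lemma hom':
  assumes "t > 0" "x \<noteq> 0"
  shows "f0' x u = t * f0' (t *\<^sub>R x) u" "F' x u = t *\<^sub>R F' (t *\<^sub>R x) u"
    "s = 1 \<or> s = -1 \<Longrightarrow> g' s x u = t *\<^sub>R g' s (t *\<^sub>R x) u"
proof -
  have tx: "t *\<^sub>R x \<noteq> 0" using assms by simp
  show "f0' x u = t * f0' (t *\<^sub>R x) u"
    using derivative_homogeneous[OF assms(1) hom(1)[OF assms(1)] der_f0[OF assms(2)] der_f0[OF tx]] by simp
  show "F' x u = t *\<^sub>R F' (t *\<^sub>R x) u"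
    by (rule derivative_homogeneous[OF assms(1) hom(2)[OF assms(1)] der_F[OF assms(2)] der_F[OF tx]])
  show "g' s x u = t *\<^sub>R g' s (t *\<^sub>R x) u" if "s = 1 \<or> s = -1"
    by (rule derivative_homogeneous[OF assms(1) hom(3)[OF assms(1)] der_g[OF that assms(2)] der_g[OF that tx]])
qed

lemma radial:
  assumes "x \<noteq> 0"
  shows "f0' x x = 0" "F' x x = 0" "s = 1 \<or> s = -1 \<Longrightarrow> g' s x x = 0"
proof -
  show "f0' x x = 0" "F' x x = 0"
    by (rule derivative_radial[OF hom(1) der_f0[OF assms]], assumption)
      (rule derivative_radial[OF hom(2) der_F[OF assms]], assumption)
  show "g' s x x = 0" if "s = 1 \<or> s = -1"
    by (rule derivative_radial[OF hom(3) der_g[OF that assms]])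
qed

lemma chart_sgn: "chart p w = sgn (p + w)"
  by (simp add: chart_def sgn_div_norm)

text \<open>\<open>chart p w\<close> is \<open>sgn (p + w)\<close>, so a chart curve is a straight
  line followed by the homogeneous extension of \<open>k\<close>.\<close>

lemma sdiff_eq:
  assumes p: "p \<noteq> 0" and d: "((\<lambda>x. k (sgn x)) has_derivative D) (at p)"
  shows "((\<lambda>t. k (chart p (t *\<^sub>R v))) has_vector_derivative D v) (at 0)" "sdiff k p v = D v"
proof -
  have "((\<lambda>t. k (sgn (p + t *\<^sub>R v))) has_derivative (\<lambda>t. D (t *\<^sub>R v))) (at 0)"
    by (rule has_derivative_compose[where f = "\<lambda>t. p + t *\<^sub>R v" and g = "\<lambda>x. k (sgn x)"])
      (auto intro!: derivative_eq_intros d)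
  then show *: "((\<lambda>t. k (chart p (t *\<^sub>R v))) has_vector_derivative D v) (at 0)"
    using has_derivative_linear[OF d] by (simp add: has_vector_derivative_def chart_sgn linear_scale)
  then show "sdiff k p v = D v" unfolding sdiff_def by (rule vector_derivative_at)
qed

lemma sdiff_f: "p \<in> S \<Longrightarrow> sdiff f p v = (f0' p v, F' p v)"
proof (rule sdiff_eq(2))
  assume p: "p \<in> S"
  then show "p \<noteq> 0" by (rule S_nz)
  have "((\<lambda>x. (f0 x, F x)) has_derivative (\<lambda>v. (f0' p v, F' p v))) (at p)"
    using p by (intro has_derivative_Pair der_f0 der_F S_nz)
  then show "((\<lambda>x. f (sgn x)) has_derivative (\<lambda>v. (f0' p v, F' p v))) (at p)"
    by (simp add: f0_def F_def)
qed

lemma sdiff_LG: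
  assumes p: "p \<in> S" and s: "s = 1 \<or> s = -1"
  shows "sdiff (LG nT nS s) p v = (0, g' s p v)"
proof (rule sdiff_eq(2)[OF S_nz[OF p]])
  have "((\<lambda>x. (1::real, g s x)) has_derivative (\<lambda>v. (0, g' s p v))) (at p)"
    using p s by (intro has_derivative_Pair has_derivative_const der_g S_nz)
  then show "((\<lambda>x. LG nT nS s (sgn x)) has_derivative (\<lambda>v. (0, g' s p v))) (at p)"
  proof (rule has_derivative_transform_within_open[OF _ open_nz])
    show "(1, g s x) = LG nT nS s (sgn x)" if "x \<in> - {0}" for x
      using LG_eq(2)[OF sgn_S s, of x] that by (simp add: sgn_inv)
  qed (use p in auto)
qed

lemma tangent_decomp:
  assumes "p \<in> S"
  shows "u - (u \<bullet> p) *\<^sub>R p \<in> tangent p" "u = (u - (u \<bullet> p) *\<^sub>R p) + (u \<bullet> p) *\<^sub>R p"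
  using assms by (simp_all add: tangent_def inner_diff_left dot_square_norm)

lemma tangent_all:
  assumes "p \<in> S"
  shows "F' p (u - (u \<bullet> p) *\<^sub>R p) = F' p u" "f0' p (u - (u \<bullet> p) *\<^sub>R p) = f0' p u"
    "s = 1 \<or> s = -1 \<Longrightarrow> g' s p (u - (u \<bullet> p) *\<^sub>R p) = g' s p u"
  using S_nz[OF assms] by (simp_all add: linear_diff lin_F' lin_f0' lin_g' linear_scale radial)

text \<open>This is Lorentz orthogonality of \<open>nT + s nS\<close> to the tangent vectors of
  \<open>f\<close>, divided by its positive time component. The radial direction contributes 0, and
  homogeneity extends the equation from the sphere to all \<open>x\<close>.\<close>

lemma conormal:
  assumes x: "x \<noteq> 0" and s: "s = 1 \<or> s = -1"
  shows "F' x u \<bullet> g s x = f0' x u"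
proof -
  have *: "F' p u \<bullet> g s p = f0' p u" if p: "p \<in> S" for p
  proof -
    let ?r = "fst (nT p) + s * fst (nS p)"
    let ?u = "u - (u \<bullet> p) *\<^sub>R p"
    have "lor (nT p) (sdiff f p ?u) = 0" "lor (nS p) (sdiff f p ?u) = 0"
      using frameD(1,2)[OF p] tangent_decomp(1)[OF p] by (auto simp: normal_space_def)
    then have "lor (nT p + s *\<^sub>R nS p) (sdiff f p ?u) = 0"
      using s by (auto simp: lor_def inner_simps algebra_simps)
    then have "?r * (F' p u \<bullet> g s p - f0' p u) = 0"
      unfolding LG_eq(1)[OF p s] sdiff_f[OF p] tangent_all[OF p]
      by (simp add: lor_def algebra_simps inner_commute)
    then show ?thesis using nT_nS_pos[OF p s] by simp
  qed
  have e: "sgn x = inverse (norm x) *\<^sub>R x" by (simp add: sgn_div_norm)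
  have t: "inverse (norm x) > 0" using x by simp
  have "F' (sgn x) u \<bullet> g s x = f0' (sgn x) u" using *[OF sgn_S[OF x]] by (simp only: sgn_inv)
  then show ?thesis unfolding hom'(1,2)[OF t x, of u] e by simp
qed

lemma spacelike:
  assumes x: "x \<noteq> 0" and u: "u \<bullet> x = 0" "u \<noteq> 0"
  shows "\<bar>f0' x u\<bar> < norm (F' x u)"
proof -
  let ?t = "inverse (norm x)"
  have t: "?t > 0" using x by simp
  have p: "sgn x \<in> S" by (rule sgn_S[OF x])
  have e: "sgn x = ?t *\<^sub>R x" by (simp add: sgn_div_norm)
  have "u \<in> tangent (sgn x)" using u(1) by (simp add: tangent_def e)
  then have "lor (sdiff f (sgn x) u) (sdiff f (sgn x) u) > 0"
    using emb p u(2) by (auto simp: spacelike_embedding_def)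
  then have "(f0' (sgn x) u)\<^sup>2 < (norm (F' (sgn x) u))\<^sup>2"
    unfolding sdiff_f[OF p] by (simp add: lor_def power2_eq_square power2_norm_eq_inner[symmetric] dot_square_norm)
  then have "\<bar>f0' (sgn x) u\<bar> < norm (F' (sgn x) u)"
    using abs_le_square_iff[of "norm (F' (sgn x) u)" "f0' (sgn x) u"] by (simp add: not_le[symmetric])
  then have "?t * \<bar>f0' (sgn x) u\<bar> < ?t * norm (F' (sgn x) u)" using t by (rule mult_strict_left_mono)
  moreover have "?t * \<bar>f0' (sgn x) u\<bar> = \<bar>?t * f0' (sgn x) u\<bar>" "?t * norm (F' (sgn x) u) = norm (?t *\<^sub>R F' (sgn x) u)"
    using t by (simp_all add: abs_mult)
  ultimately show ?thesis using hom'(1,2)[OF t x, of u] e by simp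
qed

text \<open>Pairing with \<open>w\<close> shows that \<open>u\<close> is tangential; then
  \<open>F' x u\<close> is the multiple \<open>f0' x u\<close> of a unit vector, so the image of
  \<open>u\<close> would be lightlike.\<close>

lemma immersed:
  assumes x: "x \<noteq> 0" and w: "norm w = 1" "\<And>u. F' x u \<bullet> w = f0' x u"
    and u: "F' x u - (F' x u \<bullet> w) *\<^sub>R w + (u \<bullet> x) *\<^sub>R w = 0"
  shows "u = 0"
proof (rule ccontr)
  assume "u \<noteq> 0"
  have ww: "w \<bullet> w = 1" using w(1) by (simp add: dot_square_norm)
  have "(F' x u - (F' x u \<bullet> w) *\<^sub>R w + (u \<bullet> x) *\<^sub>R w) \<bullet> w = 0" using u by simp
  then have ux: "u \<bullet> x = 0" using ww by (simp add: inner_simps)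
  with u have "F' x u = f0' x u *\<^sub>R w" using w(2) by simp
  then have "norm (F' x u) = \<bar>f0' x u\<bar>" using w(1) by simp
  then show False using spacelike[OF x ux \<open>u \<noteq> 0\<close>] by simp
qed

lemma inj_f: "p \<in> S \<Longrightarrow> q \<in> S \<Longrightarrow> F p = F q \<Longrightarrow> f0 p = f0 q \<Longrightarrow> p = q"
proof -
  assume pq: "p \<in> S" "q \<in> S" and e: "F p = F q" "f0 p = f0 q"
  have "f p = f q" using e unfolding F_def f0_def S_sgn[OF pq(1)] S_sgn[OF pq(2)] by (rule prod_eqI[rotated])
  have "inj_on f S" using emb by (simp add: spacelike_embedding_def)
  from inj_onD[OF this \<open>f p = f q\<close> pq] show "p = q" .
qed

text \<open>Otherwise the timelike \<open>nT p\<close> would be a multiple of a lightlike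
  vector.\<close>

lemma g_distinct: "p \<in> S \<Longrightarrow> g 1 p \<noteq> g (-1) p"
proof
  assume p: "p \<in> S" and e: "g 1 p = g (-1) p"
  let ?v = "(1::real, g 1 p)"
  define a where "a = fst (nT p) + fst (nS p)"
  define b where "b = fst (nT p) - fst (nS p)"
  have l: "nT p + nS p = a *\<^sub>R ?v" using LG_eq(1)[OF p, of 1] by (simp add: a_def)
  have r: "nT p - nS p = b *\<^sub>R ?v" using LG_eq(1)[OF p, of "-1"] e by (simp add: b_def)
  have "2 *\<^sub>R nT p = (a + b) *\<^sub>R ?v"
    using arg_cong2[OF l r, of "(+)"] by (simp add: scaleR_2 scaleR_add_left)
  moreover have "lor ?v ?v = 0" using norm_g[OF S_nz[OF p], of 1] by (simp add: lor_def dot_square_norm)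
  ultimately have "lor (2 *\<^sub>R nT p) (2 *\<^sub>R nT p) = 0" by (simp add: lor_def algebra_simps)
  then show False using frameD(3)[OF p] by (simp add: lor_def algebra_simps)
qed

text \<open>The equation is affine in \<open>w\<close>, and its solutions form at most a line
  because the kernel of \<open>F' p\<close> is spanned by \<open>p\<close>. A line meets the unit
  sphere at most twice, and two intersection points are already known.\<close>

lemma conormal_unique:
  assumes p: "p \<in> S" and w: "norm w = 1" "\<And>u. F' p u \<bullet> w = f0' p u"
  shows "w = g 1 p \<or> w = g (-1) p"
proof -
  let ?D = "range (F' p)"
  let ?C = "{y \<in> UNIV. \<forall>x\<in>?D. orthogonal x y}"
  have sD: "subspace ?D" by (rule linear_subspace_image[OF lin_F'[OF S_nz[OF p]] subspace_UNIV])
  have "{u. F' p u = 0} \<subseteq> span {p}"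
  proof safe
    fix u assume u: "F' p u = 0"
    then have "F' p (u - (u \<bullet> p) *\<^sub>R p) = 0" using tangent_all[OF p] by simp
    then have "u - (u \<bullet> p) *\<^sub>R p = 0"
      using spacelike[OF S_nz[OF p], of "u - (u \<bullet> p) *\<^sub>R p"] tangent_decomp(1)[OF p, of u]
      by (auto simp: tangent_def)
    then have "u = (u \<bullet> p) *\<^sub>R p" by simp
    then show "u \<in> span {p}" unfolding span_singleton by (rule range_eqI)
  qed
  then have "dim {u. F' p u = 0} \<le> dim (span {p})" by (rule dim_subset)
  also have "\<dots> = dim {p}" by (rule dim_span)
  also have "\<dots> \<le> card {p}" by (rule dim_le_card') simp
  finally have "dim {u. F' p u = 0} \<le> 1" by simp
  then have "dim ?C \<le> 1"
    using dim_range_plus_kernel[OF lin_F'[OF S_nz[OF p]]] dim_subspace_orthogonal_to_vectors[OF sD subspace_UNIV] by simp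
  moreover have C: "w - g 1 p \<in> ?C" "g (-1) p - g 1 p \<in> ?C"
    using w(2) conormal[OF S_nz[OF p]] by (auto simp: orthogonal_def inner_diff_right)
  moreover have nz: "g (-1) p - g 1 p \<noteq> 0" using g_distinct[OF p] by auto
  ultimately obtain t where t: "w - g 1 p = t *\<^sub>R (g (-1) p - g 1 p)"
  proof -
    assume d: "dim ?C \<le> 1"
    have sC: "subspace ?C" using subspace_orthogonal_to_vectors[of ?D] by simp
    have "span {g (-1) p - g 1 p} = ?C"
      using C(2) nz d by (intro subspace_dim_equal subspace_span sC span_minimal) (auto simp: dim_singleton)
    then have "w - g 1 p \<in> span {g (-1) p - g 1 p}" using C(1) by simp
    then show ?thesis using that by (auto simp: span_singleton)
  qed
  let ?a = "g 1 p" and ?b = "g (-1) p"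
  have n: "?a \<bullet> ?a = 1" "?b \<bullet> ?b = 1" "w \<bullet> w = 1"
    using norm_g[OF S_nz[OF p]] w(1) by (simp_all add: dot_square_norm)
  have W: "w = ?a + t *\<^sub>R (?b - ?a)" using t by (simp add: algebra_simps)
  have "(?a + t *\<^sub>R (?b - ?a)) \<bullet> (?a + t *\<^sub>R (?b - ?a)) = ?a \<bullet> ?a + 2 * t * (?b \<bullet> ?a - ?a \<bullet> ?a) + t * t * (?a \<bullet> ?a + ?b \<bullet> ?b - 2 * (?b \<bullet> ?a))"
    by (simp add: inner_simps inner_commute algebra_simps)
  then have "w \<bullet> w = ?a \<bullet> ?a + 2 * t * (?b \<bullet> ?a - ?a \<bullet> ?a) + t * t * (?a \<bullet> ?a + ?b \<bullet> ?b - 2 * (?b \<bullet> ?a))"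
    unfolding W[symmetric] .
  \<comment> \<open>The condition that the point with parameter \<open>t\<close> has norm 1 is
    quadratic in \<open>t\<close>, with the known solutions 0 and 1; it is not identically satisfied
    because the two Gauss images differ.\<close>
  then have "2 * t * (?b \<bullet> ?a - 1) * (1 - t) = 0" using n by (simp add: algebra_simps)
  moreover have "?b \<bullet> ?a \<noteq> 1"
  proof
    assume "?b \<bullet> ?a = 1"
    then have "(?b - ?a) \<bullet> (?b - ?a) = 0" using n by (simp add: inner_simps inner_commute)
    then show False using nz by simp
  qed
  ultimately have "t = 0 \<or> t = 1" by auto
  then show ?thesis using t by auto
qed


section \<open>Height functions, their critical points, and the Jacobian\<close>

definition h :: "real^'n \<Rightarrow> real^'n \<Rightarrow> real" where "h w x = F x \<bullet> w - f0 x"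

definition N :: "real \<Rightarrow> (real^'n) set" where
  "N s = {x. x \<noteq> 0 \<and> (\<exists>q\<in>S. h (g s x) q < h (g s x) x) \<and> (\<exists>q\<in>S. h (g s x) x < h (g s x) q)}"

text \<open>The degree 1 extension preserves norms, and its derivative \<open>DG\<close> maps the
  radial direction to \<open>g s x\<close>. Hence the spherical Jacobian of the Gauss map is the
  ordinary determinant \<open>J\<close>, which is constant on rays.\<close>

definition G :: "real \<Rightarrow> real^'n \<Rightarrow> real^'n" where "G s x = norm x *\<^sub>R g s x"

definition DG :: "real \<Rightarrow> real^'n \<Rightarrow> real^'n \<Rightarrow> real^'n" where
  "DG s x u = norm x *\<^sub>R g' s x u + (u \<bullet> sgn x) *\<^sub>R g s x"

definition J :: "real \<Rightarrow> real^'n \<Rightarrow> real" where "J s x = det (matrix (DG s x))"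

lemma height_sgn: "height f (1, w) (sgn x) = h w x"
  by (simp add: height_def h_def F_def f0_def lor_def)

lemma der_h: "x \<noteq> 0 \<Longrightarrow> (h w has_derivative (\<lambda>v. F' x v \<bullet> w - f0' x v)) (at x)"
  unfolding h_def[abs_def] by (intro has_derivative_diff has_derivative_inner_left der_F der_f0)

lemma sdiff_height: "p \<in> S \<Longrightarrow> sdiff (height f (1, w)) p v = F' p v \<bullet> w - f0' p v"
  by (rule sdiff_eq(2)) (simp_all only: height_sgn der_h S_nz not_False_eq_True)

lemma critical_iff:
  assumes "norm w = 1"
  shows "critical (height f (1, w)) p \<longleftrightarrow> p \<in> S \<and> (w = g 1 p \<or> w = g (-1) p)"
proof
  assume c: "critical (height f (1, w)) p"
  then have p: "p \<in> S" by (simp add: critical_def)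
  have "F' p u \<bullet> w = f0' p u" for u
  proof -
    have "sdiff (height f (1, w)) p (u - (u \<bullet> p) *\<^sub>R p) = 0"
      using c tangent_decomp(1)[OF p] by (simp add: critical_def)
    then show ?thesis unfolding sdiff_height[OF p] tangent_all[OF p] by simp
  qed
  then show "p \<in> S \<and> (w = g 1 p \<or> w = g (-1) p)" using conormal_unique[OF p assms] p by blast
next
  assume "p \<in> S \<and> (w = g 1 p \<or> w = g (-1) p)"
  then have p: "p \<in> S" and "w = g 1 p \<or> w = g (-1) p" by auto
  then have "F' p u \<bullet> w = f0' p u" for u
    using conormal[OF S_nz[OF p], of 1] conormal[OF S_nz[OF p], of "-1"] by auto
  then show "critical (height f (1, w)) p" using p by (simp add: critical_def sdiff_height)
qed

lemma g'_perp:
  assumes "x \<noteq> 0" and s: "s = 1 \<or> s = -1"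
  shows "g' s x u \<bullet> g s x = 0"
proof -
  have "((\<lambda>x. g s x \<bullet> g s x) has_derivative (\<lambda>u. g s x \<bullet> g' s x u + g' s x u \<bullet> g s x)) (at x)"
    by (intro has_derivative_inner der_g s assms(1))
  moreover have "((\<lambda>x. g s x \<bullet> g s x) has_derivative (\<lambda>u. 0)) (at x)"
    by (rule has_derivative_transform_within_open[OF has_derivative_const open_nz, of _ 1])
      (use assms in \<open>auto simp: dot_square_norm norm_g\<close>)
  ultimately have "(\<lambda>u. g s x \<bullet> g' s x u + g' s x u \<bullet> g s x) = (\<lambda>u. 0)" by (rule has_derivative_unique)
  from fun_cong[OF this, of u] show ?thesis by (simp add: inner_commute)
qed

text \<open>By the conormal equation at the moving point, the first derivative is
  \<open>F' y z \<bullet> (w - g s y)\<close>. The second factor vanishes at \<open>p\<close>, so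
  only the derivative of \<open>g\<close> survives.\<close>

lemma hessian_height:
  assumes p: "p \<in> S" and s: "s = 1 \<or> s = -1" and w: "w = g s p" and u: "u \<in> tangent p"
  shows "hessian (height f (1, w)) p u z = - (F' p z \<bullet> g' s p u)"
proof -
  have nz: "p + a *\<^sub>R u \<noteq> 0" for a
  proof
    assume "p + a *\<^sub>R u = 0"
    then have "(p + a *\<^sub>R u) \<bullet> p = 0" by simp
    then show False using u p by (simp add: tangent_def inner_add_left dot_square_norm)
  qed
  have inner: "vector_derivative (\<lambda>t. height f (1, w) (chart p (a *\<^sub>R u + t *\<^sub>R z))) (at 0)
      = F' (p + a *\<^sub>R u) z \<bullet> (w - g s (p + a *\<^sub>R u))" for a
  proof -
    let ?y = "p + a *\<^sub>R u"
    have "(\<lambda>t. height f (1, w) (chart p (a *\<^sub>R u + t *\<^sub>R z))) = (\<lambda>t. height f (1, w) (chart ?y (t *\<^sub>R z)))"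
      by (simp add: chart_sgn add.assoc)
    moreover have "((\<lambda>t. height f (1, w) (chart ?y (t *\<^sub>R z))) has_vector_derivative (F' ?y z \<bullet> w - f0' ?y z)) (at 0)"
      by (rule sdiff_eq(1)[OF nz]) (simp only: height_sgn der_h[OF nz])
    ultimately show ?thesis
      using conormal[OF nz s, of a z] by (simp add: vector_derivative_at inner_diff_right)
  qed
  have pa: "((\<lambda>a. p + a *\<^sub>R u) has_derivative (\<lambda>a. a *\<^sub>R u)) (at 0)"
    by (auto intro!: derivative_eq_intros)
  obtain E where "((\<lambda>x. F' x z) has_derivative E) (at p)"
    using F_der(3)[of p z] S_nz[OF p] unfolding differentiable_def by auto
  then have E: "((\<lambda>x. F' x z) has_derivative E) (at (p + 0 *\<^sub>R u))" by simp
  have g0: "(g s has_derivative g' s p) (at (p + 0 *\<^sub>R u))" using der_g[OF s S_nz[OF p]] by simp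
  have "((\<lambda>a. F' (p + a *\<^sub>R u) z \<bullet> (w - g s (p + a *\<^sub>R u))) has_derivative
      (\<lambda>a. F' (p + 0 *\<^sub>R u) z \<bullet> (0 - g' s p (a *\<^sub>R u)) + E (a *\<^sub>R u) \<bullet> (w - g s (p + 0 *\<^sub>R u)))) (at 0)"
    by (rule has_derivative_inner[OF has_derivative_compose[OF pa E]
      has_derivative_diff[OF has_derivative_const has_derivative_compose[OF pa g0]]])
  then have "((\<lambda>a. F' (p + a *\<^sub>R u) z \<bullet> (w - g s (p + a *\<^sub>R u))) has_vector_derivative (- (F' p z \<bullet> g' s p u))) (at 0)"
    unfolding has_vector_derivative_def
    by (rule has_derivative_eq_rhs) (simp add: w fun_eq_iff linear_scale[OF lin_g'[OF s S_nz[OF p]]])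
  then show ?thesis unfolding hessian_def inner by (rule vector_derivative_at)
qed

lemma lin_DG: "x \<noteq> 0 \<Longrightarrow> s = 1 \<or> s = -1 \<Longrightarrow> linear (DG s x)"
  unfolding DG_def
  by (intro linearI) (simp_all add: linear_add[OF lin_g'] linear_scale[OF lin_g'] inner_add_left algebra_simps)

lemma DG_zeroD:
  assumes "x \<noteq> 0" and s: "s = 1 \<or> s = -1" and "DG s x u = 0"
  shows "u \<bullet> x = 0" "g' s x u = 0"
proof -
  have "DG s x u \<bullet> g s x = 0" using assms(3) by simp
  then have "u \<bullet> sgn x = 0"
    using g'_perp[OF assms(1) s] norm_g[OF assms(1) s] by (simp add: DG_def inner_add_left dot_square_norm)
  then show "u \<bullet> x = 0" "g' s x u = 0"
    using assms(1,3) by (auto simp: sgn_div_norm DG_def)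
qed

lemma J_zero_iff:
  assumes "x \<noteq> 0" and s: "s = 1 \<or> s = -1"
  shows "J s x = 0 \<longleftrightarrow> (\<exists>u. u \<noteq> 0 \<and> u \<bullet> x = 0 \<and> g' s x u = 0)"
proof -
  have "J s x = 0 \<longleftrightarrow> \<not> inj (DG s x)"
    using det_nz_iff_inj[OF lin_DG[OF assms]] by (auto simp: J_def)
  also have "\<dots> \<longleftrightarrow> (\<exists>u. u \<noteq> 0 \<and> DG s x u = 0)"
    unfolding linear_injective_0[OF lin_DG[OF assms]] by blast
  also have "\<dots> \<longleftrightarrow> (\<exists>u. u \<noteq> 0 \<and> u \<bullet> x = 0 \<and> g' s x u = 0)"
    using DG_zeroD[OF assms] by (auto simp: DG_def sgn_div_norm)
  finally show ?thesis .
qed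

text \<open>When (1, \<open>w\<close>) is normal, the Lorentz square of the image of
  \<open>u\<close> is the Euclidean square of \<open>F' x u\<close> minus its
  \<open>w\<close>-component. So at a unit vector \<open>x\<close> this map is an isometry from the
  induced metric onto the complement of \<open>w\<close>, extended by sending \<open>x\<close> to
  \<open>w\<close>.\<close>

definition A :: "real^'n \<Rightarrow> real^'n \<Rightarrow> real^'n \<Rightarrow> real^'n" where
  "A w x u = F' x u - (F' x u \<bullet> w) *\<^sub>R w + (u \<bullet> x) *\<^sub>R w"

lemma lin_A: "x \<noteq> 0 \<Longrightarrow> linear (A w x)"
  unfolding A_def
  by (intro linearI) (simp_all add: linear_add[OF lin_F'] linear_scale[OF lin_F'] inner_add_left algebra_simps)

lemma inj_A:
  assumes "x \<noteq> 0" "norm w = 1" "\<And>u. F' x u \<bullet> w = f0' x u"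
  shows "inj (A w x)"
  unfolding linear_injective_0[OF lin_A[OF assms(1)]] A_def
  by (intro allI impI) (rule immersed[OF assms])

lemma surj_A:
  assumes "x \<noteq> 0" "norm w = 1" "\<And>u. F' x u \<bullet> w = f0' x u"
  shows "surj (A w x)"
  by (rule linear_inj_imp_surj[OF lin_A[OF assms(1)] inj_A[OF assms]])

lemma A_inner:
  assumes "norm w = 1"
  shows "A w x u \<bullet> w = u \<bullet> x"
  using assms by (simp add: A_def inner_simps dot_square_norm)

lemma morse_imp:
  assumes m: "morse (height f (1, g s p))" and p: "p \<in> S" and s: "s = 1 \<or> s = -1"
  shows "J s p \<noteq> 0"
proof
  assume "J s p = 0"
  then obtain u where u: "u \<noteq> 0" "u \<bullet> p = 0" "g' s p u = 0"
    using J_zero_iff[OF S_nz[OF p] s] by blast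
  have "critical (height f (1, g s p)) p"
    using critical_iff[OF norm_g[OF S_nz[OF p] s]] p s by auto
  moreover have ut: "u \<in> tangent p" using u(2) by (simp add: tangent_def)
  ultimately obtain z where "hessian (height f (1, g s p)) p u z \<noteq> 0"
    using m u(1) unfolding morse_def by blast
  then show False using hessian_height[OF p s refl ut] u(3) by simp
qed

lemma morseI:
  assumes w: "norm w = 1" and nd: "\<And>s p. s = 1 \<or> s = -1 \<Longrightarrow> p \<in> S \<Longrightarrow> g s p = w \<Longrightarrow> J s p \<noteq> 0"
  shows "morse (height f (1, w))"
  unfolding morse_def
proof (intro allI impI ballI)
  fix p u assume "critical (height f (1, w)) p" and u: "u \<in> tangent p" "u \<noteq> 0"
  then obtain s where p: "p \<in> S" and s: "s = 1 \<or> s = -1" and ws: "w = g s p"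
    unfolding critical_iff[OF w] by blast
  have "J s p \<noteq> 0" using nd[OF s p] ws by simp
  then have g'u: "g' s p u \<noteq> 0"
    using J_zero_iff[OF S_nz[OF p] s] u by (auto simp: tangent_def)
  have con: "F' p u \<bullet> w = f0' p u" for u using conormal[OF S_nz[OF p] s] ws by simp
  \<comment> \<open>The Hessian pairs \<open>u\<close> and \<open>z\<close> by
    \<open>- (F' p z \<bullet> g' s p u)\<close>; this \<open>z\<close> makes it minus the square of
    the norm of \<open>g' s p u\<close>.\<close>
  obtain z where z: "A w p z = g' s p u" using surj_A[OF S_nz[OF p] w con] by (metis surjD)
  have perp: "g' s p u \<bullet> w = 0" using g'_perp[OF S_nz[OF p] s] ws by simp
  have "g' s p u \<bullet> g' s p u = A w p z \<bullet> g' s p u" using z by simp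
  also have "\<dots> = F' p z \<bullet> g' s p u" using perp by (simp add: A_def inner_simps inner_commute)
  finally have "F' p z \<bullet> g' s p u \<noteq> 0" using g'u inner_eq_zero_iff[of "g' s p u"] by metis
  then have "hessian (height f (1, w)) p u (z - (z \<bullet> p) *\<^sub>R p) \<noteq> 0"
    using hessian_height[OF p s ws u(1)] tangent_all(1)[OF p] by simp
  then show "\<exists>z\<in>tangent p. hessian (height f (1, w)) p u z \<noteq> 0" using tangent_decomp(1)[OF p] by blast
qed

section \<open>Non-extremal points and L-convexity\<close>

lemma cont_g: "s = 1 \<or> s = -1 \<Longrightarrow> continuous_on (- {0}) (g s)"
  and cont_F: "continuous_on (- {0}) F" and cont_f0: "continuous_on (- {0}) f0"
  by (rule Ck_continuous[OF Ck_g[of _ 0]], assumption) (rule Ck_continuous[OF Ck_F[of 0]], rule Ck_continuous[OF Ck_f0[of 0]])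

lemma cont_h_fixed: "continuous_on (- {0}) (h w)"
  unfolding h_def[abs_def] by (intro continuous_intros cont_F cont_f0)

lemma cont_hg: "s = 1 \<or> s = -1 \<Longrightarrow> continuous_on (- {0}) (\<lambda>x. h (g s x) q)"
  and cont_hgx: "s = 1 \<or> s = -1 \<Longrightarrow> continuous_on (- {0}) (\<lambda>x. h (g s x) x)"
  unfolding h_def by (intro continuous_intros cont_g cont_F cont_f0; assumption)+

text \<open>\<open>Lo\<close> excludes the global minima and \<open>Hi\<close> the global maxima of
  the height function in the direction of the point's own Gauss image. Both conditions are open,
  unlike extremality.\<close>

definition Lo :: "real \<Rightarrow> (real^'n) set" where
  "Lo s = {x. x \<noteq> 0 \<and> (\<exists>q\<in>S. h (g s x) q < h (g s x) x)}"

definition Hi :: "real \<Rightarrow> (real^'n) set" where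
  "Hi s = {x. x \<noteq> 0 \<and> (\<exists>q\<in>S. h (g s x) x < h (g s x) q)}"

lemma N_Lo_Hi: "N s = Lo s \<inter> Hi s"
  by (auto simp: N_def Lo_def Hi_def)

lemma open_Lo_Hi:
  assumes s: "s = 1 \<or> s = -1"
  shows "open (Lo s)" "open (Hi s)"
proof -
  have o: "open (- {0} \<inter> \<phi> -` {0<..})" if "continuous_on (- {0}) \<phi>" for \<phi> :: "real^'n \<Rightarrow> real"
    using continuous_open_preimage[OF that open_nz] by simp
  have "Lo s = (\<Union>q\<in>S. - {0} \<inter> (\<lambda>x. h (g s x) x - h (g s x) q) -` {0<..})"
    by (auto simp: Lo_def)
  also have "open \<dots>" by (intro open_UN ballI o continuous_on_diff cont_hg cont_hgx s)
  finally show "open (Lo s)" .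
  have "Hi s = (\<Union>q\<in>S. - {0} \<inter> (\<lambda>x. h (g s x) q - h (g s x) x) -` {0<..})"
    by (auto simp: Hi_def)
  also have "open \<dots>" by (intro open_UN ballI o continuous_on_diff cont_hg cont_hgx s)
  finally show "open (Hi s)" .
qed

lemma open_N: "s = 1 \<or> s = -1 \<Longrightarrow> open (N s)"
  unfolding N_Lo_Hi by (intro open_Int open_Lo_Hi)

lemma h_hom: "t > 0 \<Longrightarrow> h w (t *\<^sub>R x) = h w x"
  by (simp add: h_def hom)

lemma N_empty:
  assumes s: "s = 1 \<or> s = -1" and flat: "\<And>x. x \<in> N s \<Longrightarrow> J s x = 0"
  shows "N s = {}"
proof (rule ccontr)
  assume ne: "N s \<noteq> {}"
  have nz: "x \<noteq> 0" if "x \<in> N s" for x using that by (simp add: N_def)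
  define \<eta> where "\<eta> x = h (g s x) x" for x
  show False
  proof (rule no_flat_cone[of "N s" "g s" F \<eta> "g' s" F'])
    show "open (N s)" by (rule open_N[OF s])
    show "N s \<noteq> {}" "0 \<notin> N s" using ne by (auto simp: N_def)
    show "t *\<^sub>R x \<in> N s \<and> g s (t *\<^sub>R x) = g s x \<and> F (t *\<^sub>R x) = F x \<and> \<eta> (t *\<^sub>R x) = \<eta> x"
      if "x \<in> N s" "t > 0" for x t
      using that by (auto simp: N_def \<eta>_def hom h_hom)
    show "(g s has_derivative g' s x) (at x)" if "x \<in> N s" for x by (rule der_g[OF s nz[OF that]])
    show "continuous_on (N s) (\<lambda>x. g' s x v)" for v
      by (rule continuous_on_subset[OF cont_g'[OF s]]) (use nz in auto)
    show "(\<lambda>x. g' s x v) differentiable (at x)" if "x \<in> N s" for v x by (rule diff_g'[OF s nz[OF that]])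
    show "(F has_derivative F' x) (at x)" if "x \<in> N s" for x by (rule der_F[OF nz[OF that]])
    show "continuous_on (N s) (\<lambda>x. F' x v)" for v
      by (rule continuous_on_subset[OF F_der(2)]) (use nz in auto)
    \<comment> \<open>Besides the stated term the product rule gives
      \<open>F' x u \<bullet> g s x - f0' x u\<close>, which is 0 by the conormal equation.\<close>
    show "(\<eta> has_derivative (\<lambda>u. F x \<bullet> g' s x u)) (at x)" if "x \<in> N s" for x
    proof -
      have "(\<eta> has_derivative (\<lambda>u. F x \<bullet> g' s x u + F' x u \<bullet> g s x - f0' x u)) (at x)"
        unfolding \<eta>_def[abs_def] h_def
        by (intro has_derivative_diff has_derivative_inner der_F der_g der_f0 s nz that)
      then show ?thesis by (simp add: conormal[OF nz[OF that] s])
    qed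
    show "norm (g s x) = 1" if "x \<in> N s" for x by (rule norm_g[OF nz[OF that] s])
    show "u = 0" if "x \<in> N s" "F' x u - (F' x u \<bullet> g s x) *\<^sub>R g s x + (u \<bullet> x) *\<^sub>R g s x = 0" for x u
      by (rule immersed[OF nz[OF that(1)] norm_g[OF nz[OF that(1)] s] conormal[OF nz[OF that(1)] s] that(2)])
    \<comment> \<open>Membership in \<open>N s\<close> depends on \<open>x\<close> only through the
      direction \<open>g s x\<close> and the height \<eta>, so a fibre lies in the open set
      \<open>N s\<close> entirely or not at all.\<close>
    show "closed {x \<in> sphere 0 1 \<inter> N s. g s x = v \<and> \<eta> x = c}" for v c
    proof (cases "(\<exists>q\<in>S. h v q < c) \<and> (\<exists>q\<in>S. c < h v q)")
      case True
      then have "{x \<in> sphere 0 1 \<inter> N s. g s x = v \<and> \<eta> x = c} = (S \<inter> g s -` {v}) \<inter> (S \<inter> \<eta> -` {c})"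
        by (auto simp: N_def \<eta>_def)
      moreover have "continuous_on S (g s)" "continuous_on S \<eta>"
        unfolding \<eta>_def[abs_def] by (rule continuous_on_subset[OF cont_g[OF s]], auto)
          (rule continuous_on_subset[OF cont_hgx[OF s]], auto)
      ultimately show ?thesis
        by (simp only:) (intro closed_Int continuous_closed_preimage closed_sphere closed_singleton)
    next
      case False
      then have "{x \<in> sphere 0 1 \<inter> N s. g s x = v \<and> \<eta> x = c} = {}" by (auto simp: N_def \<eta>_def)
      then show ?thesis by (simp only: closed_empty)
    qed
    show "dim (range (g' s x)) + 2 \<le> DIM(real^'n)" if x: "x \<in> N s" for x
    proof -
      obtain u where u: "u \<noteq> 0" "u \<bullet> x = 0" "g' s x u = 0"
        using flat[OF x] J_zero_iff[OF nz[OF x] s] by blast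
      have xu: "x \<noteq> u" using u by auto
      \<comment> \<open>The degenerate tangent direction and the radial direction together give a
        kernel of dimension at least 2.\<close>
      have "independent {x, u}"
        by (rule pairwise_orthogonal_independent)
          (use u nz[OF x] in \<open>auto simp: pairwise_def orthogonal_def inner_commute\<close>)
      then have "dim {x, u} = 2" using xu by (simp add: dim_eq_card_independent)
      moreover have "{x, u} \<subseteq> {v. g' s x v = 0}" using u(3) radial(3)[OF nz[OF x] s] by auto
      ultimately have "2 \<le> dim {v. g' s x v = 0}" using dim_subset by metis
      then show ?thesis using dim_range_plus_kernel[OF lin_g'[OF s nz[OF x]]] by simp
    qed
  qed
qed

lemma lconvex_iff: "L_convex f nT nS \<longleftrightarrow> N 1 = {} \<and> N (-1) = {}"
proof -
  have sp: "support_plane (f ` S) (nT p + s *\<^sub>R nS p) (lor (f p) (nT p + s *\<^sub>R nS p)) \<longleftrightarrow> p \<notin> N s"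
    if p: "p \<in> S" and s: "s = 1 \<or> s = -1" for p s
  proof -
    let ?r = "fst (nT p) + s * fst (nS p)"
    have r: "?r > 0" by (rule nT_nS_pos[OF p s])
    have l: "lor (f q) (nT p + s *\<^sub>R nS p) = ?r * h (g s p) q" if "q \<in> S" for q
      unfolding LG_eq(1)[OF p s] using that
      by (simp add: lor_def h_def F_def f0_def S_sgn algebra_simps inner_commute)
    have "support_plane (f ` S) (nT p + s *\<^sub>R nS p) (lor (f p) (nT p + s *\<^sub>R nS p)) \<longleftrightarrow>
      (\<forall>q\<in>S. h (g s p) q \<le> h (g s p) p) \<or> (\<forall>q\<in>S. h (g s p) q \<ge> h (g s p) p)"
      unfolding support_plane_def using p r by (auto simp: l)
    also have "\<dots> \<longleftrightarrow> p \<notin> N s"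
      using S_nz[OF p] by (auto simp: N_def not_less)
    finally show ?thesis .
  qed
  have "N s = {} \<longleftrightarrow> (\<forall>p\<in>S. p \<notin> N s)" for s
  proof
    assume a: "\<forall>p\<in>S. p \<notin> N s"
    have False if "x \<in> N s" for x
    proof -
      have "x \<noteq> 0" using that by (simp add: N_def)
      moreover have "sgn x \<in> N s" using that \<open>x \<noteq> 0\<close> by (auto simp: N_def sgn_inv h_def sgn_zero_iff)
      ultimately show False using a sgn_S by blast
    qed
    then show "N s = {}" by blast
  qed auto
  then show ?thesis unfolding L_convex_def using sp by (simp add: ball_conj_distrib)
qed


section \<open>Total curvature as an integral over the punctured ball\<close>

lemma Kl_gram:
  assumes p: "p \<in> S" and s: "s = 1 \<or> s = -1"
  shows "\<bar>Kl f nT nS s p\<bar> * sqrt (tdet p (gram f p)) = \<bar>J s p\<bar>"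
proof -
  define w where "w = g s p"
  note nz = S_nz[OF p]
  have pp: "p \<bullet> p = 1" using p by (simp add: dot_square_norm)
  have w: "norm w = 1" unfolding w_def by (rule norm_g[OF nz s])
  have con: "F' p u \<bullet> w = f0' p u" for u unfolding w_def by (rule conormal[OF nz s])
  let ?A = "A w p"
  let ?D = "\<lambda>x. adjoint ?A (?A x)"
  note linA = lin_A[OF nz, of w]
  have linadj: "linear (adjoint ?A)" by (rule adjoint_linear[OF linA])
  have adj: "adjoint ?A a \<bullet> b = a \<bullet> ?A b" for a b
    using adjoint_works[OF linA, of b a] by (simp add: inner_commute)
  have lorA: "lor (sdiff f p z) (sdiff f p y) = ?A z \<bullet> ?A y" if "z \<in> tangent p" "y \<in> tangent p" for z y
  proof -
    have "w \<bullet> F' p u = f0' p u" for u using con[of u] by (simp add: inner_commute)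
    then show ?thesis using that w unfolding sdiff_f[OF p]
      by (simp add: A_def lor_def tangent_def inner_simps con dot_square_norm algebra_simps)
  qed
  have Ap: "?A p = w" using pp by (simp add: A_def radial(2)[OF nz])
  have adjw: "adjoint ?A w = p"
  proof -
    have "(adjoint ?A w - p) \<bullet> z = 0" for z
      using adj[of w z] A_inner[OF w, of p z]
      by (simp add: inner_diff_left inner_commute[of w] inner_commute[of p])
    from this[of "adjoint ?A w - p"] show ?thesis by simp
  qed
  have gram: "gram f p u = ?D u" if u: "u \<in> tangent p" for u
    unfolding gram_def
  proof (rule the_equality)
    have "?D u \<bullet> p = 0" using u by (simp add: adj Ap A_inner[OF w] tangent_def)
    then show "?D u \<in> tangent p \<and> (\<forall>z\<in>tangent p. ?D u \<bullet> z = lor (sdiff f p u) (sdiff f p z))"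
      using u by (simp add: tangent_def[of p] adj lorA)
  next
    fix v assume v: "v \<in> tangent p \<and> (\<forall>z\<in>tangent p. v \<bullet> z = lor (sdiff f p u) (sdiff f p z))"
    have "?D u \<bullet> p = 0" using u by (simp add: adj Ap A_inner[OF w] tangent_def)
    then have t: "v - ?D u \<in> tangent p" using v by (simp add: tangent_def inner_diff_left)
    then have "(v - ?D u) \<bullet> (v - ?D u) = 0"
      using v u by (subst inner_diff_left) (simp add: adj lorA)
    then show "v = ?D u" by simp
  qed
  \<comment> \<open>By \<open>lorA\<close> the map \<open>?A\<close> is isometric on tangent
    vectors, so \<open>gram\<close> is \<open>?A\<close> followed by its adjoint. That composite
    fixes \<open>p\<close>, in agreement with the extension by the identity in
    \<open>tdet\<close>.\<close>
  have "tdet p (gram f p) = det (matrix ?D)"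
  proof -
    have "gram f p (x - (x \<bullet> p) *\<^sub>R p) + (x \<bullet> p) *\<^sub>R p = ?D x" for x
      unfolding gram[OF tangent_decomp(1)[OF p]]
      by (simp add: linear_diff[OF linA] linear_scale[OF linA] linear_diff[OF linadj] linear_scale[OF linadj] Ap adjw)
    then show ?thesis by (simp add: tdet_def)
  qed
  also have "\<dots> = det (matrix ?A) * det (matrix ?A)"
    using matrix_compose[OF linA linadj] by (simp add: o_def det_mul matrix_adjoint[OF linA] det_transpose)
  finally have sq: "sqrt (tdet p (gram f p)) = \<bar>det (matrix ?A)\<bar>" by simp
  obtain B where B: "linear B" "?A \<circ> B = id"
    using linear_surjective_right_inverse[OF linA surj_A[OF nz w con]] by blast
  have AB: "?A (B x) = x" for x using B(2) by (simp add: fun_eq_iff)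
  have perp: "g' s p u \<bullet> w = 0" for u unfolding w_def by (rule g'_perp[OF nz s])
  have Bt: "B (g' s p u) \<in> tangent p" for u
    using A_inner[OF w, of p "B (g' s p u)"] perp[of u] by (simp add: AB tangent_def)
  have inj_df: "z = y" if "z \<in> tangent p" "y \<in> tangent p" "sdiff f p z = sdiff f p y" for z y
  proof -
    have t: "z - y \<in> tangent p" using that by (simp add: tangent_def inner_diff_left)
    have "F' p (z - y) = 0" using that(3) by (simp add: sdiff_f[OF p] linear_diff[OF lin_F'[OF nz]])
    then show ?thesis using spacelike[OF nz, of "z - y"] t by (auto simp: tangent_def)
  qed
  \<comment> \<open>Lorentz products with tangent vectors of \<open>f\<close> become Euclidean
    products with their images under \<open>?A\<close>; the tangential part therefore comes from the
    preimage of \<open>g' s p u\<close> under \<open>?A\<close>.\<close>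
  have ps: "proj_tan f p (0, g' s p u) = sdiff f p (B (g' s p u))" for u
    unfolding proj_tan_def
  proof (rule the_equality)
    let ?z = "B (g' s p u)"
    have n: "lor ((0, g' s p u) - sdiff f p ?z) (sdiff f p y) = 0" if y: "y \<in> tangent p" for y
    proof -
      have "lor ((0, g' s p u) - sdiff f p ?z) (sdiff f p y) = g' s p u \<bullet> F' p y - lor (sdiff f p ?z) (sdiff f p y)"
        by (simp add: sdiff_f[OF p] lor_def inner_diff_left)
      also have "\<dots> = g' s p u \<bullet> F' p y - g' s p u \<bullet> ?A y" by (simp add: lorA[OF Bt y] AB)
      also have "\<dots> = 0" using perp[of u] by (simp add: A_def inner_simps)
      finally show ?thesis .
    qed
    then show "sdiff f p ?z \<in> sdiff f p ` tangent p \<and> (0, g' s p u) - sdiff f p ?z \<in> normal_space f p"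
      using Bt by (auto simp: normal_space_def)
    fix y assume "y \<in> sdiff f p ` tangent p \<and> (0, g' s p u) - y \<in> normal_space f p"
    then obtain z where z: "z \<in> tangent p" "y = sdiff f p z" "(0, g' s p u) - y \<in> normal_space f p" by auto
    let ?d = "z - ?z"
    have t: "?d \<in> tangent p" using z(1) Bt[of u] by (simp add: tangent_def inner_diff_left)
    have "lor ((0, g' s p u) - sdiff f p z) (sdiff f p ?d) = 0" using z t by (simp add: normal_space_def)
    then have "lor (sdiff f p ?d) (sdiff f p ?d) = 0"
      using n[OF t] by (simp add: sdiff_f[OF p] lor_def linear_diff[OF lin_F'[OF nz]] linear_diff[OF lin_f0'[OF nz]]
        inner_diff_left algebra_simps)
    then have "?A ?d \<bullet> ?A ?d = 0" using lorA[OF t t] by simp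
    then have "?A ?d = 0" by simp
    then have "?d = 0" using inj_A[OF nz w con] linear_injective_0[OF linA] by blast
    then show "y = sdiff f p ?z" using z(2) by simp
  qed
  have dv: "dinv f p (- proj_tan f p (sdiff (LG nT nS s) p u)) = - B (g' s p u)" for u
    unfolding sdiff_LG[OF p s] ps dinv_def
  proof (rule the_equality)
    show "- B (g' s p u) \<in> tangent p \<and> sdiff f p (- B (g' s p u)) = - sdiff f p (B (g' s p u))"
      using Bt[of u] by (simp add: tangent_def sdiff_f[OF p] linear_neg[OF lin_F'[OF nz]] linear_neg[OF lin_f0'[OF nz]])
    then show "y = - B (g' s p u)" if "y \<in> tangent p \<and> sdiff f p y = - sdiff f p (B (g' s p u))" for y
      using that inj_df[of y "- B (g' s p u)"] by simp
  qed
  define T where "T = (\<lambda>x. - B (g' s p x) + (x \<bullet> p) *\<^sub>R p)"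
  \<comment> \<open>\<rho> fixes \<open>p\<close> and is -1 on the tangent space. It absorbs the
    minus sign of the shape operator at the cost of a determinant \<plusminus>1.\<close>
  define \<rho> where "\<rho> = (\<lambda>x. (2 * (x \<bullet> p)) *\<^sub>R p - x)"
  note ling = lin_g'[OF s nz]
  have linT: "linear T"
    unfolding T_def by (intro linearI) (simp_all add: linear_add[OF ling] linear_add[OF B(1)] linear_scale[OF ling]
      linear_scale[OF B(1)] inner_add_left algebra_simps)
  have lin\<rho>: "linear \<rho>"
    unfolding \<rho>_def by (intro linearI) (simp_all add: inner_add_left algebra_simps)
  have K: "Kl f nT nS s p = det (matrix T)"
    unfolding Kl_def tdet_def dv T_def tangent_all(3)[OF p s] ..
  have AT: "?A \<circ> T = DG s p \<circ> \<rho>"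
  proof
    fix x
    have "?A (T x) = - g' s p x + (x \<bullet> p) *\<^sub>R w"
      by (simp add: T_def linear_diff[OF linA] linear_scale[OF linA] AB Ap)
    also have "\<dots> = DG s p (\<rho> x)"
      using pp p by (simp add: DG_def \<rho>_def linear_diff[OF ling] linear_scale[OF ling] radial(3)[OF nz s] S_sgn
        inner_diff_left w_def)
    finally show "(?A \<circ> T) x = (DG s p \<circ> \<rho>) x" by simp
  qed
  have "\<rho> \<circ> \<rho> = id" using pp by (auto simp: \<rho>_def fun_eq_iff inner_diff_left algebra_simps)
  then have "matrix \<rho> ** matrix \<rho> = mat 1"
    unfolding matrix_compose[OF lin\<rho> lin\<rho>, symmetric] by (simp add: matrix_id_mat_1)
  then have "det (matrix \<rho>) * det (matrix \<rho>) = 1" unfolding det_mul[symmetric] by simp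
  then have r1: "\<bar>det (matrix \<rho>)\<bar> = 1" by (simp add: abs_square_eq_1 power2_eq_square[symmetric])
  have "det (matrix ?A) * det (matrix T) = J s p * det (matrix \<rho>)"
    unfolding J_def det_mul[symmetric] matrix_compose[OF linT linA, symmetric]
      matrix_compose[OF lin\<rho> lin_DG[OF nz s], symmetric] AT ..
  then have "\<bar>det (matrix ?A)\<bar> * \<bar>det (matrix T)\<bar> = \<bar>J s p\<bar> * \<bar>det (matrix \<rho>)\<bar>"
    by (simp only: abs_mult[symmetric])
  then show ?thesis unfolding sq K r1 by (simp add: mult.commute)
qed

lemma DG_hom:
  assumes "t > 0" "x \<noteq> 0" "s = 1 \<or> s = -1"
  shows "DG s (t *\<^sub>R x) = DG s x"
proof
  fix u
  show "DG s (t *\<^sub>R x) u = DG s x u"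
    using assms hom'(3)[OF assms(1,2,3), of u] by (simp add: DG_def hom sgn_scaleR_pos mult.commute)
qed

lemma J_hom: "t > 0 \<Longrightarrow> x \<noteq> 0 \<Longrightarrow> s = 1 \<or> s = -1 \<Longrightarrow> J s (t *\<^sub>R x) = J s x"
  by (simp add: J_def DG_hom)

lemma J_sgn:
  assumes "x \<noteq> 0" "s = 1 \<or> s = -1"
  shows "J s (sgn x) = J s x"
  using J_hom[of "inverse (norm x)" x s] assms by (simp add: sgn_div_norm)

lemma cont_J:
  assumes s: "s = 1 \<or> s = -1"
  shows "continuous_on (- {0}) (J s)"
proof -
  have "continuous_on (- {0}) (sgn :: real^'n \<Rightarrow> _)" by (rule Ck_continuous[OF Ck_sgn[of 0]])
  then have "continuous_on (- {0}) (\<lambda>x. DG s x v)" for v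
    unfolding DG_def by (intro continuous_intros cont_g' cont_g s) auto
  then have "continuous_on (- {0}) (\<lambda>x. matrix (DG s x) $ i $ j)" for i j
    unfolding matrix_def by (simp add: continuous_on_component)
  then show ?thesis
    unfolding J_def[abs_def] det_def
    by (intro continuous_on_sum continuous_on_mult continuous_on_prod continuous_on_const)
qed

lemma J_bounded:
  assumes s: "s = 1 \<or> s = -1"
  obtains C where "\<And>x. x \<noteq> 0 \<Longrightarrow> \<bar>J s x\<bar> \<le> C"
proof -
  have "compact (J s ` S)"
    by (rule compact_continuous_image[OF continuous_on_subset[OF cont_J[OF s]]]) auto
  then obtain C where "\<And>p. p \<in> S \<Longrightarrow> norm (J s p) \<le> C"
    using compact_imp_bounded bounded_iff by (metis image_eqI)
  then have "\<bar>J s x\<bar> \<le> C" if "x \<noteq> 0" for x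
    using sgn_S[OF that] J_sgn[OF that s] by (metis real_norm_def)
  then show ?thesis using that by blast
qed

text \<open>The homogeneous extensions are controlled only away from the origin, which is a null
  set.\<close>

definition B0 :: "(real^'n) set" where "B0 = ball 0 1 - {0}"

lemma B0_lmeasurable: "B0 \<in> lmeasurable"
  unfolding B0_def by (simp add: lmeasurable_open bounded_diff open_delete)

lemma measure_B0_pos: "measure lebesgue B0 > 0"
proof -
  have "open B0" "B0 \<noteq> {}"
  proof -
    show "open B0" by (simp add: B0_def open_delete)
    obtain e :: "real^'n" where "norm e = 1/2" using vector_choose_size[of "1/2"] by auto
    then have "e \<in> B0" by (auto simp: B0_def)
    then show "B0 \<noteq> {}" by blast
  qed
  then have "\<not> negligible B0" by (rule open_not_negligible)
  then show ?thesis
    using B0_lmeasurable by (simp add: negligible_iff_measure less_le)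
qed

lemma J_integrable:
  assumes s: "s = 1 \<or> s = -1" and X: "X \<in> sets lebesgue" "X \<subseteq> B0"
  shows "(\<lambda>x. \<bar>J s x\<bar>) integrable_on X"
proof -
  obtain C where C: "\<And>x. x \<noteq> 0 \<Longrightarrow> \<bar>J s x\<bar> \<le> C" using J_bounded[OF s] by blast
  have "X \<in> lmeasurable" using fmeasurableI2[OF B0_lmeasurable X(2,1)] .
  then have int: "(\<lambda>x. C) integrable_on X" by (rule integrable_on_const)
  have "continuous_on X (\<lambda>x. \<bar>J s x\<bar>)"
    by (rule continuous_on_subset[of "- {0}"]) (use X(2) cont_J[OF s] in \<open>auto simp: B0_def intro: continuous_on_rabs\<close>)
  then have meas: "(\<lambda>x. \<bar>J s x\<bar>) \<in> borel_measurable (lebesgue_on X)"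
    using X(1) by (rule continuous_imp_measurable_on_sets_lebesgue)
  show ?thesis
  proof (rule measurable_bounded_by_integrable_imp_integrable[OF meas int])
    show "norm \<bar>J s x\<bar> \<le> C" if "x \<in> X" for x
      using C[of x] X(2) that by (auto simp: B0_def)
  qed (rule X(1))
qed

text \<open>The dimension factor from polar coordinates occurs in the curvature integral and in the
  volume of the sphere, and cancels in the quotient.\<close>

lemma tau_eq:
  assumes s: "s = 1 \<or> s = -1"
  shows "tau_l f nT nS s = integral B0 (\<lambda>x. \<bar>J s x\<bar>) / measure lebesgue B0"
proof -
  have sp: "integral (ball 0 1) \<phi> = integral B0 \<phi>" for \<phi> :: "real^'n \<Rightarrow> real"
    unfolding B0_def by (rule integral_spike_set; rule negligible_subset[of "{0}"]) auto
  have n: "real CARD('n) > 0" by simp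
  have "gamma_sphere TYPE('n) = real CARD('n) * measure lebesgue B0"
    unfolding gamma_sphere_def sphere_integral_def sp using B0_lmeasurable by (simp add: lmeasure_integral)
  moreover have "integral_M f (\<lambda>p. \<bar>Kl f nT nS s p\<bar>) = real CARD('n) * integral B0 (\<lambda>x. \<bar>J s x\<bar>)"
  proof -
    have "integral B0 (\<lambda>x. \<bar>Kl f nT nS s (x /\<^sub>R norm x)\<bar> * sqrt (tdet (x /\<^sub>R norm x) (gram f (x /\<^sub>R norm x))))
        = integral B0 (\<lambda>x. \<bar>J s x\<bar>)"
    proof (rule integral_cong)
      fix x assume "x \<in> B0"
      then have x: "x \<noteq> 0" by (simp add: B0_def)
      show "\<bar>Kl f nT nS s (x /\<^sub>R norm x)\<bar> * sqrt (tdet (x /\<^sub>R norm x) (gram f (x /\<^sub>R norm x))) = \<bar>J s x\<bar>"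
        using Kl_gram[OF sgn_S[OF x] s] J_sgn[OF x s] by (simp only: sgn_div_norm)
    qed
    then show ?thesis unfolding integral_M_def sphere_integral_def sp by simp
  qed
  ultimately show ?thesis unfolding tau_l_def using n by simp
qed


section \<open>Extrema cover all directions; the non-extremal sets are flat\<close>

lemma DIM2: "2 \<le> DIM(real^'n)"
  using card2 by simp

lemma extremum_conormal:
  assumes p: "p \<in> S" and ext: "(\<forall>q\<in>S. h w q \<le> h w p) \<or> (\<forall>q\<in>S. h w p \<le> h w q)"
  shows "F' p u \<bullet> w = f0' p u"
proof -
  have hs: "h w (sgn x) = h w x" for x by (simp add: h_def sgn_inv)
  have "(\<lambda>v. F' p v \<bullet> w - f0' p v) = (\<lambda>v. 0)"
  proof (rule differential_zero_maxmin[OF _ open_nz der_h[OF S_nz[OF p]]])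
    show "p \<in> - {0}" using S_nz[OF p] by simp
    show "(\<forall>y\<in>- {0}. h w y \<le> h w p) \<or> (\<forall>y\<in>- {0}. h w p \<le> h w y)"
      using ext
    proof
      assume a: "\<forall>q\<in>S. h w q \<le> h w p"
      have "h w y \<le> h w p" if "y \<in> - {0}" for y using bspec[OF a sgn_S, of y] that by (simp add: hs)
      then show ?thesis by blast
    next
      assume a: "\<forall>q\<in>S. h w p \<le> h w q"
      have "h w p \<le> h w y" if "y \<in> - {0}" for y using bspec[OF a sgn_S, of y] that by (simp add: hs)
      then show ?thesis by blast
    qed
  qed
  from fun_cong[OF this, of u] show ?thesis by simp
qed

lemma S_ne: "S \<noteq> ({} :: (real^'n) set)"
  by simp

lemma continuous_on_S: "continuous_on (- {0}) \<phi> \<Longrightarrow> continuous_on S \<phi>" for \<phi> :: "real^'n \<Rightarrow> 'c::topological_space"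
  by (rule continuous_on_subset) auto

text \<open>If \<open>h w\<close> were constant, \<open>w\<close> would be conormal everywhere and
  \<open>A w p\<close> onto at every \<open>p\<close>; then \<open>F x \<bullet> e\<close> with
  \<open>e\<close> orthogonal to \<open>w\<close> could have no maximum on the sphere.
  Geometrically, projection would immerse the compact sphere in the complement of \<open>w\<close>,
  a vector space of its own dimension.\<close>

lemma h_nonconst:
  assumes w: "norm w = 1" and const: "\<And>p q. p \<in> S \<Longrightarrow> q \<in> S \<Longrightarrow> h w p = h w q"
  shows False
proof -
  have con: "F' p u \<bullet> w = f0' p u" if "p \<in> S" for p u
    by (rule extremum_conormal[OF that]) (use const[OF _ that] in auto)
  obtain e where e: "e \<noteq> 0" "orthogonal w e"
    using orthogonal_to_vector_exists[OF DIM2] by blast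
  have "continuous_on S (\<lambda>x. F x \<bullet> e)"
    by (intro continuous_on_inner continuous_on_S cont_F continuous_on_const)
  then obtain p where p: "p \<in> S" "\<forall>q\<in>S. F q \<bullet> e \<le> F p \<bullet> e"
    using continuous_attains_sup[OF compact_sphere S_ne] by blast
  obtain u where u: "A w p u = e" using surj_A[OF S_nz[OF p(1)] w con[OF p(1)]] by (metis surjD)
  have "(\<lambda>v. F' p v \<bullet> e) = (\<lambda>v. 0)"
  proof (rule differential_zero_maxmin[of p "- {0}" "\<lambda>x. F x \<bullet> e"])
    show "((\<lambda>x. F x \<bullet> e) has_derivative (\<lambda>v. F' p v \<bullet> e)) (at p)"
      by (intro has_derivative_inner_left der_F S_nz p(1))
    have "F y \<bullet> e \<le> F p \<bullet> e" if "y \<in> - {0}" for y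
      using bspec[OF p(2) sgn_S, of y] that by (simp add: sgn_inv)
    then show "(\<forall>y\<in>- {0}. F y \<bullet> e \<le> F p \<bullet> e) \<or> (\<forall>y\<in>- {0}. F p \<bullet> e \<le> F y \<bullet> e)" by blast
  qed (use S_nz[OF p(1)] in auto)
  then have "F' p u \<bullet> e = 0" by (rule fun_cong)
  moreover have "A w p u \<bullet> e = F' p u \<bullet> e" using e(2) by (simp add: A_def inner_simps orthogonal_def)
  ultimately show False using u e(1) by simp
qed

lemma h_attains:
  obtains p where "p \<in> S" "\<And>q. q \<in> S \<Longrightarrow> h w q \<le> h w p"
  using continuous_attains_sup[OF compact_sphere S_ne continuous_on_S[OF cont_h_fixed]] by blast

lemma h_attains_inf:
  obtains p where "p \<in> S" "\<And>q. q \<in> S \<Longrightarrow> h w p \<le> h w q"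
  using continuous_attains_inf[OF compact_sphere S_ne continuous_on_S[OF cont_h_fixed]] by blast

lemma Lo_Hi_cover:
  assumes "x \<noteq> 0" "s = 1 \<or> s = -1"
  shows "x \<in> Lo s \<or> x \<in> Hi s"
proof (rule ccontr)
  assume "\<not> ?thesis"
  then have e: "h (g s x) q = h (g s x) x" if "q \<in> S" for q
    using assms(1) that by (force simp: Lo_def Hi_def)
  show False by (rule h_nonconst[OF norm_g[OF assms]]) (simp only: e)
qed

lemma der_G:
  assumes "x \<noteq> 0" "s = 1 \<or> s = -1"
  shows "(G s has_derivative DG s x) (at x)"
  unfolding G_def[abs_def] DG_def[abs_def]
  using has_derivative_scaleR[OF has_derivative_norm[OF assms(1)] der_g[OF assms(2,1)]]
  by (simp add: inner_commute)

lemma norm_G: "x \<noteq> 0 \<Longrightarrow> s = 1 \<or> s = -1 \<Longrightarrow> norm (G s x) = norm x"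
  by (simp add: G_def norm_g)

lemma sgn_G: "x \<noteq> 0 \<Longrightarrow> s = 1 \<or> s = -1 \<Longrightarrow> sgn (G s x) = g s x"
  unfolding sgn_div_norm norm_G by (simp add: G_def)

lemma image_measure:
  assumes s: "s = 1 \<or> s = -1" and X: "X \<in> sets lebesgue" "X \<subseteq> B0"
  shows "G s ` X \<in> lmeasurable" "measure lebesgue (G s ` X) \<le> integral X (\<lambda>x. \<bar>J s x\<bar>)"
    "inj_on (G s) X \<Longrightarrow> measure lebesgue (G s ` X) = integral X (\<lambda>x. \<bar>J s x\<bar>)"
proof -
  have d: "(G s has_derivative DG s x) (at x within X)" if "x \<in> X" for x
    by (rule has_derivative_at_withinI[OF der_G[OF _ s]]) (use X(2) that in \<open>auto simp: B0_def\<close>)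
  note I = J_integrable[OF s X, unfolded J_def]
  show "G s ` X \<in> lmeasurable" by (rule lmeasurable_image_vec[OF X(1) d I])
  show "measure lebesgue (G s ` X) \<le> integral X (\<lambda>x. \<bar>J s x\<bar>)"
    unfolding J_def by (rule measure_image_le_vec[OF X(1) d I])
  show "measure lebesgue (G s ` X) = integral X (\<lambda>x. \<bar>J s x\<bar>)" if "inj_on (G s) X"
    unfolding J_def by (rule measure_image_eq_vec[OF X(1) d I that])
qed

lemma B0_sets: "B0 \<in> sets lebesgue" and open_B0: "open B0"
  using B0_lmeasurable by (auto simp: B0_def open_delete)

lemma B0_scale:
  assumes "y \<in> B0" "p \<in> S"
  shows "norm y *\<^sub>R p \<in> B0" "g s (norm y *\<^sub>R p) = g s p" "h w (norm y *\<^sub>R p) = h w p"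
    "g s p = sgn y \<Longrightarrow> G s (norm y *\<^sub>R p) = y"
proof -
  have y: "norm y > 0" using assms(1) by (simp add: B0_def)
  show "norm y *\<^sub>R p \<in> B0" using assms by (auto simp: B0_def)
  show *: "g s (norm y *\<^sub>R p) = g s p" by (rule hom(3)[OF y])
  show "h w (norm y *\<^sub>R p) = h w p" by (rule h_hom[OF y])
  show "G s (norm y *\<^sub>R p) = y" if "g s p = sgn y"
    using assms(2) y by (simp add: G_def * that sgn_div_norm)
qed

text \<open>An extremum \<open>p\<close> of the height function in direction \<open>sgn y\<close> is
  critical, so \<open>sgn y\<close> is one of the two Gauss images of \<open>p\<close>, and the
  multiple of \<open>p\<close> with the norm of \<open>y\<close> is sent to
  \<open>y\<close>.\<close>

lemma cover_by_extrema:
  "B0 \<subseteq> G 1 ` (B0 - Hi 1) \<union> G (-1) ` (B0 - Hi (-1))"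
  "B0 \<subseteq> G 1 ` (B0 - Lo 1) \<union> G (-1) ` (B0 - Lo (-1))"
proof -
  have aux: "\<exists>s x. (s = 1 \<or> s = -1) \<and> x \<in> B0 \<and> x = norm y *\<^sub>R p \<and> g s x = sgn y \<and> G s x = y"
    if y: "y \<in> B0" and p: "p \<in> S" and con: "\<And>u. F' p u \<bullet> sgn y = f0' p u" for y p
  proof -
    have "norm (sgn y) = 1" using y by (simp add: B0_def norm_sgn)
    then obtain s where s: "s = 1 \<or> s = -1" "g s p = sgn y"
      using conormal_unique[OF p _ con] by metis
    show ?thesis
      using s B0_scale(1)[OF y p] B0_scale(2)[OF y p, of s] B0_scale(4)[OF y p s(2)] by auto
  qed
  show "B0 \<subseteq> G 1 ` (B0 - Hi 1) \<union> G (-1) ` (B0 - Hi (-1))"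
  proof
    fix y assume y: "y \<in> B0"
    obtain p where p: "p \<in> S" "\<And>q. q \<in> S \<Longrightarrow> h (sgn y) q \<le> h (sgn y) p" by (rule h_attains) (rule that)
    have "F' p u \<bullet> sgn y = f0' p u" for u by (rule extremum_conormal[OF p(1)]) (use p(2) in blast)
    from aux[OF y p(1) this] obtain s x where s: "s = 1 \<or> s = -1"
      and x: "x \<in> B0" "x = norm y *\<^sub>R p" "g s x = sgn y" "G s x = y" by blast
    have "h (sgn y) x = h (sgn y) p" unfolding x(2) by (rule B0_scale(3)[OF y p(1)])
    then have "x \<notin> Hi s" using p(2) by (simp add: Hi_def x(3) not_less)
    then have "y \<in> G s ` (B0 - Hi s)" using x by (intro image_eqI[of _ _ x]) auto
    then show "y \<in> G 1 ` (B0 - Hi 1) \<union> G (-1) ` (B0 - Hi (-1))" using s by auto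
  qed
  show "B0 \<subseteq> G 1 ` (B0 - Lo 1) \<union> G (-1) ` (B0 - Lo (-1))"
  proof
    fix y assume y: "y \<in> B0"
    obtain p where p: "p \<in> S" "\<And>q. q \<in> S \<Longrightarrow> h (sgn y) p \<le> h (sgn y) q" by (rule h_attains_inf) (rule that)
    have "F' p u \<bullet> sgn y = f0' p u" for u by (rule extremum_conormal[OF p(1)]) (use p(2) in blast)
    from aux[OF y p(1) this] obtain s x where s: "s = 1 \<or> s = -1"
      and x: "x \<in> B0" "x = norm y *\<^sub>R p" "g s x = sgn y" "G s x = y" by blast
    have "h (sgn y) x = h (sgn y) p" unfolding x(2) by (rule B0_scale(3)[OF y p(1)])
    then have "x \<notin> Lo s" using p(2) by (simp add: Lo_def x(3) not_less)
    then have "y \<in> G s ` (B0 - Lo s)" using x by (intro image_eqI[of _ _ x]) auto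
    then show "y \<in> G 1 ` (B0 - Lo 1) \<union> G (-1) ` (B0 - Lo (-1))" using s by auto
  qed
qed

lemma measure_cover_le:
  assumes X: "X 1 \<in> sets lebesgue" "X 1 \<subseteq> B0" "X (-1) \<in> sets lebesgue" "X (-1) \<subseteq> B0"
    and cov: "B0 \<subseteq> G 1 ` X 1 \<union> G (-1) ` X (-1)"
  shows "measure lebesgue B0 \<le> integral (X 1) (\<lambda>x. \<bar>J 1 x\<bar>) + integral (X (-1)) (\<lambda>x. \<bar>J (-1) x\<bar>)"
proof -
  have s: "(1::real) = 1 \<or> (1::real) = -1" "(-1::real) = 1 \<or> (-1::real) = -1" by auto
  note I1 = image_measure(1,2)[OF s(1) X(1,2)] and I2 = image_measure(1,2)[OF s(2) X(3,4)]
  have "measure lebesgue B0 \<le> measure lebesgue (G 1 ` X 1 \<union> G (-1) ` X (-1))"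
    by (rule measure_mono_fmeasurable[OF cov B0_sets fmeasurable.Un[OF I1(1) I2(1)]])
  also have "\<dots> \<le> measure lebesgue (G 1 ` X 1) + measure lebesgue (G (-1) ` X (-1))"
    by (rule measure_Un_le[OF fmeasurableD[OF I1(1)] fmeasurableD[OF I2(1)]])
  finally show ?thesis using I1(2) I2(2) by linarith
qed

text \<open>The three parts are the maxima, the minima and the rest. Maxima and minima do not
  overlap because no height function is constant.\<close>

lemma J_split:
  assumes s: "s = 1 \<or> s = -1"
  shows "integral B0 (\<lambda>x. \<bar>J s x\<bar>) = integral (B0 - Hi s) (\<lambda>x. \<bar>J s x\<bar>) + integral (B0 - Lo s) (\<lambda>x. \<bar>J s x\<bar>)
     + integral (B0 \<inter> N s) (\<lambda>x. \<bar>J s x\<bar>)"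
proof -
  have m: "B0 - Hi s \<in> sets lebesgue" "B0 - Lo s \<in> sets lebesgue" "B0 \<inter> N s \<in> sets lebesgue"
    using open_Lo_Hi[OF s] open_N[OF s] B0_sets by auto
  have i: "((\<lambda>x. \<bar>J s x\<bar>) has_integral integral X (\<lambda>x. \<bar>J s x\<bar>)) X" if "X \<in> sets lebesgue" "X \<subseteq> B0" for X
    using J_integrable[OF s that] by (rule integrable_integral)
  have d1: "(B0 - Hi s) \<inter> (B0 - Lo s) = {}" using Lo_Hi_cover[OF _ s] by (auto simp: B0_def)
  have d2: "((B0 - Hi s) \<union> (B0 - Lo s)) \<inter> (B0 \<inter> N s) = {}" by (auto simp: N_Lo_Hi)
  have u: "(B0 - Hi s) \<union> (B0 - Lo s) \<union> (B0 \<inter> N s) = B0" by (auto simp: N_Lo_Hi)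
  have "((\<lambda>x. \<bar>J s x\<bar>) has_integral (integral (B0 - Hi s) (\<lambda>x. \<bar>J s x\<bar>) + integral (B0 - Lo s) (\<lambda>x. \<bar>J s x\<bar>)
     + integral (B0 \<inter> N s) (\<lambda>x. \<bar>J s x\<bar>))) ((B0 - Hi s) \<union> (B0 - Lo s) \<union> (B0 \<inter> N s))"
    by (intro has_integral_Un i m) (auto simp: d1 d2)
  then show ?thesis unfolding u by (rule integral_unique)
qed

lemma J_zero_on_open:
  assumes s: "s = 1 \<or> s = -1" and O: "open X" "X \<subseteq> B0" and z: "integral X (\<lambda>x. \<bar>J s x\<bar>) = 0" and x: "x \<in> X"
  shows "J s x = 0"
proof -
  obtain a b where ab: "cbox a b \<subseteq> X" "x \<in> box a b"
    using open_contains_cbox[OF O(1) x] by metis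
  have ms: "X \<in> sets lebesgue" "cbox a b \<in> sets lebesgue" using O(1) by auto
  have I: "(\<lambda>x. \<bar>J s x\<bar>) integrable_on X" "(\<lambda>x. \<bar>J s x\<bar>) integrable_on cbox a b"
    using J_integrable[OF s ms(1) O(2)] J_integrable[OF s ms(2)] ab(1) O(2) by auto
  have "integral (cbox a b) (\<lambda>x. \<bar>J s x\<bar>) \<le> integral X (\<lambda>x. \<bar>J s x\<bar>)"
    by (rule integral_subset_le[OF ab(1) I(2,1)]) simp
  moreover have "0 \<le> integral (cbox a b) (\<lambda>x. \<bar>J s x\<bar>)" by (rule integral_nonneg[OF I(2)]) simp
  ultimately have "integral (cbox a b) (\<lambda>x. \<bar>J s x\<bar>) = 0" using z by linarith
  then have hi: "((\<lambda>x. \<bar>J s x\<bar>) has_integral 0) (cbox a b)" using integrable_integral[OF I(2)] by simp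
  have "continuous_on (cbox a b) (\<lambda>x. \<bar>J s x\<bar>)"
    by (rule continuous_on_rabs, rule continuous_on_subset[OF cont_J[OF s]]) (use ab(1) O(2) in \<open>auto simp: B0_def\<close>)
  then have "\<bar>J s x\<bar> = 0"
    by (rule has_integral_0_cbox_imp_0[OF _ _ hi]) (use ab(2) box_subset_cbox in auto)
  then show ?thesis by simp
qed

lemma N_scale_B0:
  assumes x: "x \<in> N s" and s: "s = 1 \<or> s = -1"
  obtains t where "t > 0" "t *\<^sub>R x \<in> B0 \<inter> N s" "J s (t *\<^sub>R x) = J s x"
proof (rule that)
  have nz: "x \<noteq> 0" using x by (simp add: N_def)
  let ?t = "inverse (2 * norm x)"
  show t: "?t > 0" using nz by simp
  have "?t *\<^sub>R x \<in> N s" using x t nz by (simp only: N_def mem_Collect_eq hom(3)[OF t] h_hom[OF t]) simp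
  then show "?t *\<^sub>R x \<in> B0 \<inter> N s" using nz by (simp add: B0_def)
  show "J s (?t *\<^sub>R x) = J s x" by (rule J_hom[OF t nz s])
qed

lemma tau_total_imp_flat:
  assumes tau: "tau_total f nT nS = 2" and s: "s = 1 \<or> s = -1" and x: "x \<in> N s"
  shows "J s x = 0"
proof -
  have s1: "(1::real) = 1 \<or> (1::real) = -1" "(-1::real) = 1 \<or> (-1::real) = -1" by auto
  let ?I = "\<lambda>s X. integral X (\<lambda>x. \<bar>J s x\<bar>)"
  have m: "B0 - Hi s \<in> sets lebesgue" "B0 - Lo s \<in> sets lebesgue" "B0 \<inter> N s \<in> sets lebesgue" if "s = 1 \<or> s = -1" for s
    using open_Lo_Hi[OF that] open_N[OF that] B0_sets by auto
  have "(?I 1 B0 + ?I (-1) B0) / measure lebesgue B0 = 2"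
    using tau unfolding tau_total_def tau_eq[OF s1(1)] tau_eq[OF s1(2)] by (simp add: add_divide_distrib)
  then have tot: "?I 1 B0 + ?I (-1) B0 = 2 * measure lebesgue B0"
    using measure_B0_pos by (simp add: field_simps)
  have "measure lebesgue B0 \<le> ?I 1 (B0 - Hi 1) + ?I (-1) (B0 - Hi (-1))"
    by (rule measure_cover_le[of "\<lambda>s. B0 - Hi s"]) (use m(1)[OF s1(1)] m(1)[OF s1(2)] cover_by_extrema(1) in auto)
  moreover have "measure lebesgue B0 \<le> ?I 1 (B0 - Lo 1) + ?I (-1) (B0 - Lo (-1))"
    by (rule measure_cover_le[of "\<lambda>s. B0 - Lo s"]) (use m(2)[OF s1(1)] m(2)[OF s1(2)] cover_by_extrema(2) in auto)
  ultimately have le: "?I 1 (B0 \<inter> N 1) + ?I (-1) (B0 \<inter> N (-1)) \<le> 0"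
    using tot J_split[OF s1(1)] J_split[OF s1(2)] by linarith
  have nn: "0 \<le> ?I s (B0 \<inter> N s)" if "s = 1 \<or> s = -1" for s
    by (rule integral_nonneg[OF J_integrable[OF that m(3)[OF that]]]) auto
  have z: "?I s (B0 \<inter> N s) = 0"
    using le nn[OF s1(1)] nn[OF s1(2)] s by (elim disjE) (hypsubst, linarith)+
  obtain t where t: "t > 0" "t *\<^sub>R x \<in> B0 \<inter> N s" "J s (t *\<^sub>R x) = J s x"
    by (rule N_scale_B0[OF x s]) (rule that)
  have "J s (t *\<^sub>R x) = 0"
    by (rule J_zero_on_open[OF s _ _ z t(2)]) (use open_B0 open_N[OF s] in auto)
  then show ?thesis using t(3) by simp
qed

text \<open>Sard's theorem in equal dimensions: the integral of \<bar>J\<bar> over the critical set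
  bounds the measure of its image and is 0.\<close>

lemma critical_values_negligible:
  assumes s: "s = 1 \<or> s = -1"
  shows "negligible (G s ` {x \<in> B0. J s x = 0})"
proof -
  let ?X = "{x \<in> B0. J s x = 0}"
  have "open (- {0} \<inter> J s -` (- {0}))" by (rule continuous_open_preimage[OF cont_J[OF s] open_nz]) auto
  moreover have "?X = B0 - (- {0} \<inter> J s -` (- {0}))" by (auto simp: B0_def)
  ultimately have X: "?X \<in> sets lebesgue" "?X \<subseteq> B0" using B0_sets by auto
  have "integral ?X (\<lambda>x. \<bar>J s x\<bar>) = 0"
    by (rule integral_unique, rule has_integral_is_0) simp
  then have "measure lebesgue (G s ` ?X) = 0"
    using image_measure(2)[OF s X] measure_nonneg[of lebesgue "G s ` ?X"] by linarith
  then show ?thesis using image_measure(1)[OF s X] by (simp add: negligible_iff_measure)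
qed

text \<open>Near a regular non-extremal point \<open>G s\<close> covers an open set, which contains
  a \<open>y\<close> that is no critical value of either map. The height function in direction
  \<open>sgn y\<close> is Morse, and besides a maximum and a minimum it has a critical point
  strictly between them.\<close>

lemma tight_imp_flat:
  assumes tight: "L_tight f" and s: "s = 1 \<or> s = -1" and x: "x \<in> N s"
  shows "J s x = 0"
proof (rule ccontr)
  assume Jx: "J s x \<noteq> 0"
  have s1: "(1::real) = 1 \<or> (1::real) = -1" "(-1::real) = 1 \<or> (-1::real) = -1" by auto
  obtain t where t: "t > 0" "t *\<^sub>R x \<in> B0 \<inter> N s" "J s (t *\<^sub>R x) = J s x"
    by (rule N_scale_B0[OF x s]) (rule that)
  let ?x = "t *\<^sub>R x"
  have nz: "?x \<noteq> 0" using t(2) by (simp add: B0_def)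
  have O: "open (B0 \<inter> N s)" using open_B0 open_N[OF s] by blast
  have "inj (DG s ?x)" using Jx t(3) det_nz_iff_inj[OF lin_DG[OF nz s]] by (simp add: J_def)
  then have "surj (DG s ?x)" by (rule linear_inj_imp_surj[OF lin_DG[OF nz s]])
  then obtain R where R: "linear R" "DG s ?x \<circ> R = id"
    using linear_surjective_right_inverse[OF lin_DG[OF nz s]] by blast
  have contG: "continuous_on (B0 \<inter> N s) (G s)"
    by (rule continuous_at_imp_continuous_on) (use der_G[OF _ s] in \<open>auto simp: B0_def intro: has_derivative_continuous\<close>)
  have "G s ?x \<in> interior (G s ` (B0 \<inter> N s))"
  proof (rule sussmann_open_mapping[OF O contG t(2) der_G[OF nz s] _ R(2) order_refl])
    show "bounded_linear R" using R(1) by (simp add: linear_conv_bounded_linear)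
    show "?x \<in> interior (B0 \<inter> N s)" unfolding interior_open[OF O] by (rule t(2))
  qed
  then have "\<not> negligible (interior (G s ` (B0 \<inter> N s)))"
    by (intro open_not_negligible) auto
  moreover have "negligible (G 1 ` {x \<in> B0. J 1 x = 0} \<union> G (-1) ` {x \<in> B0. J (-1) x = 0})"
    by (intro negligible_Un critical_values_negligible s1)
  ultimately have "\<not> interior (G s ` (B0 \<inter> N s)) \<subseteq> G 1 ` {x \<in> B0. J 1 x = 0} \<union> G (-1) ` {x \<in> B0. J (-1) x = 0}"
    using negligible_subset by blast
  then obtain y where "y \<in> interior (G s ` (B0 \<inter> N s))"
    and y2: "y \<notin> G 1 ` {x \<in> B0. J 1 x = 0}" "y \<notin> G (-1) ` {x \<in> B0. J (-1) x = 0}" by blast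
  then obtain x1 where x1: "x1 \<in> B0" "x1 \<in> N s" "y = G s x1" using interior_subset by blast
  have x1nz: "x1 \<noteq> 0" using x1(1) by (simp add: B0_def)
  define w where "w = g s x1"
  have w: "norm w = 1" unfolding w_def by (rule norm_g[OF x1nz s])
  have yw: "sgn y = w" "y \<in> B0" using x1(1) sgn_G[OF x1nz s] norm_G[OF x1nz s] by (auto simp: B0_def x1(3) w_def)
  define p where "p = sgn x1"
  have p: "p \<in> S" unfolding p_def by (rule sgn_S[OF x1nz])
  have gp: "g s p = w" by (simp add: p_def w_def sgn_inv)
  have hp: "h w p = h w x1" by (simp add: p_def h_def sgn_inv)
  have "morse (height f (1, w))"
  proof (rule morseI[OF w])
    fix \<sigma> q assume \<sigma>: "\<sigma> = 1 \<or> \<sigma> = (-1::real)" and q: "q \<in> S" and gq: "g \<sigma> q = w"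
    show "J \<sigma> q \<noteq> 0"
    proof
      assume "J \<sigma> q = 0"
      moreover have "norm y > 0" using yw(2) by (simp add: B0_def)
      ultimately have "J \<sigma> (norm y *\<^sub>R q) = 0" using J_hom[OF _ S_nz[OF q] \<sigma>] by simp
      then have "y \<in> G \<sigma> ` {x \<in> B0. J \<sigma> x = 0}"
        using B0_scale(1)[OF yw(2) q] B0_scale(4)[OF yw(2) q, of \<sigma>] gq yw(1)
        by (intro image_eqI[of _ _ "norm y *\<^sub>R q"]) auto
      then show False using y2 \<sigma> by auto
    qed
  qed
  moreover have "(1, w) \<in> lightcone_plus" using w by (simp add: lightcone_plus_def lor_def dot_square_norm)
  ultimately have card: "card {p. critical (height f (1, w)) p} = 2"
    using tight by (auto simp: L_tight_def)
  then have fin: "finite {p. critical (height f (1, w)) p}" by (metis card.infinite zero_neq_numeral)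
  obtain a where a: "a \<in> S" "\<And>q. q \<in> S \<Longrightarrow> h w q \<le> h w a" by (rule h_attains) (rule that)
  obtain b where b: "b \<in> S" "\<And>q. q \<in> S \<Longrightarrow> h w b \<le> h w q" by (rule h_attains_inf) (rule that)
  obtain q1 q2 where q: "q1 \<in> S" "h w q1 < h w p" "q2 \<in> S" "h w p < h w q2"
    using x1(2) by (auto simp: N_def hp w_def[symmetric])
  have "h w b < h w p" "h w p < h w a" using a(2)[OF q(3)] b(2)[OF q(1)] q by linarith+
  then have ne: "a \<noteq> b" "a \<noteq> p" "b \<noteq> p" by auto
  have "critical (height f (1, w)) a"
    unfolding critical_iff[OF w] using conormal_unique[OF a(1) w extremum_conormal[OF a(1)]] a by blast
  moreover have "critical (height f (1, w)) b"
    unfolding critical_iff[OF w] using conormal_unique[OF b(1) w extremum_conormal[OF b(1)]] b by blast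
  moreover have "critical (height f (1, w)) p"
    unfolding critical_iff[OF w] using p gp s by auto
  ultimately have "{a, b, p} \<subseteq> {p. critical (height f (1, w)) p}" by blast
  from card_mono[OF fin this] show False using ne card by simp
qed


section \<open>L-convex spheres: causal order and covering exactly once\<close>

text \<open>The sign \<open>\<epsilon>\<close> is \<open>1\<close> for maxima and \<open>-1\<close> for minima.\<close>

definition pure :: "real \<Rightarrow> real \<Rightarrow> bool" where
  "pure s \<epsilon> \<longleftrightarrow> (\<forall>p\<in>S. \<forall>q\<in>S. \<epsilon> * h (g s p) q \<le> \<epsilon> * h (g s p) p) \<and>
     (\<forall>p\<in>S. \<forall>w. norm w = 1 \<longrightarrow> (\<forall>q\<in>S. \<epsilon> * h w q \<le> \<epsilon> * h w p) \<longrightarrow> w = g s p)"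

lemma pureD1: "pure s \<epsilon> \<Longrightarrow> p \<in> S \<Longrightarrow> q \<in> S \<Longrightarrow> \<epsilon> * h (g s p) q \<le> \<epsilon> * h (g s p) p"
  and pureD2: "pure s \<epsilon> \<Longrightarrow> p \<in> S \<Longrightarrow> norm w = 1 \<Longrightarrow> (\<And>q. q \<in> S \<Longrightarrow> \<epsilon> * h w q \<le> \<epsilon> * h w p) \<Longrightarrow> w = g s p"
  by (simp_all add: pure_def)

lemma h_extremum:
  assumes w: "norm w = 1" and p: "p \<in> S" and ext: "(\<forall>q\<in>S. h w q \<le> h w p) \<or> (\<forall>q\<in>S. h w p \<le> h w q)"
  shows "w = g 1 p \<or> w = g (-1) p"
  by (rule conormal_unique[OF p w extremum_conormal[OF p ext]])

text \<open>The two normal directions cannot both be of maximum type: the minimum of a lightcone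
  height function is a critical point of one of them.\<close>

lemma convex_pure:
  assumes N: "N 1 = {}" "N (-1) = {}"
  obtains \<sigma> where "\<sigma> = 1 \<or> \<sigma> = -1" "pure \<sigma> 1" "pure (- \<sigma>) (-1)"
proof -
  define ext where "ext s \<epsilon> \<longleftrightarrow> (\<forall>p\<in>S. \<forall>q\<in>S. \<epsilon> * h (g s p) q \<le> \<epsilon> * h (g s p) p)" for s \<epsilon>
  have side: "ext s 1 \<or> ext s (-1)" if s: "s = 1 \<or> s = -1" for s
  proof -
    have e: "N s = {}" using N s by auto
    have conn: "connected (S :: (real^'n) set)" by (rule connected_sphere[OF DIM2])
    have cov: "S \<subseteq> Lo s \<union> Hi s" using Lo_Hi_cover[OF S_nz s] by blast
    have "Lo s \<inter> Hi s \<inter> S = {}" using e N_Lo_Hi by blast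
    from connectedD[OF conn open_Lo_Hi[OF s] this cov]
    show ?thesis
    proof
      assume *: "Hi s \<inter> S = {}"
      have "h (g s p) q \<le> h (g s p) p" if "p \<in> S" "q \<in> S" for p q
        using * that S_nz[OF that(1)] by (force simp: Hi_def)
      then show ?thesis by (simp add: ext_def)
    next
      assume *: "Lo s \<inter> S = {}"
      have "h (g s p) p \<le> h (g s p) q" if "p \<in> S" "q \<in> S" for p q
        using * that S_nz[OF that(1)] by (force simp: Lo_def)
      then show ?thesis by (simp add: ext_def)
    qed
  qed
  have const: False
    if "norm w = 1" "p \<in> S" "\<And>q. q \<in> S \<Longrightarrow> h w q \<le> h w p" "\<And>q. q \<in> S \<Longrightarrow> h w p \<le> h w q" for w p
    by (rule h_nonconst[OF that(1)]) (use that(3,4) in \<open>force intro: antisym\<close>)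
  obtain w :: "real^'n" where w: "norm w = 1" using vector_choose_size[of 1] by auto
  have "\<not> (ext 1 1 \<and> ext (-1) 1)"
  proof
    assume a: "ext 1 1 \<and> ext (-1) 1"
    obtain b where b: "b \<in> S" "\<And>q. q \<in> S \<Longrightarrow> h w b \<le> h w q" by (rule h_attains_inf) (rule that)
    have "w = g 1 b \<or> w = g (-1) b" by (rule h_extremum[OF w b(1)]) (use b(2) in blast)
    then have "h w q \<le> h w b" if "q \<in> S" for q using a b(1) that unfolding ext_def by force
    from const[OF w b(1) this b(2)] show False .
  qed
  moreover have "\<not> (ext 1 (-1) \<and> ext (-1) (-1))"
  proof
    assume a: "ext 1 (-1) \<and> ext (-1) (-1)"
    obtain b where b: "b \<in> S" "\<And>q. q \<in> S \<Longrightarrow> h w q \<le> h w b" by (rule h_attains) (rule that)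
    have "w = g 1 b \<or> w = g (-1) b" by (rule h_extremum[OF w b(1)]) (use b(2) in blast)
    then have "h w b \<le> h w q" if "q \<in> S" for q using a b(1) that unfolding ext_def by force
    from const[OF w b(1) b(2) this] show False .
  qed
  ultimately obtain \<sigma> where \<sigma>: "\<sigma> = 1 \<or> \<sigma> = (-1::real)" "ext \<sigma> 1" "ext (-\<sigma>) (-1)"
    using side[of 1] side[of "-1"] that[of 1] that[of "-1"] by auto
  have "pure s \<epsilon>" if s: "s = 1 \<or> s = -1" and \<epsilon>: "\<epsilon> = 1 \<or> \<epsilon> = -1" and x: "ext s \<epsilon>" "ext (-s) (-\<epsilon>)" for s \<epsilon>
    unfolding pure_def
  proof (intro conjI ballI allI impI)
    show "\<epsilon> * h (g s p) q \<le> \<epsilon> * h (g s p) p" if "p \<in> S" "q \<in> S" for p q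
      using x(1) that unfolding ext_def by blast
    fix p w assume p: "p \<in> S" and w: "norm w = 1" and m: "\<forall>q\<in>S. \<epsilon> * h w q \<le> \<epsilon> * h w p"
    have "w = g 1 p \<or> w = g (-1) p" by (rule h_extremum[OF w p]) (use m \<epsilon> in auto)
    then consider "w = g s p" | "w = g (- s) p" using s by auto
    then show "w = g s p"
    proof cases
      case 2
      \<comment> \<open>The other Gauss map would make \<open>p\<close> an extremum of the opposite
        kind as well, so that \<open>h w\<close> is constant.\<close>
      then have "\<forall>q\<in>S. \<epsilon> * h w p \<le> \<epsilon> * h w q" using x(2) p unfolding ext_def by simp
      then have "h w q = h w p" if "q \<in> S" for q using m \<epsilon> that by force
      then have False using const[OF w p] by simp
      then show ?thesis ..
    qed
  qed
  then show ?thesis using that[OF \<sigma>(1)] \<sigma> by auto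
qed

text \<open>Distinct causally related points cannot collide: the chord directions converge to a
  tangent vector \<open>d\<close>, and by the mean value theorem the image of \<open>d\<close> would
  satisfy the causal inequality too, although \<open>f\<close> is spacelike.\<close>

lemma causal_limit_distinct:
  assumes \<epsilon>: "\<epsilon> = 1 \<or> \<epsilon> = (-1::real)"
    and ab: "\<And>k. a k \<in> S" "\<And>k. b k \<in> S" "\<And>k. a k \<noteq> b k"
    and causal: "\<And>k. norm (F (b k) - F (a k)) \<le> \<epsilon> * (f0 (b k) - f0 (a k))"
    and lim: "a \<longlonglongrightarrow> p" "b \<longlonglongrightarrow> p" and d: "(\<lambda>k. sgn (b k - a k)) \<longlonglongrightarrow> d"
  shows False
proof -
  have p: "p \<in> S" using closed_sequentially[OF closed_sphere _ lim(1)] ab(1) by blast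
  have "sgn (b k - a k) \<in> S" for k using ab(3)[of k] by (simp add: norm_sgn)
  then have "d \<in> S" using closed_sequentially[OF closed_sphere _ d] by blast
  then have dn: "d \<noteq> 0" by auto
  \<comment> \<open>Both end points are unit vectors, so each chord is orthogonal to their sum; in
    the limit \<open>d\<close> is tangent at \<open>p\<close>.\<close>
  have dp: "d \<bullet> p = 0"
  proof -
    have "sgn (b k - a k) \<bullet> (b k + a k) = 0" for k
      using ab(1)[of k] ab(2)[of k]
      by (simp add: sgn_div_norm inner_simps dot_square_norm inner_commute)
    moreover have "(\<lambda>k. sgn (b k - a k) \<bullet> (b k + a k)) \<longlonglongrightarrow> d \<bullet> (p + p)"
      by (intro tendsto_inner tendsto_add d lim)
    ultimately have "d \<bullet> (p + p) = 0" by (simp add: LIMSEQ_const_iff)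
    then show ?thesis unfolding inner_add_right by simp
  qed
  have sp: "\<bar>f0' p d\<bar> < norm (F' p d)" by (rule spacelike[OF S_nz[OF p] dp dn])
  \<comment> \<open>Testing against \<open>e\<close> replaces the norm by a scalar function with a
    mean value theorem. It weakens the causal inequality, but loses nothing on the limit vector
    \<open>F' p d\<close>.\<close>
  define e where "e = sgn (F' p d)"
  have ne: "norm e \<le> 1" by (simp add: e_def norm_sgn)
  have Fe: "F' p d \<bullet> e = norm (F' p d)"
    by (cases "F' p d = 0") (simp_all add: e_def sgn_div_norm dot_square_norm power2_eq_square)
  define \<psi> where "\<psi> x = F x \<bullet> e - \<epsilon> * f0 x" for x
  define \<psi>' where "\<psi>' x v = F' x v \<bullet> e - \<epsilon> * f0' x v" for x v
  have der: "(\<psi> has_derivative \<psi>' x) (at x)" if "x \<noteq> 0" for x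
    unfolding \<psi>_def[abs_def] \<psi>'_def[abs_def]
    by (intro has_derivative_diff has_derivative_inner_left has_derivative_mult_right der_F der_f0 that)
  have lin: "linear (\<psi>' x)" if "x \<noteq> 0" for x using der[OF that] has_derivative_linear by blast
  have cont: "continuous_on (- {0}) (\<lambda>x. \<psi>' x v)" for v
    unfolding \<psi>'_def by (intro continuous_intros F_der(2) f0_der(2))
  have step: "\<psi> (b k) - \<psi> (a k) \<le> 0" for k
  proof -
    have "(F (b k) - F (a k)) \<bullet> e \<le> norm (F (b k) - F (a k)) * norm e" by (rule norm_cauchy_schwarz)
    also have "\<dots> \<le> norm (F (b k) - F (a k))" using ne by (simp add: mult_left_le)
    also have "\<dots> \<le> \<epsilon> * (f0 (b k) - f0 (a k))" by (rule causal)
    finally show ?thesis by (simp add: \<psi>_def inner_diff_left algebra_simps)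
  qed
  have "\<forall>\<^sub>F k in sequentially. dist (a k) p < 1/2 \<and> dist (b k) p < 1/2"
    using tendstoD[OF lim(1), of "1/2"] tendstoD[OF lim(2), of "1/2"] by (auto intro: eventually_conj)
  then obtain K where K: "\<And>k. k \<ge> K \<Longrightarrow> dist (a k) p < 1/2 \<and> dist (b k) p < 1/2"
    by (auto simp: eventually_sequentially)
  have ex: "\<exists>t\<in>{0..1}. a k + t *\<^sub>R (b k - a k) \<noteq> 0 \<and> \<psi>' (a k + t *\<^sub>R (b k - a k)) (sgn (b k - a k)) \<le> 0" if k: "k \<ge> K" for k
  proof -
    have nz: "a k + t *\<^sub>R (b k - a k) \<noteq> 0" if t: "t \<in> {0..1}" for t
    proof
      assume z: "a k + t *\<^sub>R (b k - a k) = 0"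
      have "(1 - t) *\<^sub>R a k + t *\<^sub>R b k \<in> ball p (1/2)"
        by (rule convexD[OF convex_ball]) (use t K[OF k] in \<open>auto simp: dist_commute\<close>)
      moreover have "(1 - t) *\<^sub>R a k + t *\<^sub>R b k = 0" using z by (simp add: algebra_simps)
      ultimately have "norm p < 1/2" by (simp add: dist_norm)
      then show False using p by simp
    qed
    have "\<exists>t\<in>{0..1}. (\<lambda>t. \<psi> (a k + t *\<^sub>R (b k - a k))) 1 - (\<lambda>t. \<psi> (a k + t *\<^sub>R (b k - a k))) 0 =
        (\<lambda>t s. \<psi>' (a k + t *\<^sub>R (b k - a k)) (s *\<^sub>R (b k - a k))) t (1 - 0)"
    proof (rule mvt_very_simple)
      fix t :: real assume t: "0 \<le> t" "t \<le> 1"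
      have "((\<lambda>t. a k + t *\<^sub>R (b k - a k)) has_derivative (\<lambda>s. s *\<^sub>R (b k - a k))) (at t within {0..1})"
        by (auto intro!: derivative_eq_intros)
      from has_derivative_compose[OF this der[OF nz]] t
      show "((\<lambda>t. \<psi> (a k + t *\<^sub>R (b k - a k))) has_derivative (\<lambda>s. \<psi>' (a k + t *\<^sub>R (b k - a k)) (s *\<^sub>R (b k - a k)))) (at t within {0..1})"
        by simp
    qed simp
    then obtain t where t: "t \<in> {0..1}" "\<psi> (b k) - \<psi> (a k) = \<psi>' (a k + t *\<^sub>R (b k - a k)) (b k - a k)" by auto
    have "\<psi>' (a k + t *\<^sub>R (b k - a k)) (sgn (b k - a k)) \<le> 0"
      unfolding sgn_div_norm linear_scale[OF lin[OF nz[OF t(1)]]] t(2)[symmetric] real_scaleR_def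
      using step[of k] by (intro mult_nonneg_nonpos) auto
    then show ?thesis using t(1) nz by blast
  qed
  then obtain t where t: "\<And>k. k \<ge> K \<Longrightarrow> t k \<in> {0..1}" "\<And>k. k \<ge> K \<Longrightarrow> a k + t k *\<^sub>R (b k - a k) \<noteq> 0"
    "\<And>k. k \<ge> K \<Longrightarrow> \<psi>' (a k + t k *\<^sub>R (b k - a k)) (sgn (b k - a k)) \<le> 0"
    by metis
  define \<xi> where "\<xi> k = a k + t k *\<^sub>R (b k - a k)" for k
  have \<xi>lim: "\<xi> \<longlonglongrightarrow> p"
  proof -
    have z: "(\<lambda>k. b k - a k) \<longlonglongrightarrow> 0" using tendsto_diff[OF lim(2,1)] by simp
    have "(\<lambda>k. t k *\<^sub>R (b k - a k)) \<longlonglongrightarrow> 0"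
    proof (rule Lim_null_comparison[OF _ tendsto_norm_zero[OF z]])
      show "\<forall>\<^sub>F k in sequentially. norm (t k *\<^sub>R (b k - a k)) \<le> norm (b k - a k)"
        unfolding eventually_sequentially
        by (rule exI[of _ K]) (use t(1) in \<open>auto intro!: mult_left_le_one_le\<close>)
    qed
    from tendsto_add[OF lim(1) this] show ?thesis by (simp add: \<xi>_def[abs_def])
  qed
  have t\<psi>: "(\<lambda>k. \<psi>' (\<xi> k) v) \<longlonglongrightarrow> \<psi>' p v" for v
  proof -
    have "isCont (\<lambda>x. \<psi>' x v) p" using cont[of v] S_nz[OF p] unfolding continuous_on_eq_continuous_at[OF open_nz] by blast
    then show ?thesis by (rule isCont_tendsto_compose[OF _ \<xi>lim])
  qed
  \<comment> \<open>Base point and direction vary together, while continuity of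
    \<open>\<psi>'\<close> is known for fixed directions only; the basis expansion separates the
    two.\<close>
  have exp: "\<psi>' x v = (\<Sum>i\<in>Basis. (v \<bullet> i) * \<psi>' x i)" if "x \<noteq> 0" for x v
    by (subst (1) euclidean_representation[symmetric])
      (simp only: linear_sum[OF lin[OF that]] linear_scale[OF lin[OF that]] real_scaleR_def)
  have "(\<lambda>k. \<Sum>i\<in>Basis. (sgn (b k - a k) \<bullet> i) * \<psi>' (\<xi> k) i) \<longlonglongrightarrow> (\<Sum>i\<in>Basis. (d \<bullet> i) * \<psi>' p i)"
    by (intro tendsto_sum tendsto_mult tendsto_inner d tendsto_const t\<psi>)
  moreover have "\<forall>\<^sub>F k in sequentially. (\<Sum>i\<in>Basis. (sgn (b k - a k) \<bullet> i) * \<psi>' (\<xi> k) i) \<le> 0"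
    unfolding eventually_sequentially
  proof (intro exI allI impI)
    fix k assume k: "K \<le> k"
    have "\<psi>' (\<xi> k) (sgn (b k - a k)) \<le> 0" unfolding \<xi>_def by (rule t(3)[OF k])
    moreover have "\<xi> k \<noteq> 0" unfolding \<xi>_def by (rule t(2)[OF k])
    ultimately show "(\<Sum>i\<in>Basis. (sgn (b k - a k) \<bullet> i) * \<psi>' (\<xi> k) i) \<le> 0"
      using exp[of "\<xi> k" "sgn (b k - a k)"] by linarith
  qed
  ultimately have "(\<Sum>i\<in>Basis. (d \<bullet> i) * \<psi>' p i) \<le> 0"
    by (rule tendsto_upperbound) simp
  then have "\<psi>' p d \<le> 0" using exp[OF S_nz[OF p], of d] by linarith
  then have "norm (F' p d) \<le> \<epsilon> * f0' p d" by (simp add: \<psi>'_def Fe)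
  also have "\<dots> \<le> \<bar>f0' p d\<bar>" using \<epsilon> by auto
  finally show False using sp by simp
qed

text \<open>\<open>T\<close> consists of the points with no other point of the sphere in their
  causal future (past, if \<epsilon> is -1). It is open since related pairs persist in limits
  without colliding, closed since a related point can be continued to neighbouring base points, and
  contains a maximum of \<open>\<epsilon> * f0\<close>. The relation is an inequality because that
  is all purity yields directly for a continued point.\<close>

lemma causal_trivial:
  assumes \<epsilon>: "\<epsilon> = 1 \<or> \<epsilon> = (-1::real)" and s: "s = 1 \<or> s = -1" and pure: "pure s \<epsilon>"
    and pp: "p \<in> S" "p' \<in> S" and le: "norm (F p' - F p) \<le> \<epsilon> * (f0 p' - f0 p)"
  shows "p' = p"
proof -
  define T where "T = {p\<in>S. \<forall>p'\<in>S. norm (F p' - F p) \<le> \<epsilon> * (f0 p' - f0 p) \<longrightarrow> p' = p}"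
  have \<epsilon>\<epsilon>: "\<epsilon> * (\<epsilon> * c) = c" for c using \<epsilon> by auto
  have contF: "continuous_on S F" and contf: "continuous_on S f0" and contg: "continuous_on S (g s)"
    by (rule continuous_on_S, rule cont_F cont_f0 cont_g[OF s])+
  have "closed (S - T)"
  proof (unfold closed_sequential_limits, intro allI impI, elim conjE)
    fix a l assume a: "\<forall>k. a k \<in> S - T" and al: "a \<longlonglongrightarrow> l"
    have lS: "l \<in> S" using closed_sequentially[OF closed_sphere _ al] a by blast
    have "\<forall>k. \<exists>b. b \<in> S \<and> b \<noteq> a k \<and> norm (F b - F (a k)) \<le> \<epsilon> * (f0 b - f0 (a k))"
      using a by (fastforce simp: T_def)
    from choice[OF this] obtain b where
      "\<forall>k. b k \<in> S \<and> b k \<noteq> a k \<and> norm (F (b k) - F (a k)) \<le> \<epsilon> * (f0 (b k) - f0 (a k))" by blast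
    then have b: "\<And>k. b k \<in> S" "\<And>k. b k \<noteq> a k"
      "\<And>k. norm (F (b k) - F (a k)) \<le> \<epsilon> * (f0 (b k) - f0 (a k))" by blast+
    have "seq_compact (S \<times> S :: ((real^'n) \<times> (real^'n)) set)"
      by (intro compact_imp_seq_compact compact_Times compact_sphere)
    moreover have "\<forall>k. (b k, sgn (b k - a k)) \<in> S \<times> S" using b by (simp add: norm_sgn)
    ultimately obtain m r where m: "m \<in> S \<times> S" "strict_mono r" "((\<lambda>k. (b k, sgn (b k - a k))) \<circ> r) \<longlonglongrightarrow> m"
      by (rule seq_compactE) (rule that)
    have bl: "(\<lambda>k. b (r k)) \<longlonglongrightarrow> fst m" and dl: "(\<lambda>k. sgn (b (r k) - a (r k))) \<longlonglongrightarrow> snd m"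
      using tendsto_fst[OF m(3)] tendsto_snd[OF m(3)] by (simp_all add: o_def)
    have arl: "(\<lambda>k. a (r k)) \<longlonglongrightarrow> l" using LIMSEQ_subseq_LIMSEQ[OF al m(2)] by (simp add: o_def)
    have mS: "fst m \<in> S" using m(1) by auto
    have tF: "(\<lambda>k. F (c k)) \<longlonglongrightarrow> F z" "(\<lambda>k. f0 (c k)) \<longlonglongrightarrow> f0 z"
      if "c \<longlonglongrightarrow> z" "z \<in> S" "\<And>k. c k \<in> S" for c z
      using contF contf that by (auto simp: continuous_on_sequentially o_def)
    have aS: "a k \<in> S" for k using a by blast
    have "norm (F (fst m) - F l) \<le> \<epsilon> * (f0 (fst m) - f0 l)"
    proof (rule LIMSEQ_le)
      show "(\<lambda>k. norm (F (b (r k)) - F (a (r k)))) \<longlonglongrightarrow> norm (F (fst m) - F l)"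
        by (intro tendsto_norm tendsto_diff tF bl arl mS lS b aS)
      show "(\<lambda>k. \<epsilon> * (f0 (b (r k)) - f0 (a (r k)))) \<longlonglongrightarrow> \<epsilon> * (f0 (fst m) - f0 l)"
        by (intro tendsto_mult tendsto_const tendsto_diff tF bl arl mS lS b aS)
      show "\<exists>N. \<forall>n\<ge>N. norm (F (b (r n)) - F (a (r n))) \<le> \<epsilon> * (f0 (b (r n)) - f0 (a (r n)))"
        using b(3) by blast
    qed
    moreover have "fst m \<noteq> l"
    proof
      assume e: "fst m = l"
      show False
        by (rule causal_limit_distinct[OF \<epsilon>, of "\<lambda>k. a (r k)" "\<lambda>k. b (r k)", OF aS b(1) _ b(3) arl _ dl])
          (use b(2) bl e in \<open>auto simp: eq_commute\<close>)
    qed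
    ultimately show "l \<in> S - T" using lS mS by (auto simp: T_def)
  qed
  then have opT: "openin (top_of_set S) T"
  proof -
    assume "closed (S - T)"
    then have "openin (top_of_set S) (S \<inter> - (S - T))" by (intro openin_open_Int open_Compl)
    moreover have "S \<inter> - (S - T) = T" by (auto simp: T_def)
    ultimately show ?thesis by simp
  qed
  have opC: "\<exists>d>0. \<forall>p2\<in>S. dist p2 p1 < d \<longrightarrow> p2 \<notin> T" if p1: "p1 \<in> S" "p1 \<notin> T" for p1
  proof -
    obtain p' where p': "p' \<in> S" "p' \<noteq> p1" "norm (F p' - F p1) \<le> \<epsilon> * (f0 p' - f0 p1)"
      using p1 by (auto simp: T_def)
    define w where "w = g s p'"
    have w: "norm w = 1" unfolding w_def by (rule norm_g[OF S_nz[OF p'(1)] s])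
    let ?\<Delta> = "F p' - F p1"
    \<comment> \<open>Purity at \<open>p'\<close> reverses the causal inequality, so Cauchy-Schwarz
      holds with equality and the chord is lightlike in direction \<open>w\<close>.\<close>
    have "\<epsilon> * h w p1 \<le> \<epsilon> * h w p'" unfolding w_def by (rule pureD1[OF pure p'(1) p1(1)])
    then have 1: "\<epsilon> * (f0 p' - f0 p1) \<le> (\<epsilon> *\<^sub>R ?\<Delta>) \<bullet> w"
      by (simp add: h_def inner_diff_left algebra_simps)
    have n\<epsilon>: "norm (\<epsilon> *\<^sub>R ?\<Delta>) = norm ?\<Delta>" using \<epsilon> by auto
    have 2: "(\<epsilon> *\<^sub>R ?\<Delta>) \<bullet> w \<le> norm ?\<Delta>"
      using norm_cauchy_schwarz[of "\<epsilon> *\<^sub>R ?\<Delta>" w] unfolding n\<epsilon> w mult_1_right .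
    have eq: "(\<epsilon> *\<^sub>R ?\<Delta>) \<bullet> w = norm ?\<Delta>" "\<epsilon> * (f0 p' - f0 p1) = norm ?\<Delta>"
      using 1 2 p'(3) by linarith+
    have \<Delta>: "\<epsilon> *\<^sub>R ?\<Delta> = norm ?\<Delta> *\<^sub>R w"
    proof -
      have "norm ?\<Delta> *\<^sub>R w = 1 *\<^sub>R (\<epsilon> *\<^sub>R ?\<Delta>)"
        using norm_cauchy_schwarz_eq[of "\<epsilon> *\<^sub>R ?\<Delta>" w] eq(1) unfolding n\<epsilon> w mult_1_right by blast
      then show ?thesis by simp
    qed
    have pos: "norm ?\<Delta> > 0"
    proof (rule ccontr)
      assume "\<not> norm ?\<Delta> > 0"
      then have "F p' = F p1" by simp
      moreover have "f0 p' = f0 p1" using eq(2) \<epsilon> calculation by auto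
      ultimately show False using inj_f[OF p'(1) p1(1)] p'(2) by blast
    qed
    have hh: "\<epsilon> * h w p1 = \<epsilon> * h w p'"
      using eq unfolding h_def inner_scaleR_left inner_diff_left right_diff_distrib by linarith
    \<comment> \<open>\<open>p1\<close> has the same height as the extremum \<open>p'\<close> and is
      therefore extremal itself; the second clause of \<open>pure\<close> identifies its Gauss
      image.\<close>
    have wp: "w = g s p1"
    proof (rule pureD2[OF pure p1(1) w])
      show "\<epsilon> * h w q \<le> \<epsilon> * h w p1" if "q \<in> S" for q
        unfolding hh unfolding w_def by (rule pureD1[OF pure p'(1) that])
    qed
    have max': "(\<forall>q\<in>S. h w q \<le> h w p') \<or> (\<forall>q\<in>S. h w p' \<le> h w q)"
      using pureD1[OF pure p'(1), folded w_def] \<epsilon> by auto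
    have con: "F' p' u \<bullet> w = f0' p' u" for u by (rule extremum_conormal[OF p'(1) max'])
    obtain B where B: "linear B" "A w p' \<circ> B = id"
      using linear_surjective_right_inverse[OF lin_A[OF S_nz[OF p'(1)]] surj_A[OF S_nz[OF p'(1)] w con]] by blast
    (* A zero (a, x) of P has |x| = 1 and F x - F a parallel to g s a; solving for x with a near p1
       continues the point p' that lies in the causal future of p1. *)
    define u where "u z = F (snd z) - F (fst z)" for z
    define P where "P z = u z - (u z \<bullet> g s (fst z)) *\<^sub>R g s (fst z) + (norm (snd z) - 1) *\<^sub>R g s (fst z)" for z
    define du where "du \<zeta> = F' p' (snd \<zeta>) - F' p1 (fst \<zeta>)" for \<zeta>
    define dP where "dP \<zeta> = du \<zeta> - ((u (p1, p') \<bullet> w) *\<^sub>R g' s p1 (fst \<zeta>) +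
       (u (p1, p') \<bullet> g' s p1 (fst \<zeta>) + du \<zeta> \<bullet> w) *\<^sub>R w)
       + ((norm p' - 1) *\<^sub>R g' s p1 (fst \<zeta>) + (snd \<zeta> \<bullet> sgn p') *\<^sub>R w)" for \<zeta>
    have nz1: "p1 \<noteq> 0" and nz': "p' \<noteq> 0" by (rule S_nz[OF p1(1)], rule S_nz[OF p'(1)])
    have dF: "((\<lambda>z. F (snd z)) has_derivative (\<lambda>\<zeta>. F' p' (snd \<zeta>))) (at (p1, p'))"
      "((\<lambda>z. F (fst z)) has_derivative (\<lambda>\<zeta>. F' p1 (fst \<zeta>))) (at (p1, p'))"
      "((\<lambda>z. g s (fst z)) has_derivative (\<lambda>\<zeta>. g' s p1 (fst \<zeta>))) (at (p1, p'))"
      "((\<lambda>z. norm (snd z)) has_derivative (\<lambda>\<zeta>. snd \<zeta> \<bullet> sgn p')) (at (p1, p'))"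
      using has_derivative_compose[of snd snd "(p1, p')" UNIV F "F' p'"]
        has_derivative_compose[of fst fst "(p1, p')" UNIV F "F' p1"]
        has_derivative_compose[of fst fst "(p1, p')" UNIV "g s" "g' s p1"]
        has_derivative_compose[of snd snd "(p1, p')" UNIV norm "\<lambda>\<zeta>. \<zeta> \<bullet> sgn p'"]
        der_F[OF nz1] der_F[OF nz'] der_g[OF s nz1] has_derivative_norm[OF nz']
      by (simp_all add: bounded_linear_imp_has_derivative bounded_linear_fst bounded_linear_snd inner_commute)
    have du: "(u has_derivative du) (at (p1, p'))"
      unfolding u_def[abs_def] du_def[abs_def] by (rule has_derivative_diff[OF dF(1,2)])
    have dP: "(P has_derivative dP) (at (p1, p'))"
    proof -
      have "(P has_derivative (\<lambda>\<zeta>. du \<zeta> - ((u (p1, p') \<bullet> g s (fst (p1, p'))) *\<^sub>R g' s p1 (fst \<zeta>) +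
       (u (p1, p') \<bullet> g' s p1 (fst \<zeta>) + du \<zeta> \<bullet> g s (fst (p1, p'))) *\<^sub>R g s (fst (p1, p')))
       + ((norm (snd (p1, p')) - 1) *\<^sub>R g' s p1 (fst \<zeta>) + (snd \<zeta> \<bullet> sgn p' - 0) *\<^sub>R g s (fst (p1, p'))))) (at (p1, p'))"
        unfolding P_def[abs_def]
        by (rule has_derivative_add[OF has_derivative_diff[OF du has_derivative_scaleR[OF has_derivative_inner[OF du dF(3)] dF(3)]]
            has_derivative_scaleR[OF has_derivative_diff[OF dF(4) has_derivative_const] dF(3)]])
      then show ?thesis by (simp add: dP_def[abs_def] wp)
    qed
    \<comment> \<open>Keeping the base point as a component turns the implicit function problem into
      openness at a single point, for which continuity and a right invertible derivative there
      suffice.\<close>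
    define \<Psi> where "\<Psi> z = (fst z, P z)" for z :: "(real^'n) \<times> (real^'n)"
    have d\<Psi>: "(\<Psi> has_derivative (\<lambda>\<zeta>. (fst \<zeta>, dP \<zeta>))) (at (p1, p'))"
      unfolding \<Psi>_def[abs_def] by (intro has_derivative_Pair dP has_derivative_fst has_derivative_ident)
    have lindP: "linear dP" using dP has_derivative_linear by blast
    have dPA: "dP (0, \<xi>) = A w p' \<xi>" for \<xi>
      using p'(1) linear_0[OF lin_F'[OF nz1]] linear_0[OF lin_g'[OF s nz1]]
      by (simp add: dP_def du_def A_def S_sgn)
    \<comment> \<open>The derivative of \<Psi> is block triangular with diagonal blocks the identity
      and \<open>A w p'\<close>; this is its right inverse, built from \<open>B\<close>.\<close>
    define R where "R \<zeta> = (fst \<zeta>, B (snd \<zeta> - dP (fst \<zeta>, 0)))" for \<zeta> :: "(real^'n) \<times> (real^'n)"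
    have "bounded_linear R"
    proof -
      have "bounded_linear (\<lambda>\<zeta> :: (real^'n) \<times> (real^'n). (fst \<zeta>, 0 :: real^'n))"
        by (rule bounded_linear_Pair[OF bounded_linear_fst bounded_linear_zero])
      then have "bounded_linear (\<lambda>\<zeta> :: (real^'n) \<times> (real^'n). dP (fst \<zeta>, 0))"
        by (rule bounded_linear_compose[OF has_derivative_bounded_linear[OF dP]])
      then have bl: "bounded_linear (\<lambda>\<zeta>. snd \<zeta> - dP (fst \<zeta>, 0))"
        by (rule bounded_linear_sub[OF bounded_linear_snd])
      have "bounded_linear B" using B(1) by (simp add: linear_conv_bounded_linear)
      from bounded_linear_Pair[OF bounded_linear_fst bounded_linear_compose[OF this bl]]
      show ?thesis unfolding R_def[abs_def] .
    qed
    moreover have "(\<lambda>\<zeta>. (fst \<zeta>, dP \<zeta>)) \<circ> R = id"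
    proof
      fix \<zeta> :: "(real^'n) \<times> (real^'n)"
      have "dP (R \<zeta>) = dP (fst \<zeta>, 0) + dP (0, B (snd \<zeta> - dP (fst \<zeta>, 0)))"
        unfolding R_def linear_add[OF lindP, symmetric] by simp
      also have "\<dots> = snd \<zeta>" using B(2) by (simp add: dPA fun_eq_iff)
      finally show "((\<lambda>\<zeta>. (fst \<zeta>, dP \<zeta>)) \<circ> R) \<zeta> = id \<zeta>" by (simp add: R_def prod_eq_iff)
    qed
    \<comment> \<open>The sign condition keeps the continued point strictly on the same side of its
      base point along the null direction, so the two cannot coincide.\<close>
    moreover define Q where "Q = ((- {0}) \<times> (- {0})) \<inter> (\<lambda>z. \<epsilon> * (u z \<bullet> g s (fst z))) -` {0<..}"
    have c1: "continuous_on ((- {0}) \<times> (- {0})) (\<lambda>z. F (fst z))" "continuous_on ((- {0}) \<times> (- {0})) (\<lambda>z. F (snd z))"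
      "continuous_on ((- {0}) \<times> (- {0})) (\<lambda>z. g s (fst z))"
      by (rule continuous_on_compose2[OF cont_F] continuous_on_compose2[OF cont_g[OF s]];
          auto intro: continuous_on_fst continuous_on_snd continuous_on_id)+
    have c2: "continuous_on ((- {0}) \<times> (- {0})) u" unfolding u_def[abs_def] by (intro continuous_on_diff c1)
    have Qo: "open Q" unfolding Q_def
      by (rule continuous_open_preimage) (auto intro!: continuous_on_mult continuous_on_inner c1 c2 continuous_on_const open_Times)
    have c\<Psi>: "continuous_on Q \<Psi>"
      unfolding \<Psi>_def[abs_def] P_def[abs_def]
      by (rule continuous_on_subset[of "(- {0}) \<times> (- {0})"])
        (auto simp: Q_def intro!: continuous_intros c1 c2)
    have Qp: "(p1, p') \<in> Q"
    proof -
      have "\<epsilon> * (?\<Delta> \<bullet> w) = norm ?\<Delta>" using eq(1) by simp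
      then have "\<epsilon> * (u (p1, p') \<bullet> g s p1) > 0" using pos wp by (simp add: u_def)
      then show ?thesis using nz1 nz' by (simp add: Q_def)
    qed
    ultimately have "\<Psi> (p1, p') \<in> interior (\<Psi> ` Q)"
      by (intro sussmann_open_mapping[OF Qo c\<Psi> Qp d\<Psi>]) (auto simp: interior_open[OF Qo] Qp)
    moreover have "\<Psi> (p1, p') = (p1, 0)"
    proof -
      have "u (p1, p') = \<epsilon> *\<^sub>R (\<epsilon> *\<^sub>R ?\<Delta>)" using \<epsilon> by (auto simp: u_def)
      also have "\<dots> = (\<epsilon> * norm ?\<Delta>) *\<^sub>R w" by (simp only: \<Delta> scaleR_scaleR)
      finally show ?thesis
        using p'(1) w by (simp add: \<Psi>_def P_def wp[symmetric] dot_square_norm)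
    qed
    ultimately obtain d where d: "d > 0" "ball (p1, 0) d \<subseteq> \<Psi> ` Q"
      by (metis mem_interior)
    have "p2 \<notin> T" if p2: "p2 \<in> S" "dist p2 p1 < d" for p2
    proof
      assume p2T: "p2 \<in> T"
      have "(p2, 0) \<in> ball (p1, 0) d" using p2(2) by (simp add: dist_Pair_Pair dist_commute)
      then obtain z where z: "z \<in> Q" "\<Psi> z = (p2, 0)" using d(2) by auto
      define x where "x = snd z"
      have fz: "fst z = p2" "P z = 0" using z(2) by (auto simp: \<Psi>_def)
      define gg where "gg = g s p2"
      have n: "gg \<bullet> gg = 1" unfolding gg_def using norm_g[OF S_nz[OF p2(1)] s] by (simp add: dot_square_norm)
      have Pz: "u z - (u z \<bullet> gg) *\<^sub>R gg + (norm x - 1) *\<^sub>R gg = 0"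
        using fz(2) by (simp add: P_def fz(1) gg_def x_def)
      have "(u z - (u z \<bullet> gg) *\<^sub>R gg + (norm x - 1) *\<^sub>R gg) \<bullet> gg = 0" unfolding Pz by simp
      then have nx: "norm x = 1" using n by (simp add: inner_simps)
      then have xS: "x \<in> S" by simp
      define \<nu> where "\<nu> = u z \<bullet> gg"
      have uz: "u z = F x - F p2" by (simp add: u_def x_def fz(1))
      have dF': "F x - F p2 = \<nu> *\<^sub>R gg" using Pz nx unfolding uz[symmetric] \<nu>_def by simp
      have \<nu>pos: "\<epsilon> * \<nu> > 0" using z(1) by (auto simp: Q_def \<nu>_def fz(1) gg_def)
      have nd: "norm (F x - F p2) = \<epsilon> * \<nu>"
        unfolding dF' using n \<nu>pos \<epsilon> by (auto simp: norm_eq_sqrt_inner)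
      \<comment> \<open>The spatial chord has length \<open>\<epsilon> * \<nu>\<close>; purity at
        \<open>p2\<close> bounds this by the signed time difference.\<close>
      have "\<epsilon> * h gg x \<le> \<epsilon> * h gg p2" unfolding gg_def by (rule pureD1[OF pure p2(1) xS])
      moreover have "h gg x - h gg p2 = \<nu> - (f0 x - f0 p2)"
        using arg_cong[OF dF', of "\<lambda>v. v \<bullet> gg"] n by (simp add: h_def inner_diff_left)
      ultimately have "\<epsilon> * \<nu> \<le> \<epsilon> * (f0 x - f0 p2)" using \<epsilon> by auto
      then have "norm (F x - F p2) \<le> \<epsilon> * (f0 x - f0 p2)" by (simp only: nd)
      then have "x = p2" using p2T xS by (auto simp: T_def)
      then show False using nd \<nu>pos by auto
    qed
    then show ?thesis using d(1) by blast
  qed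
  have clT: "closedin (top_of_set S) T"
  proof -
    have "openin (top_of_set S) (S - T)"
      unfolding openin_euclidean_subtopology_iff using opC by blast
    then show ?thesis by (auto simp: closedin_def T_def)
  qed
  have conn: "connected (S :: (real^'n) set)" by (rule connected_sphere[OF DIM2])
  have "T \<noteq> {}"
  proof -
    have "continuous_on S (\<lambda>x. \<epsilon> * f0 x)" by (intro continuous_on_mult continuous_on_const contf)
    then obtain p where p: "p \<in> S" "\<forall>q\<in>S. \<epsilon> * f0 q \<le> \<epsilon> * f0 p"
      using continuous_attains_sup[OF compact_sphere S_ne] by blast
    have "q = p" if q: "q \<in> S" "norm (F q - F p) \<le> \<epsilon> * (f0 q - f0 p)" for q
    proof -
      have "\<epsilon> * (f0 q - f0 p) \<le> 0" using bspec[OF p(2) q(1)] by (simp add: right_diff_distrib)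
      then have "norm (F q - F p) = 0" "\<epsilon> * (f0 q - f0 p) = 0" using q(2) norm_ge_zero[of "F q - F p"] by linarith+
      then have "F q = F p" "f0 q = f0 p" using \<epsilon> by auto
      then show ?thesis by (rule inj_f[OF q(1) p(1)])
    qed
    then have "p \<in> T" using p(1) by (auto simp: T_def)
    then show ?thesis by blast
  qed
  then have "T = S" using conn opT clT unfolding connected_clopen by blast
  then have "p \<in> T" using pp(1) by simp
  then show ?thesis using pp(2) le unfolding T_def by blast
qed

text \<open>Let \<open>k x\<close> compare the heights of \<open>x\<close> and \<open>p\<close> in
  the moving direction \<open>g s x\<close>. By purity it has its minimum 0 at \<open>q\<close>, so
  its derivative there vanishes: the chord is orthogonal to the range of \<open>g' s q\<close>. As
  \<open>DG s q\<close> is onto, the chord is parallel to \<open>w\<close>, hence lightlike, and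
  \<open>causal_trivial\<close> applies in one of the two orders.\<close>

lemma null_separated_eq:
  assumes \<epsilon>: "\<epsilon> = 1 \<or> \<epsilon> = (-1::real)" and s: "s = 1 \<or> s = -1" and pure: "pure s \<epsilon>"
    and pq: "p \<in> S" "q \<in> S" and J: "J s q \<noteq> 0" and gpq: "g s p = g s q"
  shows "p = q"
proof -
  define w where "w = g s q"
  have nz: "q \<noteq> 0" by (rule S_nz[OF pq(2)])
  have w: "norm w = 1" unfolding w_def by (rule norm_g[OF nz s])
  have ww: "w \<bullet> w = 1" using w by (simp add: dot_square_norm)
  have hpq: "h w p = h w q"
    using pureD1[OF pure pq] pureD1[OF pure pq(2,1)] \<epsilon> gpq by (auto simp: w_def)
  let ?\<Delta> = "F q - F p"
  define k where "k x = \<epsilon> * (F x \<bullet> g s x - f0 x - (F p \<bullet> g s x - f0 p))" for x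
  have "(k has_derivative (\<lambda>u. \<epsilon> * (F q \<bullet> g' s q u + F' q u \<bullet> g s q - f0' q u - (F p \<bullet> g' s q u - 0)))) (at q)"
    unfolding k_def[abs_def]
    by (intro has_derivative_mult_right has_derivative_diff has_derivative_inner has_derivative_inner_right
        has_derivative_const der_F der_f0 der_g nz s)
  then have dk: "(k has_derivative (\<lambda>u. \<epsilon> * (?\<Delta> \<bullet> g' s q u))) (at q)"
    by (simp add: conormal[OF nz s] inner_diff_left)
  have kmin: "k q \<le> k x" if "x \<in> - {0}" for x
  proof -
    have "\<epsilon> * h (g s (sgn x)) p \<le> \<epsilon> * h (g s (sgn x)) (sgn x)"
      by (rule pureD1[OF pure sgn_S pq(1)]) (use that in simp)
    then have "0 \<le> k x" by (simp add: k_def h_def sgn_inv algebra_simps)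
    moreover have "k q = 0" using hpq by (simp add: k_def h_def w_def)
    ultimately show ?thesis by simp
  qed
  have "(\<lambda>u. \<epsilon> * (?\<Delta> \<bullet> g' s q u)) = (\<lambda>v. 0)"
    by (rule differential_zero_maxmin[OF _ open_nz dk]) (use nz kmin in auto)
  then have "\<epsilon> * (?\<Delta> \<bullet> g' s q u) = 0" for u by (rule fun_cong)
  then have \<Delta>g: "?\<Delta> \<bullet> g' s q u = 0" for u using \<epsilon> by auto
  let ?E = "?\<Delta> - (?\<Delta> \<bullet> w) *\<^sub>R w"
  have E: "?E \<bullet> DG s q u = 0" for u
  proof -
    have "w \<bullet> g' s q u = 0" using g'_perp[OF nz s, of u] by (simp add: w_def inner_commute)
    moreover have "DG s q u = g' s q u + (u \<bullet> q) *\<^sub>R w" using pq(2) S_sgn[OF pq(2)] by (simp add: DG_def w_def)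
    ultimately show ?thesis
      using \<Delta>g[of u] ww unfolding inner_diff_left by (simp add: inner_add_right inner_diff_left algebra_simps)
  qed
  have "inj (DG s q)" using J det_nz_iff_inj[OF lin_DG[OF nz s]] by (simp add: J_def)
  then have "surj (DG s q)" by (rule linear_inj_imp_surj[OF lin_DG[OF nz s]])
  then obtain u where "DG s q u = ?E" by (metis surjD)
  with E[of u] have "?E \<bullet> ?E = 0" by (simp only:)
  then have \<Delta>: "?\<Delta> = (?\<Delta> \<bullet> w) *\<^sub>R w" by simp
  have \<mu>: "?\<Delta> \<bullet> w = f0 q - f0 p" using hpq by (simp add: h_def inner_diff_left)
  have n: "norm (F q - F p) = \<bar>f0 q - f0 p\<bar>" using arg_cong[OF \<Delta>, of norm] w \<mu> by simp
  have n': "norm (F p - F q) = \<bar>f0 q - f0 p\<bar>" using n by (simp add: norm_minus_commute)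
  show ?thesis
  proof (cases "\<epsilon> * (f0 q - f0 p) \<ge> 0")
    case True
    then have "\<bar>f0 q - f0 p\<bar> = \<epsilon> * (f0 q - f0 p)" using \<epsilon> by auto
    then show ?thesis using causal_trivial[OF \<epsilon> s pure pq] n by simp
  next
    case False
    then have "\<bar>f0 q - f0 p\<bar> = \<epsilon> * (f0 p - f0 q)" using \<epsilon> by auto
    then show ?thesis using causal_trivial[OF \<epsilon> s pure pq(2,1)] n' by simp
  qed
qed

lemma pure_attained:
  assumes \<epsilon>: "\<epsilon> = 1 \<or> \<epsilon> = (-1::real)" and pure: "pure s \<epsilon>" and w: "norm w = 1"
  obtains p where "p \<in> S" "g s p = w"
proof -
  have "continuous_on S (\<lambda>x. \<epsilon> * h w x)"
    by (intro continuous_on_mult continuous_on_const continuous_on_S cont_h_fixed)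
  then obtain p where p: "p \<in> S" "\<forall>q\<in>S. \<epsilon> * h w q \<le> \<epsilon> * h w p"
    using continuous_attains_sup[OF compact_sphere S_ne] by blast
  have "w = g s p" by (rule pureD2[OF pure p(1) w]) (use p(2) in blast)
  then show ?thesis using that p(1) by blast
qed

text \<open>\<open>G s\<close> maps the ball onto itself, which bounds the integral from below.
  Conversely, zeros of \<open>J s\<close> do not contribute to it, and on the remaining points
  \<open>G s\<close> is injective by \<open>null_separated_eq\<close>.\<close>

lemma pure_tau:
  assumes \<epsilon>: "\<epsilon> = 1 \<or> \<epsilon> = (-1::real)" and s: "s = 1 \<or> s = -1" and pure: "pure s \<epsilon>"
  shows "tau_l f nT nS s = 1"
proof -
  have "B0 \<subseteq> G s ` B0"
  proof
    fix y assume y: "y \<in> B0"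
    then have "norm (sgn y) = 1" by (simp add: B0_def norm_sgn)
    then obtain p where p: "p \<in> S" "g s p = sgn y" by (rule pure_attained[OF \<epsilon> pure]) (rule that)
    show "y \<in> G s ` B0"
      using B0_scale(4)[OF y p] B0_scale(1)[OF y p(1)] by (intro image_eqI[of _ _ "norm y *\<^sub>R p"]) simp_all
  qed
  then have GB: "G s ` B0 = B0" using norm_G[OF _ s] by (auto simp: B0_def) (metis norm_eq_zero)
  have le: "measure lebesgue B0 \<le> integral B0 (\<lambda>x. \<bar>J s x\<bar>)"
    using image_measure(2)[OF s B0_sets order_refl] by (simp only: GB)
  let ?X = "B0 \<inter> (- {0} \<inter> J s -` (- {0}))"
  have "open (- {0} \<inter> J s -` (- {0}))" by (rule continuous_open_preimage[OF cont_J[OF s] open_nz]) auto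
  then have X: "?X \<in> sets lebesgue" "?X \<subseteq> B0" using B0_sets by auto
  have inj: "inj_on (G s) ?X"
  proof (rule inj_onI)
    fix x y assume x: "x \<in> ?X" and y: "y \<in> ?X" and e: "G s x = G s y"
    have nz: "x \<noteq> 0" "y \<noteq> 0" using x y by auto
    have "sgn x = sgn y"
    proof (rule null_separated_eq[OF \<epsilon> s pure sgn_S[OF nz(1)] sgn_S[OF nz(2)]])
      show "J s (sgn y) \<noteq> 0" using y J_sgn[OF nz(2) s] by simp
      show "g s (sgn x) = g s (sgn y)"
        using arg_cong[OF e, of sgn] sgn_G[OF nz(1) s] sgn_G[OF nz(2) s] by (simp add: sgn_inv)
    qed
    moreover have "norm x = norm y" using arg_cong[OF e, of norm] norm_G[OF nz(1) s] norm_G[OF nz(2) s] by simp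
    moreover have "x = norm x *\<^sub>R sgn x" "y = norm y *\<^sub>R sgn y" using nz by (simp_all add: sgn_div_norm)
    ultimately show "x = y" by metis
  qed
  have "integral ?X (\<lambda>x. \<bar>J s x\<bar>) = measure lebesgue (G s ` ?X)"
    by (rule image_measure(3)[OF s X inj, symmetric])
  also have "\<dots> \<le> measure lebesgue B0"
    by (rule measure_mono_fmeasurable[OF _ fmeasurableD[OF image_measure(1)[OF s X]] B0_lmeasurable])
      (use GB in blast)
  finally have ge: "integral ?X (\<lambda>x. \<bar>J s x\<bar>) \<le> measure lebesgue B0" .
  have "integral ?X (\<lambda>x. \<bar>J s x\<bar>) = integral B0 (\<lambda>x. if x \<in> - {0} \<inter> J s -` (- {0}) then \<bar>J s x\<bar> else 0)"
    by (subst Int_commute) (rule integral_restrict_Int[symmetric])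
  also have "\<dots> = integral B0 (\<lambda>x. \<bar>J s x\<bar>)" by (rule integral_cong) (auto simp: B0_def)
  finally have "integral B0 (\<lambda>x. \<bar>J s x\<bar>) = measure lebesgue B0" using le ge by simp
  then show ?thesis using tau_eq[OF s] measure_B0_pos by simp
qed

lemma convex_tau:
  assumes "N 1 = {}" "N (-1) = {}"
  shows "tau_l f nT nS 1 = 1" "tau_l f nT nS (-1) = 1"
proof -
  obtain \<sigma> where \<sigma>: "\<sigma> = 1 \<or> \<sigma> = -1" "pure \<sigma> 1" "pure (- \<sigma>) (-1)" by (rule convex_pure[OF assms]) (rule that)
  have "tau_l f nT nS \<sigma> = 1" by (rule pure_tau[OF _ \<sigma>(1,2)]) simp
  moreover have "tau_l f nT nS (- \<sigma>) = 1" by (rule pure_tau[OF _ _ \<sigma>(3)]) (use \<sigma>(1) in auto)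
  ultimately show "tau_l f nT nS 1 = 1" "tau_l f nT nS (-1) = 1" using \<sigma>(1) by auto
qed

text \<open>In a Morse direction the preimages under both Gauss maps are regular, so
  \<open>null_separated_eq\<close> makes each unique; one is the maximum, the other the
  minimum.\<close>

lemma convex_tight:
  assumes N: "N 1 = {}" "N (-1) = {}"
  shows "L_tight f"
  unfolding L_tight_def
proof (intro ballI impI)
  fix v :: "real \<times> (real^'n)" assume v: "v \<in> lightcone_plus" and m: "morse (height f v)"
  define w where "w = snd v"
  have vw: "v = (1, w)" using v by (simp add: lightcone_plus_def w_def prod_eq_iff)
  have w: "norm w = 1" using v by (simp add: lightcone_plus_def vw lor_def norm_eq_1)
  obtain \<sigma> where \<sigma>: "\<sigma> = 1 \<or> \<sigma> = -1" "pure \<sigma> 1" "pure (- \<sigma>) (-1)" by (rule convex_pure[OF N]) (rule that)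
  have \<sigma>': "- \<sigma> = 1 \<or> - \<sigma> = -1" using \<sigma>(1) by auto
  have e: "(1::real) = 1 \<or> (1::real) = -1" "(-1::real) = 1 \<or> (-1::real) = -1" by auto
  obtain p where p: "p \<in> S" "g \<sigma> p = w" by (rule pure_attained[OF e(1) \<sigma>(2) w]) (rule that)
  obtain q where q: "q \<in> S" "g (- \<sigma>) q = w" by (rule pure_attained[OF e(2) \<sigma>(3) w]) (rule that)
  have Jp: "J \<sigma> p \<noteq> 0" by (rule morse_imp[OF _ p(1) \<sigma>(1)]) (use m vw p(2) in simp)
  have Jq: "J (- \<sigma>) q \<noteq> 0" by (rule morse_imp[OF _ q(1) \<sigma>']) (use m vw q(2) in simp)
  have up: "x = p" if "x \<in> S" "g \<sigma> x = w" for x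
    by (rule null_separated_eq[OF e(1) \<sigma>(1,2) that(1) p(1) Jp]) (simp add: that(2) p(2))
  have uq: "x = q" if "x \<in> S" "g (- \<sigma>) x = w" for x
    by (rule null_separated_eq[OF e(2) \<sigma>' \<sigma>(3) that(1) q(1) Jq]) (simp add: that(2) q(2))
  have "{x. critical (height f v) x} = {p, q}"
  proof (intro set_eqI iffI)
    fix x assume "x \<in> {x. critical (height f v) x}"
    then have "x \<in> S" "w = g 1 x \<or> w = g (-1) x" unfolding vw mem_Collect_eq critical_iff[OF w] by auto
    then show "x \<in> {p, q}" using up[of x] uq[of x] \<sigma>(1) by auto
  next
    fix x assume "x \<in> {p, q}"
    then show "x \<in> {x. critical (height f v) x}"
      unfolding vw mem_Collect_eq critical_iff[OF w] using p q \<sigma>(1) by auto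
  qed
  moreover have "p \<noteq> q" using g_distinct[OF p(1)] p(2) q(2) \<sigma>(1) by auto
  ultimately show "card {x. critical (height f v) x} = 2" by simp
qed

end

theorem theorem9p2:
  fixes f nT nS :: "real^'n \<Rightarrow> real \<times> (real^'n)"
  assumes "CARD('n) \<ge> 2"
    and "spacelike_embedding f"
    and "normal_frame f nT nS"
  shows "(L_convex f nT nS \<longleftrightarrow> tau_total f nT nS = 2)
    \<and> (tau_total f nT nS = 2 \<longleftrightarrow> L_tight f)
    \<and> (tau_l f nT nS 1 = 1 \<and> tau_l f nT nS (-1) = 1 \<longrightarrow> tau_total f nT nS = 2)
    \<and> ((odd CARD('n) \<or> immersed_embedding (proj0 \<circ> f)) \<longrightarrow>
         tau_total f nT nS = 2 \<longrightarrow> tau_l f nT nS 1 = 1 \<and> tau_l f nT nS (-1) = 1)"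
proof -
  interpret spacelike_sphere f nT nS by (rule spacelike_sphere.intro[OF assms])
  have s: "(1::real) = 1 \<or> (1::real) = -1" "(-1::real) = 1 \<or> (-1::real) = -1" by auto
  \<comment> \<open>The passage from (2) to (4) goes through L-convexity, under which each of the
    two Gauss maps has total curvature 1.\<close>
  have c4: "tau_l f nT nS 1 = 1 \<and> tau_l f nT nS (-1) = 1" if "L_convex f nT nS"
    using that convex_tau unfolding lconvex_iff by blast
  have c3: "L_tight f" if "L_convex f nT nS"
    using that convex_tight unfolding lconvex_iff by blast
  have t1: "L_convex f nT nS" if "tau_total f nT nS = 2"
    unfolding lconvex_iff
    using N_empty[OF s(1) tau_total_imp_flat[OF that s(1)]] N_empty[OF s(2) tau_total_imp_flat[OF that s(2)]] by blast
  have t2: "L_convex f nT nS" if "L_tight f"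
    unfolding lconvex_iff
    using N_empty[OF s(1) tight_imp_flat[OF that s(1)]] N_empty[OF s(2) tight_imp_flat[OF that s(2)]] by blast
  have "tau_total f nT nS = 2" if "tau_l f nT nS 1 = 1 \<and> tau_l f nT nS (-1) = 1"
    using that by (simp add: tau_total_def)
  then show ?thesis using c4 c3 t1 t2 by blast
qed

end
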